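(* Let $p_1p_2\cdots p_k$ be a string in the alphabet $\{1,2\}$. The node word $W(p_1p_2\cdots p_k)$ (the code word of the stratum of $S(k)$ containing the point $N(p_1p_2\cdots p_k)$) can be obtained from $p_1p_2\cdots p_k$ by the following process: divide the string into its (maximal) blocks of equal consecutive symbols; replace the initial block of the symbol $1$ or $2$ by the same-length block of the symbol $R$, and replace each succeeding block by the same-length block of the symbol $V_j$, where $j$ is the beginning position of the block.
   Context: Work over an algebraically closed field $\mathbf{k}$ of characteristic $0$. **Monster tower.** Let $S$ be a nonsingular surface, $S(0)=S$, $\mathcal{B}(0)=TS$. Recursively, $S(k)=\mathbb{P}(\mathcal{B}(k-1))$ is the total space of the bundle of lines in the rank 2 bundle $\mathcal{B}(k-1)\subset TS(k-1)$, with projection $\pi_k:S(k)\to S(k-1)$ (a $\mathbb{P}^1$-bundle). The rank 2 subbundle $\mathcal{B}(k)\subset TS(k)$ consists, at a point $\tilde p$, of the tangent vectors that $d\pi_k$ maps into the line in $T_{\pi_k(\tilde p)}S(k-1)$ represented by $\tilde p$ (vectors mapped to $0$, called vertical vectors, included). **Charts and nodes.** $U\subset S$ is an open set with local coordinates $x_1,x_2$ (so $dx_1,dx_2$ trivialize the cotangent bundle), containing exactly one point with $x_1=x_2=0$, the origin. For $p\in\{1,2\}$ let $\overline{p}=3-p$. For each string $p_1\cdots p_k$ in $\{1,2\}$ there is a chart $\mathcal{C}(p_1\cdots p_k)\cong U\times\mathbb{A}^k$ of $S(k)$ with two active coordinates $x_1(p_1\cdots p_k),x_2(p_1\cdots p_k)$,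 defined recursively: $\mathcal{C}(\varnothing)=U$ with active coordinates $x_i(\varnothing)=x_i$; $\mathcal{C}(p_1\cdots p_k)$ is the set of points of $\pi_k^{-1}(\mathcal{C}(p_1\cdots p_{k-1}))$ representing directions on which $dx_{p_k}(p_1\cdots p_{k-1})\ne0$, and on it $$x_{p_k}(p_1\cdots p_k):=x_{p_k}(p_1\cdots p_{k-1}),\qquad x_{\overline{p_k}}(p_1\cdots p_k):=\frac{dx_{\overline{p_k}}(p_1\cdots p_{k-1})}{dx_{p_k}(p_1\cdots p_{k-1})}.$$ The $k+2$ coordinates on $\mathcal{C}(p_1\cdots p_k)$ are $x_1,x_2$ and $x_{\overline{p_j}}(p_1\cdots p_j)$ for $1\le j\le k$. $N(p_1\cdots p_k)$ denotes the origin of $\mathcal{C}(p_1\cdots p_k)$, the point where all $k+2$ coordinates vanish. **Prolongation.** If $C$ is a curve in $S(j)$ tangent to $\mathcal{B}(j)$ at its nonsingular points, its prolongation is the closure in $S(j+1)=\mathbb{P}(\mathcal{B}(j))$ of the set of tangent directions to $C$ at nonsingular points; this can be iterated. Fibers of $\pi_j:S(j)\to S(j-1)$ are tangent to $\mathcal{B}(j)$. **Stratification.** For $j\ge2$ and $n\ge0$, let $I_j[n]\subset S(j+n)$ be the union of the $(n+1)$-fold prolongations of all fibers of $S(j-1)\to S(j-2)$; $I_j=I_j[0]\subset S(j)$ is the "divisor at infinity" of points representing vertical directions. Each $I_j[n]$ is a copy of $S(j-1)$. A code word of length $k$ is a word $V_{A_1}V_{A_2}\cdots V_{A_k}$ such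 that $A_1=\varnothing$ and, for $j\ge2$, $A_j$ is $\varnothing$, or $j$, or $A_{j-1}$; the symbol $V_\varnothing$ is written $R$. For a code word $W$ of length $k$, let $n_j$ be the number of times $j$ occurs among its subscripts ($2\le j\le k$), and let $I_W=\bigcap_{j=2}^k I_j[n_j-1]\subset S(k)$, where $I_j[n_j-1]$ stands for its full inverse image in $S(k)$ and $I_j[-1]$ means $S(k)$. These are exactly the nonempty intersections of this kind. The stratum of $W$ is $I_W$ minus all the lower-dimensional loci $I_{W'}\subsetneq I_W$; the strata partition $S(k)$. The code word of a point is the code word of its stratum (for $k=0$ it is the empty word). *)

theory Defs
  imports "HOL-Analysis.Abstract_Topology" "HOL-Computational_Algebra.Polynomial"
begin

section \<open>Varieties as spaces with functions\<close>

text \<open>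
  A variety is given by its set of closed points with the Zariski topology, and by the
  predicate \<open>regular X W f\<close>: the restriction of \<open>f\<close> to the open set \<open>W\<close> is a regular function.
  Functions are total HOL functions; their values outside \<open>W\<close> are irrelevant.
\<close>

record ('p, 'k) fspace =
  zariski :: "'p topology"
  regular :: "'p set \<Rightarrow> ('p \<Rightarrow> 'k) \<Rightarrow> bool"

abbreviation points :: "('p, 'k, 'z) fspace_scheme \<Rightarrow> 'p set"
  where "points X \<equiv> topspace (zariski X)"

definition space_with_functions :: "('p, 'k::field) fspace \<Rightarrow> bool" where
  "space_with_functions X \<longleftrightarrow>
     (\<forall>W f. regular X W f \<longrightarrow> openin (zariski X) W) \<and>
     (\<forall>W c. openin (zariski X) W \<longrightarrow> regular X W (\<lambda>_. c)) \<and>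
     (\<forall>W f g. regular X W f \<and> regular X W g \<longrightarrow>
        regular X W (\<lambda>p. f p + g p) \<and> regular X W (\<lambda>p. f p * g p)) \<and>
     (\<forall>W W' f. regular X W f \<and> openin (zariski X) W' \<and> W' \<subseteq> W \<longrightarrow> regular X W' f) \<and>
     (\<forall>W f. openin (zariski X) W \<and>
        (\<forall>p\<in>W. \<exists>W' f'. p \<in> W' \<and> W' \<subseteq> W \<and> regular X W' f' \<and> (\<forall>q\<in>W'. f q = f' q)) \<longrightarrow>
        regular X W f)"

definition open_subspace :: "('p, 'k) fspace \<Rightarrow> 'p set \<Rightarrow> ('p, 'k) fspace" where
  "open_subspace X U =
     \<lparr> zariski = subtopology (zariski X) U,
       regular = (\<lambda>W f. W \<subseteq> U \<and> regular X W f) \<rparr>"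

definition morphism :: "('p, 'k) fspace \<Rightarrow> ('q, 'k) fspace \<Rightarrow> ('p \<Rightarrow> 'q) \<Rightarrow> bool" where
  "morphism X Y \<phi> \<longleftrightarrow>
     continuous_map (zariski X) (zariski Y) \<phi> \<and>
     (\<forall>W g. regular Y W g \<longrightarrow> regular X {p \<in> points X. \<phi> p \<in> W} (\<lambda>p. g (\<phi> p)))"

definition isomorphic :: "('p, 'k) fspace \<Rightarrow> ('q, 'k) fspace \<Rightarrow> bool" where
  "isomorphic X Y \<longleftrightarrow>
     (\<exists>\<phi> \<psi>. morphism X Y \<phi> \<and> morphism Y X \<psi> \<and>
            (\<forall>p\<in>points X. \<psi> (\<phi> p) = p) \<and> (\<forall>q\<in>points Y. \<phi> (\<psi> q) = q))"

text \<open>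
  Affine \<open>n\<close>-space is the set of sequences vanishing from index \<open>n\<close> on; over an infinite field
  a polynomial in \<open>n\<close> variables is the same thing as a polynomial function on it.
\<close>

inductive_set polyfun :: "nat \<Rightarrow> ((nat \<Rightarrow> 'k::field) \<Rightarrow> 'k) set" for n where
  const: "(\<lambda>_. c) \<in> polyfun n"
| coord: "i < n \<Longrightarrow> (\<lambda>y. y i) \<in> polyfun n"
| add: "f \<in> polyfun n \<Longrightarrow> g \<in> polyfun n \<Longrightarrow> (\<lambda>y. f y + g y) \<in> polyfun n"
| mult: "f \<in> polyfun n \<Longrightarrow> g \<in> polyfun n \<Longrightarrow> (\<lambda>y. f y * g y) \<in> polyfun n"

definition zero_locus :: "nat \<Rightarrow> ((nat \<Rightarrow> 'k::field) \<Rightarrow> 'k) set \<Rightarrow> (nat \<Rightarrow> 'k) set" where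
  "zero_locus n F = {y. (\<forall>i\<ge>n. y i = 0) \<and> (\<forall>f\<in>F. f y = 0)}"

definition zariski_of :: "nat \<Rightarrow> ((nat \<Rightarrow> 'k::field) \<Rightarrow> 'k) set \<Rightarrow> (nat \<Rightarrow> 'k) topology" where
  "zariski_of n F = topology_generated_by {{y \<in> zero_locus n F. g y \<noteq> 0} |g. g \<in> polyfun n}"

definition affine_variety :: "nat \<Rightarrow> ((nat \<Rightarrow> 'k::field) \<Rightarrow> 'k) set \<Rightarrow> (nat \<Rightarrow> 'k, 'k) fspace" where
  "affine_variety n F =
     \<lparr> zariski = zariski_of n F,
       regular = (\<lambda>W h. openin (zariski_of n F) W \<and>
         (\<forall>y\<in>W. \<exists>W' f g. openin (zariski_of n F) W' \<and> y \<in> W' \<and> W' \<subseteq> W \<and>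
            f \<in> polyfun n \<and> g \<in> polyfun n \<and> (\<forall>z\<in>W'. g z \<noteq> 0 \<and> h z = f z / g z))) \<rparr>"

definition prevariety :: "('p, 'k::field) fspace \<Rightarrow> bool" where
  "prevariety X \<longleftrightarrow>
     space_with_functions X \<and>
     (\<exists>\<U>. finite \<U> \<and> \<Union>\<U> = points X \<and>
        (\<forall>U\<in>\<U>. openin (zariski X) U \<and>
           (\<exists>n F. F \<subseteq> polyfun n \<and> isomorphic (open_subspace X U) (affine_variety n F))))"

text \<open>The Hausdorff axiom for prevarieties, in its form with equalizers of morphisms.\<close>

definition separated :: "('p, 'k::field) fspace \<Rightarrow> bool" where
  "separated X \<longleftrightarrow>
     (\<forall>n F \<phi> \<psi>. F \<subseteq> polyfun n \<and>
        morphism (affine_variety n F) X \<phi> \<and> morphism (affine_variety n F) X \<psi> \<longrightarrow>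
        closedin (zariski_of n F) {y \<in> zero_locus n F. \<phi> y = \<psi> y})"

definition irreducible_closed :: "'a topology \<Rightarrow> 'a set \<Rightarrow> bool" where
  "irreducible_closed T Z \<longleftrightarrow>
     closedin T Z \<and> Z \<noteq> {} \<and>
     (\<forall>A B. closedin T A \<and> closedin T B \<and> Z = A \<union> B \<longrightarrow> Z = A \<or> Z = B)"

definition krull_dim_ge :: "'a topology \<Rightarrow> nat \<Rightarrow> bool" where
  "krull_dim_ge T n \<longleftrightarrow>
     (\<exists>Z. (\<forall>i\<le>n. irreducible_closed T (Z i)) \<and> (\<forall>i<n. Z i \<subset> Z (Suc i)))"

text \<open>For a prevariety this says that every irreducible component has dimension \<open>n\<close>.\<close>

definition pure_dimension :: "'a topology \<Rightarrow> nat \<Rightarrow> bool" where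
  "pure_dimension T n \<longleftrightarrow>
     (\<forall>W. openin T W \<and> W \<noteq> {} \<longrightarrow>
        krull_dim_ge (subtopology T W) n \<and> \<not> krull_dim_ge (subtopology T W) (Suc n))"


section \<open>Tangent vectors\<close>

text \<open>
  A tangent vector at \<open>p\<close> is a \<open>'k\<close>-linear derivation at \<open>p\<close> on the germs of functions regular
  near \<open>p\<close>. It is extended by 0 to all other functions, so that equality of tangent vectors
  is equality in HOL. For a tangent vector \<open>v\<close>, \<open>v f\<close> is the value of the differential of \<open>f\<close> on \<open>v\<close>.
\<close>

type_synonym ('p, 'k) tvec = "('p \<Rightarrow> 'k) \<Rightarrow> 'k"

definition regular_at :: "('p, 'k) fspace \<Rightarrow> 'p \<Rightarrow> ('p \<Rightarrow> 'k) \<Rightarrow> bool" where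
  "regular_at X p f \<longleftrightarrow> (\<exists>W. p \<in> W \<and> regular X W f)"

definition tangent_space :: "('p, 'k::field) fspace \<Rightarrow> 'p \<Rightarrow> ('p, 'k) tvec set" where
  "tangent_space X p = {v.
     (\<forall>f. \<not> regular_at X p f \<longrightarrow> v f = 0) \<and>
     (\<forall>f g. regular_at X p f \<and> regular_at X p g \<longrightarrow>
        v (\<lambda>q. f q + g q) = v f + v g \<and>
        v (\<lambda>q. f q * g q) = f p * v g + g p * v f) \<and>
     (\<forall>c f. regular_at X p f \<longrightarrow> v (\<lambda>q. c * f q) = c * v f) \<and>
     (\<forall>f g W. regular_at X p f \<and> regular_at X p g \<and> openin (zariski X) W \<and> p \<in> W \<and>
        (\<forall>q\<in>W. f q = g q) \<longrightarrow> v f = v g)}"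

definition is_line :: "('p, 'k::field) tvec set \<Rightarrow> bool" where
  "is_line L \<longleftrightarrow> (\<exists>v. v \<noteq> (\<lambda>f. 0) \<and> L = {(\<lambda>f. c * v f) |c. True})"

definition is_plane :: "('p, 'k::field) tvec set \<Rightarrow> bool" where
  "is_plane P \<longleftrightarrow>
     (\<exists>v w. (\<forall>a b. (\<forall>f. a * v f + b * w f = 0) \<longrightarrow> a = 0 \<and> b = 0) \<and>
            P = {(\<lambda>f. a * v f + b * w f) |a b. True})"

definition differential ::
    "('p, 'k::field) fspace \<Rightarrow> ('p \<Rightarrow> 'p) \<Rightarrow> 'p \<Rightarrow> ('p, 'k) tvec \<Rightarrow> ('p, 'k) tvec" where
  "differential Y \<phi> p v = (\<lambda>g. if regular_at Y (\<phi> p) g then v (\<lambda>q. g (\<phi> q)) else 0)"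

text \<open>The tangent space at \<open>p\<close> of a locally closed subset \<open>C\<close> of \<open>X\<close>.\<close>

definition tangent_to :: "('p, 'k::field) fspace \<Rightarrow> 'p set \<Rightarrow> 'p \<Rightarrow> ('p, 'k) tvec set" where
  "tangent_to X C p = {v \<in> tangent_space X p.
     \<forall>W f. p \<in> W \<and> regular X W f \<and> (\<forall>q\<in>C \<inter> W. f q = 0) \<longrightarrow> v f = 0}"

definition nonsingular_surface :: "('p, 'k::field) fspace \<Rightarrow> bool" where
  "nonsingular_surface X \<longleftrightarrow>
     prevariety X \<and> separated X \<and> pure_dimension (zariski X) 2 \<and>
     (\<forall>p\<in>points X. is_plane (tangent_space X p))"

text \<open>
  Local coordinates \<open>x 1\<close>, \<open>x 2\<close> on \<open>U\<close>: their differentials are a frame of the cotangent bundle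
  over \<open>U\<close>, that is, they are independent at each point, and every differential is a
  combination of them with regular coefficients.
\<close>

definition local_coordinates ::
    "('p, 'k::field) fspace \<Rightarrow> 'p set \<Rightarrow> (nat \<Rightarrow> 'p \<Rightarrow> 'k) \<Rightarrow> bool" where
  "local_coordinates X U x \<longleftrightarrow>
     openin (zariski X) U \<and> regular X U (x 1) \<and> regular X U (x 2) \<and>
     (\<forall>p\<in>U. \<forall>a b. (\<forall>v\<in>tangent_space X p. a * v (x 1) + b * v (x 2) = 0) \<longrightarrow> a = 0 \<and> b = 0) \<and>
     (\<forall>W g. W \<subseteq> U \<and> regular X W g \<longrightarrow>
        (\<exists>a b. regular X W a \<and> regular X W b \<and>
           (\<forall>p\<in>W. \<forall>v\<in>tangent_space X p. v g = a p * v (x 1) + b p * v (x 2))))"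


section \<open>The Monster tower\<close>

text \<open>
  Let \<open>\<delta> q\<close> be the line of tangent vectors represented by a point \<open>q\<close>. The quotient \<open>du/dv\<close> is a
  function of \<open>q\<close>, defined where \<open>dv\<close> does not vanish on \<open>\<delta> q\<close>.
\<close>

definition nonzero_on :: "('p, 'k::field) tvec set \<Rightarrow> ('p \<Rightarrow> 'k) \<Rightarrow> bool" where
  "nonzero_on L v \<longleftrightarrow> (\<exists>w\<in>L. w v \<noteq> 0)"

definition dquotient :: "('p \<Rightarrow> ('p, 'k::field) tvec set) \<Rightarrow> ('p \<Rightarrow> 'k) \<Rightarrow> ('p \<Rightarrow> 'k) \<Rightarrow> 'p \<Rightarrow> 'k" where
  "dquotient \<delta> u v q = (THE c. \<forall>w\<in>\<delta> q. w u = c * w v)"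

text \<open>
  The structure of a variety on the total space of the bundle of lines in \<open>B\<close>, a subbundle of the
  tangent bundle of \<open>X\<close>. Near a point of \<open>X\<close> some differentials \<open>du\<^sub>1, \<dots>, du\<^sub>r\<close> restrict to a frame
  of the dual of \<open>B\<close>; they are homogeneous fiber coordinates of the projective bundle, whose regular
  functions are therefore locally rational in pullbacks from \<open>X\<close> and in the quotients
  \<open>du\<^sub>i/du\<^sub>j\<close>. Here \<open>line_fun X P \<pi> \<delta> W h\<close> says that \<open>h\<close> is such an expression, with \<open>P\<close> the total
  space and \<open>W\<close> an open set on which it is defined. The sets \<open>W\<close> form a basis of the
  Zariski topology.
\<close>

inductive line_fun ::
    "('p, 'k::field) fspace \<Rightarrow> 'p set \<Rightarrow> ('p \<Rightarrow> 'p) \<Rightarrow> ('p \<Rightarrow> ('p, 'k) tvec set) \<Rightarrow>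
     'p set \<Rightarrow> ('p \<Rightarrow> 'k) \<Rightarrow> bool"
  for X P \<pi> \<delta> where
  pullback: "regular X U g \<Longrightarrow> line_fun X P \<pi> \<delta> {q \<in> P. \<pi> q \<in> U} (\<lambda>q. g (\<pi> q))"
| quotient: "regular X U u \<Longrightarrow> regular X U v \<Longrightarrow>
     line_fun X P \<pi> \<delta> {q \<in> P. \<pi> q \<in> U \<and> nonzero_on (\<delta> q) v} (dquotient \<delta> u v)"
| add: "line_fun X P \<pi> \<delta> W f \<Longrightarrow> line_fun X P \<pi> \<delta> W' g \<Longrightarrow>
     line_fun X P \<pi> \<delta> (W \<inter> W') (\<lambda>q. f q + g q)"
| mult: "line_fun X P \<pi> \<delta> W f \<Longrightarrow> line_fun X P \<pi> \<delta> W' g \<Longrightarrow>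
     line_fun X P \<pi> \<delta> (W \<inter> W') (\<lambda>q. f q * g q)"
| inverse: "line_fun X P \<pi> \<delta> W f \<Longrightarrow>
     line_fun X P \<pi> \<delta> {q \<in> W. f q \<noteq> 0} (\<lambda>q. inverse (f q))"

text \<open>\<open>Y\<close>, with projection \<open>\<pi>\<close> and tautological lines \<open>\<delta>\<close>, is the total space of the bundle of
  lines in \<open>B\<close>.\<close>

definition is_line_bundle_space ::
    "('p, 'k::field) fspace \<Rightarrow> ('p \<Rightarrow> ('p, 'k) tvec set) \<Rightarrow>
     ('p, 'k) fspace \<Rightarrow> ('p \<Rightarrow> 'p) \<Rightarrow> ('p \<Rightarrow> ('p, 'k) tvec set) \<Rightarrow> bool" where
  "is_line_bundle_space X B Y \<pi> \<delta> \<longleftrightarrow>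
     bij_betw (\<lambda>q. (\<pi> q, \<delta> q)) (points Y) {(p, L). p \<in> points X \<and> is_line L \<and> L \<subseteq> B p} \<and>
     zariski Y = topology_generated_by {W. \<exists>h. line_fun X (points Y) \<pi> \<delta> W h} \<and>
     (\<forall>W f. regular Y W f \<longleftrightarrow> openin (zariski Y) W \<and>
        (\<forall>q\<in>W. \<exists>W' h. line_fun X (points Y) \<pi> \<delta> W' h \<and> q \<in> W' \<and> (\<forall>r\<in>W \<inter> W'. f r = h r)))"

text \<open>
  HOL has no type that uniformly contains the points \<open>(p, L)\<close> of all levels, so the levels live on
  one type \<open>'p\<close> and \<open>q \<mapsto> (\<pi>\<^sub>k q, line at \<pi>\<^sub>k q)\<close> is a bijection instead of the identity. This determines
  the tower up to unique isomorphism. A tower exists over every nonsingular surface \<open>S\<close> on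
  \<open>'p\<close>: if \<open>S\<close> is nonempty, then it has as many points as \<open>'k\<close>, and so does each level.

  \<open>bproj M k\<close> is \<open>\<pi>\<^sub>k\<close> from level \<open>k\<close> to level \<open>k - 1\<close>, and \<open>dirn M k q\<close> is the line in the tangent
  space of level \<open>k - 1\<close> that \<open>q\<close> represents; both are used for \<open>k \<ge> 1\<close> only.
\<close>

record ('p, 'k) tower =
  level :: "nat \<Rightarrow> ('p, 'k) fspace"
  bproj :: "nat \<Rightarrow> 'p \<Rightarrow> 'p"
  dirn :: "nat \<Rightarrow> 'p \<Rightarrow> ('p, 'k) tvec set"

primrec focal :: "('p, 'k::field) tower \<Rightarrow> nat \<Rightarrow> 'p \<Rightarrow> ('p, 'k) tvec set" where
  "focal M 0 = tangent_space (level M 0)"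
| "focal M (Suc k) = (\<lambda>q. {v \<in> tangent_space (level M (Suc k)) q.
     differential (level M k) (bproj M (Suc k)) q v \<in> dirn M (Suc k) q})"

definition monster_tower :: "('p, 'k::field) fspace \<Rightarrow> ('p, 'k) tower \<Rightarrow> bool" where
  "monster_tower S M \<longleftrightarrow>
     level M 0 = S \<and>
     (\<forall>k. is_line_bundle_space (level M k) (focal M k)
            (level M (Suc k)) (bproj M (Suc k)) (dirn M (Suc k)))"

text \<open>The composite projection from level \<open>k\<close> to level \<open>m\<close>, for \<open>m \<le> k\<close>.\<close>

primrec proj_to :: "('p, 'k) tower \<Rightarrow> nat \<Rightarrow> nat \<Rightarrow> 'p \<Rightarrow> 'p" where
  "proj_to M m 0 q = q"
| "proj_to M m (Suc k) q = (if Suc k \<le> m then q else proj_to M m k (bproj M (Suc k) q))"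


section \<open>Charts and nodes\<close>

text \<open>A string \<open>p\<^sub>1 \<dots> p\<^sub>k\<close> is a list \<open>ps\<close>, with \<open>p\<^sub>j = ps ! (j - 1)\<close>.\<close>

definition bar :: "nat \<Rightarrow> nat" where "bar p = 3 - p"

text \<open>\<open>active M x ps k i\<close> is \<open>x\<^sub>i(p\<^sub>1 \<dots> p\<^sub>k)\<close>, and \<open>chart M U x ps k\<close> is \<open>C(p\<^sub>1 \<dots> p\<^sub>k)\<close>.\<close>

primrec active ::
    "('p, 'k::field) tower \<Rightarrow> (nat \<Rightarrow> 'p \<Rightarrow> 'k) \<Rightarrow> nat list \<Rightarrow> nat \<Rightarrow> nat \<Rightarrow> 'p \<Rightarrow> 'k" where
  "active M x ps 0 i = x i"
| "active M x ps (Suc k) i =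
     (if i = ps ! k then (\<lambda>q. active M x ps k (ps ! k) (bproj M (Suc k) q))
      else dquotient (dirn M (Suc k)) (active M x ps k (bar (ps ! k))) (active M x ps k (ps ! k)))"

primrec chart ::
    "('p, 'k::field) tower \<Rightarrow> 'p set \<Rightarrow> (nat \<Rightarrow> 'p \<Rightarrow> 'k) \<Rightarrow> nat list \<Rightarrow> nat \<Rightarrow> 'p set" where
  "chart M U x ps 0 = U"
| "chart M U x ps (Suc k) = {q \<in> points (level M (Suc k)).
     bproj M (Suc k) q \<in> chart M U x ps k \<and>
     nonzero_on (dirn M (Suc k) q) (active M x ps k (ps ! k))}"

definition node ::
    "('p, 'k::field) tower \<Rightarrow> 'p set \<Rightarrow> (nat \<Rightarrow> 'p \<Rightarrow> 'k) \<Rightarrow> nat list \<Rightarrow> 'p" where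
  "node M U x ps = (let k = length ps in
     THE q. q \<in> chart M U x ps k \<and>
       x 1 (proj_to M 0 k q) = 0 \<and> x 2 (proj_to M 0 k q) = 0 \<and>
       (\<forall>j\<in>{1..k}. active M x ps j (bar (ps ! (j - 1))) (proj_to M j k q) = 0))"


section \<open>Prolongation and the stratification\<close>

text \<open>
  A point of a curve \<open>C\<close> is nonsingular iff the tangent space of \<open>C\<close> there is a line. Since
  \<open>dirn M (Suc k) q\<close> is always a line in the rank 2 bundle, the set below consists of the
  tangent directions at the nonsingular points of \<open>C\<close>.
\<close>

definition prolong :: "('p, 'k::field) tower \<Rightarrow> nat \<Rightarrow> 'p set \<Rightarrow> 'p set" where
  "prolong M k C = zariski (level M (Suc k)) closure_of
     {q \<in> points (level M (Suc k)). bproj M (Suc k) q \<in> C \<and>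
        dirn M (Suc k) q = tangent_to (level M k) C (bproj M (Suc k) q)}"

text \<open>\<open>prolong_iter M k n C\<close> is the \<open>n\<close>-fold prolongation, in level \<open>k + n\<close>, of a curve \<open>C\<close> in
  level \<open>k\<close>.\<close>

primrec prolong_iter :: "('p, 'k::field) tower \<Rightarrow> nat \<Rightarrow> nat \<Rightarrow> 'p set \<Rightarrow> 'p set" where
  "prolong_iter M k 0 C = C"
| "prolong_iter M k (Suc n) C = prolong M (k + n) (prolong_iter M k n C)"

text \<open>\<open>fiber M k p\<close> is the fiber of \<open>\<pi>\<^sub>k\<close> over \<open>p\<close>, and \<open>infinity_locus M j n\<close> is \<open>I\<^sub>j[n]\<close>, in level
  \<open>j + n\<close>.\<close>

definition fiber :: "('p, 'k) tower \<Rightarrow> nat \<Rightarrow> 'p \<Rightarrow> 'p set" where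
  "fiber M k p = {q \<in> points (level M k). bproj M k q = p}"

definition infinity_locus :: "('p, 'k::field) tower \<Rightarrow> nat \<Rightarrow> nat \<Rightarrow> 'p set" where
  "infinity_locus M j n =
     (\<Union>p\<in>points (level M (j - 2)). prolong_iter M (j - 1) (n + 1) (fiber M (j - 1) p))"

datatype code_symbol = R | V nat

definition is_code_word :: "code_symbol list \<Rightarrow> bool" where
  "is_code_word w \<longleftrightarrow>
     (w \<noteq> [] \<longrightarrow> w ! 0 = R) \<and>
     (\<forall>j\<in>{2..length w}. w ! (j - 1) \<in> {R, V j, w ! (j - 2)})"

definition word_locus :: "('p, 'k::field) tower \<Rightarrow> code_symbol list \<Rightarrow> 'p set" where
  "word_locus M w = (let k = length w in
     {q \<in> points (level M k). \<forall>j\<in>{2..k}. let n = count_list w (V j) in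
        n > 0 \<longrightarrow> proj_to M (j + (n - 1)) k q \<in> infinity_locus M j (n - 1)})"

definition stratum :: "('p, 'k::field) tower \<Rightarrow> code_symbol list \<Rightarrow> 'p set" where
  "stratum M w = word_locus M w -
     \<Union>{word_locus M w' |w'. is_code_word w' \<and> length w' = length w \<and>
         word_locus M w' \<subset> word_locus M w}"

definition code_word_of :: "('p, 'k::field) tower \<Rightarrow> nat \<Rightarrow> 'p \<Rightarrow> code_symbol list" where
  "code_word_of M k q = (THE w. is_code_word w \<and> length w = k \<and> q \<in> stratum M w)"

definition node_word ::
    "('p, 'k::field) tower \<Rightarrow> 'p set \<Rightarrow> (nat \<Rightarrow> 'p \<Rightarrow> 'k) \<Rightarrow> nat list \<Rightarrow> code_symbol list" where
  "node_word M U x ps = code_word_of M (length ps) (node M U x ps)"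


section \<open>The block process\<close>

function blocks :: "'a list \<Rightarrow> 'a list list" where
  "blocks [] = []"
| "blocks (p # ps) = (p # takeWhile (\<lambda>r. r = p) ps) # blocks (dropWhile (\<lambda>r. r = p) ps)"
  by pat_completeness auto
termination
  by (relation "measure length") (simp_all add: le_imp_less_Suc length_dropWhile_le)

text \<open>The first argument is the position at which the next block begins.\<close>

fun replace_later_blocks :: "nat \<Rightarrow> 'a list list \<Rightarrow> code_symbol list" where
  "replace_later_blocks j [] = []"
| "replace_later_blocks j (b # bs) =
     replicate (length b) (V j) @ replace_later_blocks (j + length b) bs"

fun replace_blocks :: "'a list list \<Rightarrow> code_symbol list" where
  "replace_blocks [] = []"
| "replace_blocks (b # bs) =
     replicate (length b) R @ replace_later_blocks (length b + 1) bs"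

end

theory Submission
  imports Defs
begin

text \<open>
  The code word of a point of a chart can be read off from its coordinates. Let \<open>q\<close> lie in
  \<open>C(p\<^sub>1 \<dots> p\<^sub>k)\<close>, and say that \<open>q\<close> vanishes at position \<open>l\<close> if the coordinate that is new at level
  \<open>l\<close>, namely \<open>x\<^sub>i(p\<^sub>1 \<dots> p\<^sub>l)\<close> with \<open>i = 3 - p\<^sub>l\<close>, is zero at \<open>q\<close>. Then \<open>q\<close> lies over \<open>I\<^sub>j[n]\<close> iff
  \<open>p\<^sub>j = \<dots> = p\<^sub>j\<^sub>+\<^sub>n \<noteq> p\<^sub>j\<^sub>-\<^sub>1\<close> and \<open>q\<close> vanishes at all the positions \<open>j, \<dots>, j + n\<close>
  (\<open>infinity_locus_chart\<close>). At a node every position vanishes, so \<open>j\<close> has to begin a block other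
  than the first, and the longest admissible run is that block: this is the block process.

  The description of \<open>I\<^sub>j[n]\<close> rests on one fact about charts, \<open>chart_frame\<close>: over a chart of level \<open>k\<close>
  the two active coordinates are dual to a frame of the focal bundle consisting of vector fields that
  send regular functions to regular functions. A frame over a chart yields one over each of the two
  charts above it (\<open>frame_lift\<close>). With \<open>s\<close> the new coordinate, the new frame consists of the
  velocities along the fibers \<open>\<pi> = const\<close> and of the images of the tautological directions under the
  local sections \<open>s = const\<close>.

  In a chart of level \<open>j - 1\<close> a fiber is an affine line parametrized by the new coordinate.
  In the direction of its tangent the differential of the other active coordinate, \<open>b\<close>, vanishes.
  So the lift of the fiber to level \<open>j\<close> lies in the chart that exchanges the roles of the two active
  coordinates; there \<open>b\<close> is replaced by a new coordinate, which is zero on the lift, and the parameter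
  stays an active coordinate. From there on the situation repeats itself without a change of roles:
  each further prolongation adds one equation, that the new coordinate vanishes. To compute tangent
  spaces, one needs that functions vanishing on the curve have derivative zero along its
  parametrization by the affine line (\<open>tangent_to_sup\<close>), and conversely that a vector
  annihilated by the differentials of all these functions is a multiple of the velocity
  (\<open>tangent_to_crd\<close>, \<open>tangent_to_focal_0\<close>, \<open>tangent_to_focal_Suc\<close>). The condition so obtained
  is closed, so that the closure in the definition of the prolongation adds no point
  (\<open>prolonged_fiber\<close>).

  It remains to see that the word \<open>word_at\<close> read off from the coordinates is the only code word whose
  stratum contains \<open>q\<close>. A locus \<open>I\<^sub>W\<close> contains \<open>q\<close> iff each \<open>V\<^sub>j\<close> occurs in \<open>W\<close> at most as often as in
  the word of \<open>q\<close> (\<open>word_locus_chart\<close>), a code word of given length is determined by the multiplicities of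
  the \<open>V\<^sub>j\<close> (\<open>code_word_eqI\<close>), and every code word is the word of some point over \<open>U\<close>
  (\<open>word_realized\<close>), so that different words have different loci (\<open>stratum_chart\<close>).
\<close>

section \<open>Functions and tangent vectors\<close>

text \<open>
  A space with functions in which the inverse of a regular function is regular where the function
  does not vanish. In particular the set where a regular function does not vanish is open.
\<close>

definition function_space :: "('p, 'k::field) fspace \<Rightarrow> bool" where
  "function_space X \<longleftrightarrow> space_with_functions X \<and>
     (\<forall>W f. regular X W f \<longrightarrow> regular X {p \<in> W. f p \<noteq> 0} (\<lambda>p. inverse (f p)))"

lemma
  assumes "function_space X"
  shows regular_openin: "regular X W f \<Longrightarrow> openin (zariski X) W"
    and regular_const: "openin (zariski X) W \<Longrightarrow> regular X W (\<lambda>_. c)"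
    and regular_add: "regular X W f \<Longrightarrow> regular X W g \<Longrightarrow> regular X W (\<lambda>p. f p + g p)"
    and regular_mult: "regular X W f \<Longrightarrow> regular X W g \<Longrightarrow> regular X W (\<lambda>p. f p * g p)"
    and regular_restrict:
      "regular X W f \<Longrightarrow> openin (zariski X) W' \<Longrightarrow> W' \<subseteq> W \<Longrightarrow> regular X W' f"
    and regular_glue: "openin (zariski X) W \<Longrightarrow>
      (\<And>p. p \<in> W \<Longrightarrow> \<exists>W' f'. p \<in> W' \<and> W' \<subseteq> W \<and> regular X W' f' \<and> (\<forall>q\<in>W'. f q = f' q)) \<Longrightarrow>
      regular X W f"
proof -
  have 1: "\<forall>W f. regular X W f \<longrightarrow> openin (zariski X) W"
    using assms unfolding function_space_def space_with_functions_def by (elim conjE)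
  show "regular X W f \<Longrightarrow> openin (zariski X) W" using 1 by iprover
  have 2: "\<forall>W c. openin (zariski X) W \<longrightarrow> regular X W (\<lambda>_. c)"
    using assms unfolding function_space_def space_with_functions_def by (elim conjE)
  show "openin (zariski X) W \<Longrightarrow> regular X W (\<lambda>_. c)" using 2 by iprover
  have 3: "\<forall>W f g. regular X W f \<and> regular X W g \<longrightarrow>
        regular X W (\<lambda>p. f p + g p) \<and> regular X W (\<lambda>p. f p * g p)"
    using assms unfolding function_space_def space_with_functions_def by (elim conjE)
  show "regular X W f \<Longrightarrow> regular X W g \<Longrightarrow> regular X W (\<lambda>p. f p + g p)"
    "regular X W f \<Longrightarrow> regular X W g \<Longrightarrow> regular X W (\<lambda>p. f p * g p)"
    using 3[THEN spec, THEN spec, THEN spec, THEN mp, OF conjI] by iprover+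
  have 4: "\<forall>W W' f. regular X W f \<and> openin (zariski X) W' \<and> W' \<subseteq> W \<longrightarrow> regular X W' f"
    using assms unfolding function_space_def space_with_functions_def by (elim conjE)
  show "regular X W f \<Longrightarrow> openin (zariski X) W' \<Longrightarrow> W' \<subseteq> W \<Longrightarrow> regular X W' f"
    using 4[THEN spec, THEN spec, THEN spec, THEN mp, of W f W'] by iprover
  have 5: "\<forall>W f. openin (zariski X) W \<and>
        (\<forall>p\<in>W. \<exists>W' f'. p \<in> W' \<and> W' \<subseteq> W \<and> regular X W' f' \<and> (\<forall>q\<in>W'. f q = f' q)) \<longrightarrow>
        regular X W f"
    using assms unfolding function_space_def space_with_functions_def by (elim conjE)
  show "openin (zariski X) W \<Longrightarrow>
      (\<And>p. p \<in> W \<Longrightarrow> \<exists>W' f'. p \<in> W' \<and> W' \<subseteq> W \<and> regular X W' f' \<and> (\<forall>q\<in>W'. f q = f' q)) \<Longrightarrow>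
      regular X W f"
    by (rule 5[THEN spec, THEN spec, THEN mp]) (intro conjI ballI; assumption?; iprover?)
qed

lemma regular_inverse:
  "function_space X \<Longrightarrow> regular X W f \<Longrightarrow> regular X {p \<in> W. f p \<noteq> 0} (\<lambda>p. inverse (f p))"
  by (simp add: function_space_def)

lemma regular_locally:
  assumes "function_space X"
    and "\<And>p. p \<in> W \<Longrightarrow> \<exists>W' f'. p \<in> W' \<and> W' \<subseteq> W \<and> regular X W' f' \<and> (\<forall>q\<in>W'. f q = f' q)"
  shows "regular X W f"
proof -
  have "openin (zariski X) W"
    by (subst openin_subopen) (meson assms regular_openin)
  then show ?thesis
    by (rule regular_glue[OF assms(1)]) (rule assms(2))
qed

lemma regular_cong:
  assumes "function_space X" "regular X W f" "\<And>q. q \<in> W \<Longrightarrow> g q = f q"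
  shows "regular X W g"
  by (rule regular_locally[OF assms(1)]) (use assms in blast)

lemma openin_nonzero:
  "function_space X \<Longrightarrow> regular X W f \<Longrightarrow> openin (zariski X) {p \<in> W. f p \<noteq> 0}"
  using regular_inverse regular_openin by blast

lemma regular_atI: "p \<in> W \<Longrightarrow> regular X W f \<Longrightarrow> regular_at X p f"
  unfolding regular_at_def by (intro exI conjI)

lemma regular_at_add:
  assumes "function_space X" "regular_at X p f" "regular_at X p g"
  shows "regular_at X p (\<lambda>q. f q + g q)"
proof -
  obtain W W' where W: "p \<in> W" "regular X W f" "p \<in> W'" "regular X W' g"
    using assms unfolding regular_at_def by blast
  then have o: "openin (zariski X) (W \<inter> W')"
    using assms(1) regular_openin by blast
  have "regular X (W \<inter> W') f" "regular X (W \<inter> W') g"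
    using W o regular_restrict[OF assms(1)] by blast+
  then show ?thesis
    unfolding regular_at_def using W regular_add[OF assms(1)] by blast
qed

lemma regular_at_mult:
  assumes "function_space X" "regular_at X p f" "regular_at X p g"
  shows "regular_at X p (\<lambda>q. f q * g q)"
proof -
  obtain W W' where W: "p \<in> W" "regular X W f" "p \<in> W'" "regular X W' g"
    using assms unfolding regular_at_def by blast
  then have o: "openin (zariski X) (W \<inter> W')"
    using assms(1) regular_openin by blast
  have "regular X (W \<inter> W') f" "regular X (W \<inter> W') g"
    using W o regular_restrict[OF assms(1)] by blast+
  then show ?thesis
    unfolding regular_at_def using W regular_mult[OF assms(1)] by blast
qed

lemma regular_at_const: "function_space X \<Longrightarrow> p \<in> points X \<Longrightarrow> regular_at X p (\<lambda>_. c)"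
  unfolding regular_at_def using regular_const[of X "points X"] by blast

lemma regular_at_cong:
  assumes "function_space X" "regular_at X p f" "openin (zariski X) W" "p \<in> W" "\<And>q. q \<in> W \<Longrightarrow> g q = f q"
  shows "regular_at X p g"
proof -
  obtain W' where W: "p \<in> W'" "regular X W' f"
    using assms unfolding regular_at_def by blast
  then have "openin (zariski X) (W \<inter> W')"
    using assms regular_openin by blast
  then have "regular X (W \<inter> W') f"
    using W regular_restrict[OF assms(1)] by blast
  then have "regular X (W \<inter> W') g"
    by (rule regular_cong[OF assms(1)]) (use assms in blast)
  then show ?thesis unfolding regular_at_def using W assms by blast
qed

lemma regular_at_inverse:
  assumes "function_space X" "regular_at X p f" "f p \<noteq> 0"
  shows "regular_at X p (\<lambda>q. inverse (f q))"
proof -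
  obtain W where "p \<in> W" "regular X W f"
    using assms(2) unfolding regular_at_def by blast
  then have "p \<in> {p \<in> W. f p \<noteq> 0}" "regular X {p \<in> W. f p \<noteq> 0} (\<lambda>q. inverse (f q))"
    using regular_inverse[OF assms(1)] assms(3) by auto
  then show ?thesis
    unfolding regular_at_def by (intro exI conjI)
qed

lemma tangent_not_regular: "v \<in> tangent_space X p \<Longrightarrow> \<not> regular_at X p f \<Longrightarrow> v f = 0"
  by (simp add: tangent_space_def)

lemma tangent_add:
  "v \<in> tangent_space X p \<Longrightarrow> regular_at X p f \<Longrightarrow> regular_at X p g \<Longrightarrow>
   v (\<lambda>q. f q + g q) = v f + v g"
  by (simp add: tangent_space_def)

lemma tangent_mult:
  "v \<in> tangent_space X p \<Longrightarrow> regular_at X p f \<Longrightarrow> regular_at X p g \<Longrightarrow>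
   v (\<lambda>q. f q * g q) = f p * v g + g p * v f"
  by (simp add: tangent_space_def)

lemma
  assumes "v \<in> tangent_space X p"
  shows tangent_scale: "regular_at X p f \<Longrightarrow> v (\<lambda>q. c * f q) = c * v f"
    and tangent_eq: "regular_at X p f \<Longrightarrow> regular_at X p g \<Longrightarrow> openin (zariski X) W \<Longrightarrow> p \<in> W \<Longrightarrow>
      \<forall>q\<in>W. f q = g q \<Longrightarrow> v f = v g"
proof -
  have 1: "\<forall>c f. regular_at X p f \<longrightarrow> v (\<lambda>q. c * f q) = c * v f"
    using assms unfolding tangent_space_def by (elim CollectE conjE)
  show "regular_at X p f \<Longrightarrow> v (\<lambda>q. c * f q) = c * v f"
    by (rule 1[THEN spec, THEN spec, THEN mp])
  have 2: "\<forall>f g W. regular_at X p f \<and> regular_at X p g \<and> openin (zariski X) W \<and> p \<in> W \<and>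
        (\<forall>q\<in>W. f q = g q) \<longrightarrow> v f = v g"
    using assms unfolding tangent_space_def by (elim CollectE conjE)
  show "regular_at X p f \<Longrightarrow> regular_at X p g \<Longrightarrow> openin (zariski X) W \<Longrightarrow> p \<in> W \<Longrightarrow>
      \<forall>q\<in>W. f q = g q \<Longrightarrow> v f = v g"
    by (rule 2[THEN spec, THEN spec, THEN spec, THEN mp]) (intro conjI)
qed

lemma tangent_cong:
  assumes "v \<in> tangent_space X p" "function_space X" "regular_at X p f" "openin (zariski X) W"
    "p \<in> W" "\<And>q. q \<in> W \<Longrightarrow> g q = f q"
  shows "v g = v f"
  by (rule tangent_eq[OF assms(1) regular_at_cong[OF assms(2-6)] assms(3-5)]) (simp_all add: assms(6))

lemma tangent_const:
  assumes "function_space X" "p \<in> points X" "v \<in> tangent_space X p"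
  shows "v (\<lambda>_. c) = 0"
proof -
  have r: "regular_at X p (\<lambda>_. c)" for c
    by (rule regular_at_const[OF assms(1,2)])
  have "v (\<lambda>_. 1) = v (\<lambda>_. 1) + v (\<lambda>_. 1)"
    using tangent_mult[OF assms(3) r[of 1] r[of 1]] by (simp only: mult_1)
  then have "v (\<lambda>_. 1) = 0" by (metis add_cancel_right_right)
  moreover have "v (\<lambda>q. c * (\<lambda>_. 1) q) = c * v (\<lambda>_. 1)"
    by (rule tangent_scale[OF assms(3) r])
  ultimately show ?thesis by simp
qed

lemma tangent_locally_const:
  assumes "function_space X" "v \<in> tangent_space X p" "openin (zariski X) W" "p \<in> W"
    "\<And>q. q \<in> W \<Longrightarrow> f q = c"
  shows "v f = 0"
proof -
  have p: "p \<in> points X" using assms openin_subset by blast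
  show ?thesis
    using tangent_cong[OF assms(2,1) regular_at_const[OF assms(1) p, of c] assms(3,4), of f] assms(5)
      tangent_const[OF assms(1) p assms(2)] by simp
qed

lemma tangent_inverse:
  assumes "function_space X" "v \<in> tangent_space X p" "regular_at X p f" "f p \<noteq> 0"
  shows "v (\<lambda>q. inverse (f q)) = - (inverse (f p) * inverse (f p) * v f)"
proof -
  obtain W where W: "p \<in> W" "regular X W f"
    using assms(3) unfolding regular_at_def by blast
  have i: "regular_at X p (\<lambda>q. inverse (f q))"
    by (rule regular_at_inverse[OF assms(1,3,4)])
  have "v (\<lambda>q. f q * inverse (f q)) = 0"
    by (rule tangent_locally_const[OF assms(1,2) openin_nonzero[OF assms(1) W(2)], where c = 1])
      (use W assms in auto)
  then have "f p * v (\<lambda>q. inverse (f q)) + inverse (f p) * v f = 0"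
    using tangent_mult[OF assms(2,3) i] by simp
  then have "inverse (f p) * (f p * v (\<lambda>q. inverse (f q)) + inverse (f p) * v f) = 0" by simp
  then have "v (\<lambda>q. inverse (f q)) + inverse (f p) * inverse (f p) * v f = 0"
    using assms(4) by (simp add: distrib_left mult.assoc[symmetric])
  then show ?thesis by (simp add: eq_neg_iff_add_eq_0)
qed

lemma tangent_combination:
  assumes "v \<in> tangent_space X p" "w \<in> tangent_space X p"
  shows "(\<lambda>f. c * v f + d * w f) \<in> tangent_space X p"
  unfolding tangent_space_def
proof (intro CollectI conjI allI impI; (elim conjE)?)
  fix f g W
  assume *: "regular_at X p f" "regular_at X p g" "openin (zariski X) W" "p \<in> W" "\<forall>q\<in>W. f q = g q"
  have "u f = u g" if "u \<in> tangent_space X p" for u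
    by (rule tangent_eq[OF that *])
  from this[OF assms(1)] this[OF assms(2)]
  show "c * v f + d * w f = c * v g + d * w g" by simp
next
  fix k f assume "regular_at X p f"
  then have "u (\<lambda>q. k * f q) = k * u f" if "u \<in> tangent_space X p" for u
    using tangent_scale[OF that] by simp
  then show "c * v (\<lambda>q. k * f q) + d * w (\<lambda>q. k * f q) = k * (c * v f + d * w f)"
    using assms by (simp add: algebra_simps)
next
  fix f g assume fg: "regular_at X p f" "regular_at X p g"
  show "c * v (\<lambda>q. f q + g q) + d * w (\<lambda>q. f q + g q) = c * v f + d * w f + (c * v g + d * w g)"
    using tangent_add[OF assms(1) fg] tangent_add[OF assms(2) fg] by (simp add: algebra_simps)
  show "c * v (\<lambda>q. f q * g q) + d * w (\<lambda>q. f q * g q) =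
      f p * (c * v g + d * w g) + g p * (c * v f + d * w f)"
    using tangent_mult[OF assms(1) fg] tangent_mult[OF assms(2) fg] by (simp add: algebra_simps)
next
  fix f assume "\<not> regular_at X p f"
  then show "c * v f + d * w f = 0"
    using tangent_not_regular[OF assms(1)] tangent_not_regular[OF assms(2)] by simp
qed

section \<open>Regular maps\<close>

text \<open>
  A morphism defined on the open set \<open>N\<close> only. Outside \<open>N\<close> the function \<open>\<phi>\<close> is arbitrary.
\<close>

definition regular_map ::
  "('z, 'k::field) fspace \<Rightarrow> ('p, 'k) fspace \<Rightarrow> ('z \<Rightarrow> 'p) \<Rightarrow> 'z set \<Rightarrow> bool" where
  "regular_map Z Y \<phi> N \<longleftrightarrow> openin (zariski Z) N \<and> \<phi> ` N \<subseteq> points Y \<and>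
     (\<forall>W g. regular Y W g \<longrightarrow> regular Z {z \<in> N. \<phi> z \<in> W} (\<lambda>z. g (\<phi> z)))"

text \<open>
  The image of the tangent vector \<open>w\<close> at \<open>z\<close> under \<open>\<phi>\<close>; like every tangent vector it is zero on
  functions that are not regular at the point. Unlike in \<open>differential\<close>, the two spaces may
  live on different types.
\<close>

definition pushforward ::
  "('p, 'k::field) fspace \<Rightarrow> ('z \<Rightarrow> 'p) \<Rightarrow> 'z \<Rightarrow> ('z, 'k) tvec \<Rightarrow> ('p, 'k) tvec" where
  "pushforward Y \<phi> z w = (\<lambda>g. if regular_at Y (\<phi> z) g then w (\<lambda>z. g (\<phi> z)) else 0)"

lemma differential_pushforward: "differential Y \<phi> p v = pushforward Y \<phi> p v"
  by (simp add: differential_def pushforward_def)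

lemma regular_mapD:
  "regular_map Z Y \<phi> N \<Longrightarrow> regular Y W g \<Longrightarrow> regular Z {z \<in> N. \<phi> z \<in> W} (\<lambda>z. g (\<phi> z))"
  unfolding regular_map_def by (elim conjE) iprover

lemma regular_map_regular_at:
  assumes "regular_map Z Y \<phi> N" "z \<in> N" "regular_at Y (\<phi> z) g"
  shows "regular_at Z z (\<lambda>z. g (\<phi> z))"
proof -
  obtain W where "\<phi> z \<in> W" "regular Y W g"
    using assms(3) unfolding regular_at_def by blast
  then have "z \<in> {z \<in> N. \<phi> z \<in> W}" "regular Z {z \<in> N. \<phi> z \<in> W} (\<lambda>z. g (\<phi> z))"
    using regular_mapD[OF assms(1)] assms(2) by auto
  then show ?thesis unfolding regular_at_def by (intro exI conjI)
qed

lemma regular_map_vimage: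
  assumes "function_space Z" "function_space Y" "regular_map Z Y \<phi> N" "openin (zariski Y) W"
  shows "openin (zariski Z) {z \<in> N. \<phi> z \<in> W}"
  by (rule regular_openin[OF assms(1) regular_mapD[OF assms(3) regular_const[OF assms(2,4), of 0]]])

lemma pushforward_tangent:
  assumes "function_space Z" "function_space Y" "regular_map Z Y \<phi> N" "z \<in> N"
    and w: "w \<in> tangent_space Z z"
  shows "pushforward Y \<phi> z w \<in> tangent_space Y (\<phi> z)"
proof -
  note r = regular_map_regular_at[OF assms(3,4)]
  have p: "\<phi> z \<in> points Y" using assms unfolding regular_map_def by blast
  have c: "w (\<lambda>z. f (\<phi> z)) = w (\<lambda>z. g (\<phi> z))"
    if "regular_at Y (\<phi> z) f" "regular_at Y (\<phi> z) g" "openin (zariski Y) W" "\<phi> z \<in> W" "\<forall>q\<in>W. f q = g q"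
    for f g W
    by (rule tangent_cong[OF w assms(1) r[OF that(2)] regular_map_vimage[OF assms(1,2,3) that(3)]])
      (use that assms(4) in auto)
  have s: "regular_at Y (\<phi> z) (\<lambda>q. k * f q)" if "regular_at Y (\<phi> z) f" for f k
    using regular_at_mult[OF assms(2) regular_at_const[OF assms(2) p] that] .
  have s': "w (\<lambda>q. k * f (\<phi> q)) = k * w (\<lambda>z. f (\<phi> z))" if "regular_at Y (\<phi> z) f" for f k
    by (rule tangent_scale[OF w r[OF that]])
  show ?thesis
    unfolding tangent_space_def pushforward_def
  proof (intro CollectI conjI allI impI; (elim conjE)?)
    fix f g assume fg: "regular_at Y (\<phi> z) f" "regular_at Y (\<phi> z) g"
    show "(if regular_at Y (\<phi> z) (\<lambda>q. f q + g q) then w (\<lambda>z. f (\<phi> z) + g (\<phi> z)) else 0) =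
        (if regular_at Y (\<phi> z) f then w (\<lambda>z. f (\<phi> z)) else 0) +
        (if regular_at Y (\<phi> z) g then w (\<lambda>z. g (\<phi> z)) else 0)"
      using fg tangent_add[OF w r[OF fg(1)] r[OF fg(2)]] regular_at_add[OF assms(2) fg] by simp
    show "(if regular_at Y (\<phi> z) (\<lambda>q. f q * g q) then w (\<lambda>z. f (\<phi> z) * g (\<phi> z)) else 0) =
        f (\<phi> z) * (if regular_at Y (\<phi> z) g then w (\<lambda>z. g (\<phi> z)) else 0) +
        g (\<phi> z) * (if regular_at Y (\<phi> z) f then w (\<lambda>z. f (\<phi> z)) else 0)"
      using fg tangent_mult[OF w r[OF fg(1)] r[OF fg(2)]] regular_at_mult[OF assms(2) fg] by simp
  next
    fix f g W
    assume *: "regular_at Y (\<phi> z) f" "regular_at Y (\<phi> z) g" "openin (zariski Y) W" "\<phi> z \<in> W"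
      "\<forall>q\<in>W. f q = g q"
    show "(if regular_at Y (\<phi> z) f then w (\<lambda>z. f (\<phi> z)) else 0) =
        (if regular_at Y (\<phi> z) g then w (\<lambda>z. g (\<phi> z)) else 0)"
      unfolding if_P[OF *(1)] if_P[OF *(2)] by (rule c[OF *])
  next
    fix k f assume f: "regular_at Y (\<phi> z) f"
    show "(if regular_at Y (\<phi> z) (\<lambda>q. k * f q) then w (\<lambda>q. k * f (\<phi> q)) else 0) =
        k * (if regular_at Y (\<phi> z) f then w (\<lambda>z. f (\<phi> z)) else 0)"
      using f s[OF f] s'[OF f] by simp
  qed simp
qed

section \<open>The affine line\<close>

text \<open>
  \<open>P/Q\<close> represents \<open>f\<close> on the principal open set \<open>Q \<noteq> 0\<close>, which contains \<open>s\<close> and is contained in \<open>W\<close>.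
\<close>

abbreviation is_fraction ::
    "'k::field set \<Rightarrow> ('k \<Rightarrow> 'k) \<Rightarrow> 'k \<Rightarrow> 'k poly \<Rightarrow> 'k poly \<Rightarrow> bool" where
  "is_fraction W f s P Q \<equiv>
     poly Q s \<noteq> 0 \<and> (\<forall>r. poly Q r \<noteq> 0 \<longrightarrow> r \<in> W \<and> f r = poly P r / poly Q r)"

text \<open>
  The affine line, with the field itself as its set of points. It is the source of the curves below.
\<close>

definition affine_line :: "('k, 'k::field) fspace" where
  "affine_line =
     \<lparr> zariski = topology (\<lambda>W. \<forall>s\<in>W. \<exists>E. poly E s \<noteq> 0 \<and> {r. poly E r \<noteq> 0} \<subseteq> W),
       regular = (\<lambda>W f. \<forall>s\<in>W. \<exists>P Q. is_fraction W f s P Q) \<rparr>"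

lemma openin_affine_line:
  "openin (zariski affine_line) W \<longleftrightarrow> (\<forall>s\<in>W. \<exists>E. poly E s \<noteq> 0 \<and> {r. poly E r \<noteq> 0} \<subseteq> W)"
proof -
  have "istopology (\<lambda>W. \<forall>s\<in>W. \<exists>E::'a poly. poly E s \<noteq> 0 \<and> {r. poly E r \<noteq> 0} \<subseteq> W)"
    unfolding istopology_def
  proof (intro conjI allI impI ballI)
    fix S T s
    assume "\<forall>s\<in>S. \<exists>E::'a poly. poly E s \<noteq> 0 \<and> {r. poly E r \<noteq> 0} \<subseteq> S"
      "\<forall>s\<in>T. \<exists>E::'a poly. poly E s \<noteq> 0 \<and> {r. poly E r \<noteq> 0} \<subseteq> T" "s \<in> S \<inter> T"
    then obtain E F where "poly E s \<noteq> 0" "{r. poly E r \<noteq> 0} \<subseteq> S" "poly F s \<noteq> 0" "{r. poly F r \<noteq> 0} \<subseteq> T"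
      by blast
    then have "poly (E * F) s \<noteq> 0 \<and> {r. poly (E * F) r \<noteq> 0} \<subseteq> S \<inter> T" by auto
    then show "\<exists>E::'a poly. poly E s \<noteq> 0 \<and> {r. poly E r \<noteq> 0} \<subseteq> S \<inter> T" by blast
  next
    fix K s
    assume K: "\<forall>S\<in>K. \<forall>s\<in>S. \<exists>E::'a poly. poly E s \<noteq> 0 \<and> {r. poly E r \<noteq> 0} \<subseteq> S" and "s \<in> \<Union> K"
    then obtain S where S: "S \<in> K" "s \<in> S" by blast
    then obtain E where "poly E s \<noteq> 0" "{r. poly E r \<noteq> 0} \<subseteq> S" using K by meson
    then show "\<exists>E::'a poly. poly E s \<noteq> 0 \<and> {r. poly E r \<noteq> 0} \<subseteq> \<Union> K" using S(1) by blast
  qed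
  then show ?thesis by (simp add: affine_line_def topology_inverse')
qed

lemma points_affine_line [simp]: "points affine_line = (UNIV :: 'k::field set)"
proof -
  have "openin (zariski affine_line) (UNIV :: 'k set)"
    unfolding openin_affine_line by (auto intro: exI[of _ 1])
  then show ?thesis using openin_subset by blast
qed

lemma regular_affine_line:
  "regular affine_line W f \<longleftrightarrow> (\<forall>s\<in>W. \<exists>P Q. is_fraction W f s P Q)"
  by (simp add: affine_line_def)

lemma regular_affine_lineE:
  assumes "regular affine_line W f" "s \<in> W"
  obtains P Q where "poly Q s \<noteq> 0" "\<And>r. poly Q r \<noteq> 0 \<Longrightarrow> r \<in> W \<and> f r = poly P r / poly Q r"
  using assms unfolding regular_affine_line by blast

lemma regular_affine_lineI:
  assumes "\<And>s. s \<in> W \<Longrightarrow> \<exists>P Q. is_fraction W f s P Q"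
  shows "regular affine_line W f"
  using assms unfolding regular_affine_line by blast

lemma function_space_affine_line: "function_space (affine_line :: ('k::field, 'k) fspace)"
  unfolding function_space_def space_with_functions_def
proof (intro conjI allI impI; (elim conjE)?)
  let ?X = "affine_line :: ('k, 'k) fspace"
  fix W :: "'k set" and f
  assume f: "regular ?X W f"
  show "openin (zariski ?X) W"
    unfolding openin_affine_line
  proof
    fix s assume "s \<in> W"
    then obtain P Q where "poly Q s \<noteq> 0" "\<And>r. poly Q r \<noteq> 0 \<Longrightarrow> r \<in> W \<and> f r = poly P r / poly Q r"
      using f regular_affine_lineE by meson
    then show "\<exists>E. poly E s \<noteq> 0 \<and> {r. poly E r \<noteq> 0} \<subseteq> W" by auto
  qed
  show "regular ?X {p \<in> W. f p \<noteq> 0} (\<lambda>p. inverse (f p))"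
  proof (rule regular_affine_lineI)
    fix s assume s: "s \<in> {p \<in> W. f p \<noteq> 0}"
    then obtain P Q where "poly Q s \<noteq> 0" "\<And>r. poly Q r \<noteq> 0 \<Longrightarrow> r \<in> W \<and> f r = poly P r / poly Q r"
      using regular_affine_lineE[OF f, of s] by (metis (no_types, lifting) mem_Collect_eq)
    then have "poly (P * Q) s \<noteq> 0 \<and> (\<forall>r. poly (P * Q) r \<noteq> 0 \<longrightarrow>
        r \<in> {p \<in> W. f p \<noteq> 0} \<and> inverse (f r) = poly (Q * Q) r / poly (P * Q) r)"
      using s by auto
    then show "\<exists>P Q. is_fraction {p \<in> W. f p \<noteq> 0} (\<lambda>r. inverse (f r)) s P Q" by blast
  qed
next
  let ?X = "affine_line :: ('k, 'k) fspace"
  fix W :: "'k set" and c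
  assume W: "openin (zariski ?X) W"
  show "regular ?X W (\<lambda>_. c)"
  proof (rule regular_affine_lineI)
    fix s assume "s \<in> W"
    then obtain E where "poly E s \<noteq> 0" "{r. poly E r \<noteq> 0} \<subseteq> W" using W openin_affine_line by blast
    then show "\<exists>P Q. is_fraction W (\<lambda>_. c) s P Q"
      by (intro exI[of _ "smult c E"] exI[of _ E]) auto
  qed
next
  let ?X = "affine_line :: ('k, 'k) fspace"
  fix W :: "'k set" and f g
  assume fg: "regular ?X W f" "regular ?X W g"
  have ex: "\<exists>P Q P' Q'. poly (Q * Q') s \<noteq> 0 \<and> (\<forall>r. poly (Q * Q') r \<noteq> 0 \<longrightarrow>
      r \<in> W \<and> f r = poly P r / poly Q r \<and> g r = poly P' r / poly Q' r)" if s: "s \<in> W" for s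
  proof -
    obtain P Q where 1: "poly Q s \<noteq> 0" "\<And>r. poly Q r \<noteq> 0 \<Longrightarrow> r \<in> W \<and> f r = poly P r / poly Q r"
      using fg(1) s regular_affine_lineE by meson
    obtain P' Q' where 2: "poly Q' s \<noteq> 0" "\<And>r. poly Q' r \<noteq> 0 \<Longrightarrow> r \<in> W \<and> g r = poly P' r / poly Q' r"
      using fg(2) s regular_affine_lineE by meson
    show ?thesis
      using 1 2 by (intro exI[of _ P] exI[of _ Q] exI[of _ P'] exI[of _ Q']) auto
  qed
  show "regular ?X W (\<lambda>p. f p + g p)"
  proof (rule regular_affine_lineI)
    fix s assume "s \<in> W"
    then obtain P Q P' Q' where *: "poly (Q * Q') s \<noteq> 0" "\<And>r. poly (Q * Q') r \<noteq> 0 \<Longrightarrow>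
      r \<in> W \<and> f r = poly P r / poly Q r \<and> g r = poly P' r / poly Q' r" using ex by meson
    have "r \<in> W \<and> f r + g r = poly (P * Q' + P' * Q) r / poly (Q * Q') r" if "poly (Q * Q') r \<noteq> 0" for r
      using *(2)[OF that] that by (auto simp: field_simps)
    then show "\<exists>P Q. is_fraction W (\<lambda>r. f r + g r) s P Q"
      using *(1) by blast
  qed
  show "regular ?X W (\<lambda>p. f p * g p)"
  proof (rule regular_affine_lineI)
    fix s assume "s \<in> W"
    then obtain P Q P' Q' where *: "poly (Q * Q') s \<noteq> 0" "\<And>r. poly (Q * Q') r \<noteq> 0 \<Longrightarrow>
      r \<in> W \<and> f r = poly P r / poly Q r \<and> g r = poly P' r / poly Q' r" using ex by meson
    have "r \<in> W \<and> f r * g r = poly (P * P') r / poly (Q * Q') r" if "poly (Q * Q') r \<noteq> 0" for r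
      using *(2)[OF that] by simp
    then show "\<exists>P Q. is_fraction W (\<lambda>r. f r * g r) s P Q"
      using *(1) by blast
  qed
next
  let ?X = "affine_line :: ('k, 'k) fspace"
  fix W W' :: "'k set" and f
  assume f: "regular ?X W f" and W': "openin (zariski ?X) W'" "W' \<subseteq> W"
  show "regular ?X W' f"
  proof (rule regular_affine_lineI)
    fix s assume s: "s \<in> W'"
    then have "s \<in> W" using W' by blast
    obtain P Q where 1: "poly Q s \<noteq> 0" "\<And>r. poly Q r \<noteq> 0 \<Longrightarrow> r \<in> W \<and> f r = poly P r / poly Q r"
      using regular_affine_lineE[OF f \<open>s \<in> W\<close>] by metis
    obtain E where 2: "poly E s \<noteq> 0" "{r. poly E r \<noteq> 0} \<subseteq> W'" using W' s openin_affine_line by blast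
    show "\<exists>P Q. is_fraction W' f s P Q"
      using 1 2 by (intro exI[of _ "P * E"] exI[of _ "Q * E"]) auto
  qed
next
  let ?X = "affine_line :: ('k, 'k) fspace"
  fix W :: "'k set" and f
  assume *: "\<forall>p\<in>W. \<exists>W' f'. p \<in> W' \<and> W' \<subseteq> W \<and> regular ?X W' f' \<and> (\<forall>q\<in>W'. f q = f' q)"
  show "regular ?X W f"
  proof (rule regular_affine_lineI)
    fix s assume "s \<in> W"
    from bspec[OF * this] obtain W' f'
      where W': "s \<in> W'" "W' \<subseteq> W" "regular ?X W' f'" "\<forall>q\<in>W'. f q = f' q"
      by (elim exE conjE)
    obtain P Q where "poly Q s \<noteq> 0" "\<And>r. poly Q r \<noteq> 0 \<Longrightarrow> r \<in> W' \<and> f' r = poly P r / poly Q r"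
      using regular_affine_lineE[OF W'(3,1)] by metis
    then have "is_fraction W f s P Q"
      using W' by auto
    then show "\<exists>P Q. is_fraction W f s P Q"
      by blast
  qed
qed

lemma regular_affine_line_poly: "regular affine_line UNIV (poly P)"
  by (rule regular_affine_lineI) (rule exI[of _ P], rule exI[of _ 1], simp)

text \<open>
  The derivation \<open>d/dt\<close> at \<open>s\<close>, given by the quotient rule for any representation as a fraction. That
  the representation does not matter is \<open>ddt_eq\<close>; it uses that the field is infinite.
\<close>

definition ddt :: "'k::field \<Rightarrow> ('k, 'k) tvec" where
  "ddt s f = (if regular_at affine_line s f then
     (SOME d. \<exists>P Q. poly Q s \<noteq> 0 \<and> (\<forall>r. poly Q r \<noteq> 0 \<longrightarrow> f r = poly P r / poly Q r) \<and>
        d = (poly (pderiv P) s * poly Q s - poly P s * poly (pderiv Q) s) / (poly Q s)\<^sup>2) else 0)"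

lemma regular_at_affine_line:
  "regular_at affine_line s f \<longleftrightarrow>
     (\<exists>P Q. poly Q s \<noteq> 0 \<and> (\<forall>r. poly Q r \<noteq> 0 \<longrightarrow> f r = poly P r / poly Q r))"
proof
  assume "regular_at affine_line s f"
  then obtain W where W: "s \<in> W" "regular affine_line W f" unfolding regular_at_def by blast
  obtain P Q where "poly Q s \<noteq> 0" "\<And>r. poly Q r \<noteq> 0 \<Longrightarrow> r \<in> W \<and> f r = poly P r / poly Q r"
    using regular_affine_lineE[OF W(2,1)] by metis
  then show "\<exists>P Q. poly Q s \<noteq> 0 \<and> (\<forall>r. poly Q r \<noteq> 0 \<longrightarrow> f r = poly P r / poly Q r)"
    by (intro exI[of _ P] exI[of _ Q]) simp
next
  assume "\<exists>P Q. poly Q s \<noteq> 0 \<and> (\<forall>r. poly Q r \<noteq> 0 \<longrightarrow> f r = poly P r / poly Q r)"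
  then obtain P Q where *: "poly Q s \<noteq> 0" "\<And>r. poly Q r \<noteq> 0 \<Longrightarrow> f r = poly P r / poly Q r" by blast
  then have "regular affine_line {r. poly Q r \<noteq> 0} f"
    by (intro regular_affine_lineI exI[of _ P] exI[of _ Q]) auto
  then show "regular_at affine_line s f"
    unfolding regular_at_def using *(1) by (intro exI[of _ "{r. poly Q r \<noteq> 0}"]) simp
qed

lemma ddt_eq:
  fixes f :: "'k::field_char_0 \<Rightarrow> 'k"
  assumes "poly Q s \<noteq> 0" "\<And>r. poly Q r \<noteq> 0 \<Longrightarrow> f r = poly P r / poly Q r"
  shows "ddt s f = (poly (pderiv P) s * poly Q s - poly P s * poly (pderiv Q) s) / (poly Q s)\<^sup>2"
proof -
  have "d = (poly (pderiv P) s * poly Q s - poly P s * poly (pderiv Q) s) / (poly Q s)\<^sup>2"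
    if d: "\<exists>P Q. poly Q s \<noteq> 0 \<and> (\<forall>r. poly Q r \<noteq> 0 \<longrightarrow> f r = poly P r / poly Q r) \<and>
        d = (poly (pderiv P) s * poly Q s - poly P s * poly (pderiv Q) s) / (poly Q s)\<^sup>2" for d
  proof -
    obtain P' Q' where 1: "poly Q' s \<noteq> 0" "\<And>r. poly Q' r \<noteq> 0 \<Longrightarrow> f r = poly P' r / poly Q' r" and
      d: "d = (poly (pderiv P') s * poly Q' s - poly P' s * poly (pderiv Q') s) / (poly Q' s)\<^sup>2"
      using d by blast
    \<comment> \<open>The factor \<open>Q Q'\<close> covers the points where one of the two fractions is not defined.\<close>
    have "poly ((P * Q' - P' * Q) * (Q * Q')) r = 0" for r
    proof (cases "poly (Q * Q') r = 0")
      case False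
      then have "poly P r / poly Q r = poly P' r / poly Q' r" using 1(2)[of r] assms(2)[of r] by auto
      then show ?thesis using False by (simp add: field_simps)
    qed simp
    then have "(P * Q' - P' * Q) * (Q * Q') = 0" using poly_all_0_iff_0 by blast
    then have e: "P * Q' = P' * Q" using assms(1) 1(1) by auto
    then have p0: "poly P s * poly Q' s = poly P' s * poly Q s" by (metis poly_mult)
    have "pderiv (P * Q') = pderiv (P' * Q)" using e by simp
    then have "poly (pderiv (P * Q')) s = poly (pderiv (P' * Q)) s" by simp
    then have p1: "poly (pderiv P) s * poly Q' s + poly P s * poly (pderiv Q') s
        = poly (pderiv P') s * poly Q s + poly P' s * poly (pderiv Q) s"
      by (simp add: pderiv_mult algebra_simps)
    define a b c e a' b' c' e' where defs: "a = poly P s" "b = poly Q s" "c = poly (pderiv P) s"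
      "e = poly (pderiv Q) s" "a' = poly P' s" "b' = poly Q' s" "c' = poly (pderiv P') s"
      "e' = poly (pderiv Q') s"
    have h: "a * b' = a' * b" "c * b' + a * e' = c' * b + a' * e" "b \<noteq> 0" "b' \<noteq> 0"
      using p0 p1 assms(1) 1(1) by (simp_all add: defs)
    have "(c' * b' - a' * e') * b\<^sup>2 = (c * b - a * e) * b'\<^sup>2"
      using h(1,2) by algebra
    then have "(c' * b' - a' * e') / b'\<^sup>2 = (c * b - a * e) / b\<^sup>2"
      using h(3,4) by (simp add: field_simps)
    then show ?thesis by (simp add: d defs)
  qed
  moreover have "regular_at affine_line s f" using assms regular_at_affine_line by blast
  ultimately show ?thesis
    unfolding ddt_def using assms by (subst if_P) (auto intro!: some_equality)
qed

lemma ddt_tangent: "ddt s \<in> tangent_space affine_line (s :: 'k::field_char_0)"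
proof -
  have rep: "\<exists>P Q. poly Q s \<noteq> 0 \<and> (\<forall>r. poly Q r \<noteq> 0 \<longrightarrow> f r = poly P r / poly Q r)"
    if "regular_at affine_line s f" for f
    using that regular_at_affine_line by blast
  have am: "ddt s (\<lambda>q. f q + g q) = ddt s f + ddt s g \<and>
      ddt s (\<lambda>q. f q * g q) = f s * ddt s g + g s * ddt s f"
    if fg: "regular_at affine_line s f" "regular_at affine_line s g" for f g
  proof -
    obtain P Q where 1: "poly Q s \<noteq> 0" "\<And>r. poly Q r \<noteq> 0 \<Longrightarrow> f r = poly P r / poly Q r"
      using rep[OF fg(1)] by blast
    obtain P' Q' where 2: "poly Q' s \<noteq> 0" "\<And>r. poly Q' r \<noteq> 0 \<Longrightarrow> g r = poly P' r / poly Q' r"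
      using rep[OF fg(2)] by blast
    have q: "poly (Q * Q') s \<noteq> 0" using 1 2 by simp
    have s: "ddt s (\<lambda>q. f q + g q) =
      (poly (pderiv (P * Q' + P' * Q)) s * poly (Q * Q') s - poly (P * Q' + P' * Q) s * poly (pderiv (Q * Q')) s)
      / (poly (Q * Q') s)\<^sup>2"
      by (rule ddt_eq[OF q]) (use 1 2 in \<open>auto simp: field_simps\<close>)
    have m: "ddt s (\<lambda>q. f q * g q) =
      (poly (pderiv (P * P')) s * poly (Q * Q') s - poly (P * P') s * poly (pderiv (Q * Q')) s)
      / (poly (Q * Q') s)\<^sup>2"
      by (rule ddt_eq[OF q]) (use 1 2 in auto)
    have d: "ddt s f = (poly (pderiv P) s * poly Q s - poly P s * poly (pderiv Q) s) / (poly Q s)\<^sup>2"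
      "ddt s g = (poly (pderiv P') s * poly Q' s - poly P' s * poly (pderiv Q') s) / (poly Q' s)\<^sup>2"
      by (rule ddt_eq; use 1 2 in simp)+
    have v: "f s = poly P s / poly Q s" "g s = poly P' s / poly Q' s" using 1 2 by simp_all
    show ?thesis
      unfolding s m d v
      using 1(1) 2(1)
      by (simp add: pderiv_mult pderiv_add field_simps power2_eq_square)
  qed
  have sc: "ddt s (\<lambda>q. c * f q) = c * ddt s f" if f: "regular_at affine_line s f" for f c
  proof -
    obtain P Q where 1: "poly Q s \<noteq> 0" "\<And>r. poly Q r \<noteq> 0 \<Longrightarrow> f r = poly P r / poly Q r"
      using rep[OF f] by blast
    have m: "ddt s (\<lambda>q. c * f q) =
      (poly (pderiv (smult c P)) s * poly Q s - poly (smult c P) s * poly (pderiv Q) s) / (poly Q s)\<^sup>2"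
      by (rule ddt_eq[OF 1(1)]) (use 1 in \<open>auto simp: field_simps\<close>)
    have d: "ddt s f = (poly (pderiv P) s * poly Q s - poly P s * poly (pderiv Q) s) / (poly Q s)\<^sup>2"
      by (rule ddt_eq; use 1 in simp)
    show ?thesis
      unfolding m d by (simp add: pderiv_smult algebra_simps diff_divide_distrib)
  qed
  have co: "ddt s f = ddt s g"
    if fg: "regular_at affine_line s g" "openin (zariski affine_line) W" "s \<in> W" "\<forall>q\<in>W. f q = g q" for f g W
  proof -
    obtain P Q where 1: "poly Q s \<noteq> 0" "\<And>r. poly Q r \<noteq> 0 \<Longrightarrow> g r = poly P r / poly Q r"
      using rep[OF fg(1)] by blast
    obtain E where E: "poly E s \<noteq> 0" "{r. poly E r \<noteq> 0} \<subseteq> W" using fg openin_affine_line by blast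
    have q: "poly (Q * E) s \<noteq> 0" using 1 E by simp
    have f: "f r = poly (P * E) r / poly (Q * E) r" and g: "g r = poly (P * E) r / poly (Q * E) r"
      if "poly (Q * E) r \<noteq> 0" for r
      using that 1 E fg by auto
    show ?thesis using ddt_eq[OF q f] ddt_eq[OF q g] by simp
  qed
  show ?thesis
    unfolding tangent_space_def
  proof (intro CollectI conjI allI impI; (elim conjE)?)
    fix f g W
    assume "regular_at affine_line s g" "openin (zariski affine_line) W" "s \<in> W" "\<forall>q\<in>W. f q = g q"
    then show "ddt s f = ddt s g" by (rule co)
  next
    fix f :: "'k \<Rightarrow> 'k"
    assume "\<not> regular_at affine_line s f"
    then show "ddt s f = 0" by (simp add: ddt_def)
  qed (simp_all add: am sc)
qed

lemma ddt_regular: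
  assumes "regular affine_line W f"
  shows "regular affine_line W (\<lambda>s :: 'k::field_char_0. ddt s f)"
proof (rule regular_affine_lineI)
  fix s assume "s \<in> W"
  then obtain P Q where 1: "poly Q s \<noteq> 0" "\<And>r. poly Q r \<noteq> 0 \<Longrightarrow> r \<in> W \<and> f r = poly P r / poly Q r"
    using assms regular_affine_lineE by meson
  have "r \<in> W \<and> ddt r f = poly (pderiv P * Q - P * pderiv Q) r / poly (Q\<^sup>2) r" if "poly (Q\<^sup>2) r \<noteq> 0" for r
    using ddt_eq[of Q r f P] 1(2) that by simp
  then show "\<exists>P Q. is_fraction W (\<lambda>r. ddt r f) s P Q"
    using 1(1) by (intro exI[of _ "pderiv P * Q - P * pderiv Q"] exI[of _ "Q\<^sup>2"]) auto
qed

lemma ddt_ident: "ddt s (\<lambda>r. r) = (1 :: 'k::field_char_0)"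
  using ddt_eq[of 1 s "\<lambda>r. r" "[:0, 1:]"] by (simp add: pderiv_pCons)

section \<open>Prevarieties\<close>

lemma openin_zariski_of:
  "g \<in> polyfun n \<Longrightarrow> openin (zariski_of n F) {y \<in> zero_locus n F. g y \<noteq> 0}"
  unfolding zariski_of_def by (rule topology_generated_by_Basis) blast

lemma points_affine_variety: "points (affine_variety n F) = zero_locus n F"
proof -
  have "openin (zariski_of n F) {y \<in> zero_locus n F. (1::'a) \<noteq> 0}"
    by (rule openin_zariski_of[OF polyfun.const])
  then have "zero_locus n F \<subseteq> topspace (zariski_of n F)"
    using openin_subset by fastforce
  moreover have "topspace (zariski_of n F) \<subseteq> zero_locus n F"
    unfolding zariski_of_def topology_generated_by_topspace by blast
  ultimately show ?thesis by (simp add: affine_variety_def)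
qed

lemma regular_affine_varietyE:
  assumes "regular (affine_variety n F) W h" "y \<in> W"
  obtains W' f g where "openin (zariski_of n F) W'" "y \<in> W'" "W' \<subseteq> W" "f \<in> polyfun n"
    "g \<in> polyfun n" "\<forall>z\<in>W'. g z \<noteq> 0 \<and> h z = f z / g z"
proof -
  have "\<forall>y\<in>W. \<exists>W' f g. openin (zariski_of n F) W' \<and> y \<in> W' \<and> W' \<subseteq> W \<and>
            f \<in> polyfun n \<and> g \<in> polyfun n \<and> (\<forall>z\<in>W'. g z \<noteq> 0 \<and> h z = f z / g z)"
    using assms(1) by (simp add: affine_variety_def)
  from bspec[OF this assms(2)] show thesis
    by (elim exE conjE) (rule that)
qed

lemma morphismD:
  assumes "morphism X Y \<phi>"
  shows "continuous_map (zariski X) (zariski Y) \<phi>"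
    and "regular Y W g \<Longrightarrow> regular X {p \<in> points X. \<phi> p \<in> W} (\<lambda>p. g (\<phi> p))"
proof -
  have *: "\<forall>W g. regular Y W g \<longrightarrow> regular X {p \<in> points X. \<phi> p \<in> W} (\<lambda>p. g (\<phi> p))"
    using assms unfolding morphism_def by (elim conjE)
  show "regular Y W g \<Longrightarrow> regular X {p \<in> points X. \<phi> p \<in> W} (\<lambda>p. g (\<phi> p))"
    by (rule *[THEN spec, THEN spec, THEN mp])
  show "continuous_map (zariski X) (zariski Y) \<phi>"
    using assms unfolding morphism_def by (elim conjE)
qed

lemma prevariety_affine_chart:
  assumes "prevariety X" "p \<in> points X"
  obtains U n F \<phi> \<psi> where "openin (zariski X) U" "p \<in> U"
    "morphism (open_subspace X U) (affine_variety n F) \<phi>"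
    "morphism (affine_variety n F) (open_subspace X U) \<psi>"
    "\<forall>q\<in>U. \<psi> (\<phi> q) = q"
    "\<forall>q\<in>U. \<phi> q \<in> zero_locus n F"
proof -
  obtain \<U> where \<U>: "\<Union>\<U> = points X" and
    c: "\<forall>U\<in>\<U>. openin (zariski X) U \<and>
           (\<exists>n F. F \<subseteq> polyfun n \<and> isomorphic (open_subspace X U) (affine_variety n F))"
    using assms(1) unfolding prevariety_def by metis
  obtain U where U: "U \<in> \<U>" "p \<in> U" using assms(2) \<U> by blast
  obtain n F where oU: "openin (zariski X) U" and
    iso: "isomorphic (open_subspace X U) (affine_variety n F)"
    using c U(1) by meson
  from iso[unfolded isomorphic_def] obtain \<phi> \<psi> where
    m: "morphism (open_subspace X U) (affine_variety n F) \<phi>"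
       "morphism (affine_variety n F) (open_subspace X U) \<psi>" and
    i: "\<forall>p\<in>points (open_subspace X U). \<psi> (\<phi> p) = p"
    by (elim exE conjE)
  have pt: "points (open_subspace X U) = U"
    using openin_subset[OF oU] by (auto simp: open_subspace_def)
  show thesis
  proof (rule that[OF oU U(2) m]; rule ballI)
    fix q assume q: "q \<in> U"
    then show "\<psi> (\<phi> q) = q" using i pt by simp
    have "\<phi> q \<in> points (affine_variety n F)"
      using continuous_map_image_subset_topspace[OF morphismD(1)[OF m(1)]] q pt by blast
    then show "\<phi> q \<in> zero_locus n F" by (simp add: points_affine_variety)
  qed
qed

text \<open>
  In an affine variety a regular function is locally a fraction \<open>g/h\<close>, whose inverse \<open>h/g\<close> is again a
  fraction where \<open>g\<close> does not vanish.
\<close>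

lemma function_space_prevariety:
  assumes "prevariety X"
  shows "function_space X"
proof -
  have s: "space_with_functions X" using assms by (simp add: prevariety_def)
  have op: "\<forall>W f. regular X W f \<longrightarrow> openin (zariski X) W"
    using s unfolding space_with_functions_def by (elim conjE)
  have re: "\<forall>W W' f. regular X W f \<and> openin (zariski X) W' \<and> W' \<subseteq> W \<longrightarrow> regular X W' f"
    using s unfolding space_with_functions_def by (elim conjE)
  have gl: "\<forall>W f. openin (zariski X) W \<and>
        (\<forall>p\<in>W. \<exists>W' f'. p \<in> W' \<and> W' \<subseteq> W \<and> regular X W' f' \<and> (\<forall>q\<in>W'. f q = f' q)) \<longrightarrow>
        regular X W f"
    using s unfolding space_with_functions_def by (elim conjE)
  have "regular X {p \<in> W. f p \<noteq> 0} (\<lambda>p. inverse (f p))" if f: "regular X W f" for W f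
  proof -
    have loc: "\<exists>W' f'. p \<in> W' \<and> W' \<subseteq> {p \<in> W. f p \<noteq> 0} \<and> regular X W' f' \<and> (\<forall>q\<in>W'. inverse (f q) = f' q)"
      if p: "p \<in> {p \<in> W. f p \<noteq> 0}" for p
    proof -
      have oW: "openin (zariski X) W" using op f by iprover
      then have pX: "p \<in> points X" using p openin_subset by fastforce
      obtain U n F \<phi> \<psi> where
        U: "openin (zariski X) U" "p \<in> U" and
        m: "morphism (open_subspace X U) (affine_variety n F) \<phi>"
          "morphism (affine_variety n F) (open_subspace X U) \<psi>" and
        i: "\<forall>q\<in>U. \<psi> (\<phi> q) = q" "\<forall>q\<in>U. \<phi> q \<in> zero_locus n F"
        by (rule prevariety_affine_chart[OF assms pX])
      have pt: "points (open_subspace X U) = U"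
        using openin_subset[OF U(1)] by (auto simp: open_subspace_def)
      have "openin (zariski X) (W \<inter> U)" using oW U(1) by blast
      then have "regular X (W \<inter> U) f"
        using re[THEN spec, THEN spec, THEN spec, THEN mp, of W f "W \<inter> U"] f by simp
      then have "regular (open_subspace X U) (W \<inter> U) f" by (simp add: open_subspace_def)
      from morphismD(2)[OF m(2) this]
      have f\<psi>: "regular (affine_variety n F) {y \<in> zero_locus n F. \<psi> y \<in> W \<inter> U} (\<lambda>y. f (\<psi> y))"
        by (simp add: points_affine_variety)
      have y: "\<phi> p \<in> {y \<in> zero_locus n F. \<psi> y \<in> W \<inter> U}" using i U(2) p by simp
      obtain W1 g h where
        W1: "openin (zariski_of n F) W1" "\<phi> p \<in> W1" "W1 \<subseteq> {y \<in> zero_locus n F. \<psi> y \<in> W \<inter> U}"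
        and gh: "g \<in> polyfun n" "h \<in> polyfun n"
        and eq: "\<forall>z\<in>W1. h z \<noteq> 0 \<and> f (\<psi> z) = g z / h z"
        by (rule regular_affine_varietyE[OF f\<psi> y])
      let ?W2 = "W1 \<inter> {y \<in> zero_locus n F. g y \<noteq> 0}"
      have o2: "openin (zariski_of n F) ?W2" using W1(1) openin_zariski_of[OF gh(1)] by blast
      have "regular (affine_variety n F) ?W2 (\<lambda>y. h y / g y)"
        unfolding affine_variety_def fspace.simps
        using o2 gh
        by (intro conjI ballI; (rule exI[of _ ?W2], rule exI[of _ h], rule exI[of _ g])?) auto
      from morphismD(2)[OF m(1) this]
      have "regular (open_subspace X U) {q \<in> U. \<phi> q \<in> ?W2} (\<lambda>q. h (\<phi> q) / g (\<phi> q))"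
        by (simp add: pt)
      then have "regular X {q \<in> U. \<phi> q \<in> ?W2} (\<lambda>q. h (\<phi> q) / g (\<phi> q))"
        by (simp add: open_subspace_def)
      moreover have fq: "f q = g (\<phi> q) / h (\<phi> q)" if "q \<in> U" "\<phi> q \<in> W1" for q
        using bspec[OF eq that(2)] bspec[OF i(1) that(1)] by simp
      moreover have "g (\<phi> p) \<noteq> 0" using fq[OF U(2) W1(2)] p by auto
      moreover have "q \<in> W" if "q \<in> U" "\<phi> q \<in> W1" for q
        using that W1(3) i(1) that(1) by auto
      ultimately show ?thesis
        using U(2) W1(2) i(2) eq
        by (intro exI[of _ "{q \<in> U. \<phi> q \<in> ?W2}"] exI[of _ "\<lambda>q. h (\<phi> q) / g (\<phi> q)"]) auto
    qed
    have "openin (zariski X) {p \<in> W. f p \<noteq> 0}"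
    proof (subst openin_subopen, intro ballI)
      fix p assume "p \<in> {p \<in> W. f p \<noteq> 0}"
      from loc[OF this] obtain W' f' where "p \<in> W'" "W' \<subseteq> {p \<in> W. f p \<noteq> 0}" "regular X W' f'"
        by (elim exE conjE)
      then show "\<exists>T. openin (zariski X) T \<and> p \<in> T \<and> T \<subseteq> {p \<in> W. f p \<noteq> 0}"
        using op by (intro exI[of _ W'] conjI) iprover+
    qed
    then show ?thesis
      by (intro gl[THEN spec, THEN spec, THEN mp] conjI ballI loc)
  qed
  then show ?thesis unfolding function_space_def using s by simp
qed

lemma prevariety_T1:
  assumes "prevariety X" "p \<in> points X" "r \<noteq> p"
  shows "\<exists>W. openin (zariski X) W \<and> p \<in> W \<and> r \<notin> W"
proof -
  obtain U n F \<phi> \<psi> where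
    U: "openin (zariski X) U" "p \<in> U" and
    m: "morphism (open_subspace X U) (affine_variety n F) \<phi>"
      "morphism (affine_variety n F) (open_subspace X U) \<psi>" and
    i: "\<forall>q\<in>U. \<psi> (\<phi> q) = q" "\<forall>q\<in>U. \<phi> q \<in> zero_locus n F"
    by (rule prevariety_affine_chart[OF assms(1,2)])
  show ?thesis
  proof (cases "r \<in> U")
    case True
    have ne: "\<phi> r \<noteq> \<phi> p" using i(1) True U(2) assms(3) by metis
    obtain k where k: "\<phi> r k \<noteq> \<phi> p k" using ne by (meson ext)
    have "k < n"
      using k bspec[OF i(2) True] bspec[OF i(2) U(2)] unfolding zero_locus_def by (metis (mono_tags, lifting) mem_Collect_eq not_le)
    let ?g = "\<lambda>y. y k + - \<phi> r k"
    have "?g \<in> polyfun n" by (intro polyfun.add polyfun.coord polyfun.const \<open>k < n\<close>)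
    note o = openin_zariski_of[OF this, of F]
    have pt: "points (open_subspace X U) = U"
      using openin_subset[OF U(1)] by (auto simp: open_subspace_def)
    have "openin (zariski (open_subspace X U)) {q \<in> U. \<phi> q \<in> {y \<in> zero_locus n F. ?g y \<noteq> 0}}"
      using openin_continuous_map_preimage[OF morphismD(1)[OF m(1)],
        of "{y \<in> zero_locus n F. ?g y \<noteq> 0}"] o
      unfolding pt by (simp add: affine_variety_def)
    then have "openin (zariski X) {q \<in> U. \<phi> q \<in> {y \<in> zero_locus n F. ?g y \<noteq> 0}}"
      by (simp add: open_subspace_def openin_open_subtopology[OF U(1)])
    moreover have "p \<in> {q \<in> U. \<phi> q \<in> {y \<in> zero_locus n F. ?g y \<noteq> 0}}"
      using U(2) bspec[OF i(2) U(2)] k by auto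
    moreover have "r \<notin> {q \<in> U. \<phi> q \<in> {y \<in> zero_locus n F. ?g y \<noteq> 0}}"
      by simp
    ultimately show ?thesis by blast
  qed (use U in blast)
qed

section \<open>The space of lines in a bundle\<close>

lemma is_lineE:
  assumes "is_line L"
  obtains v where "v \<noteq> (\<lambda>f. 0)" "L = {(\<lambda>f. c * v f) |c. True}"
  using assms unfolding is_line_def by blast

text \<open>The line spanned by a tangent vector (the zero space if the vector is zero).\<close>

definition span1 :: "('p, 'k::field) tvec \<Rightarrow> ('p, 'k) tvec set" where
  "span1 v = {(\<lambda>f. c * v f) |c. True}"

lemma span1_self: "v \<in> span1 v"
  unfolding span1_def by (auto intro!: exI[of _ 1])

lemma zero_in_span1: "(\<lambda>f. 0) \<in> span1 v"
  unfolding span1_def by (auto intro!: exI[of _ 0])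

lemma nonzero_on_span1: "nonzero_on (span1 w) v \<longleftrightarrow> w v \<noteq> 0"
proof
  assume "w v \<noteq> 0"
  then show "nonzero_on (span1 w) v" unfolding nonzero_on_def using span1_self by blast
qed (auto simp: nonzero_on_def span1_def)

lemma dquotient_span1:
  assumes "\<delta> q = span1 w" "w v \<noteq> 0"
  shows "dquotient \<delta> u v q = w u / w v"
  unfolding dquotient_def
proof (rule the_equality)
  show "\<forall>w'\<in>\<delta> q. w' u = w u / w v * w' v"
    using assms by (auto simp: span1_def)
  fix c assume "\<forall>w'\<in>\<delta> q. w' u = c * w' v"
  then have "w u = c * w v" using span1_self[of w] assms(1) by blast
  then show "c = w u / w v" using assms(2) by simp
qed

lemma is_line_span1: "w v \<noteq> 0 \<Longrightarrow> is_line (span1 w)"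
  unfolding is_line_def span1_def by (intro exI[of _ w]) auto

text \<open>
  \<open>Y\<close> is the space of lines in the subbundle \<open>B\<close> of the tangent bundle of \<open>X\<close>.
\<close>

locale line_bundle_space =
  fixes X :: "('p, 'k::field) fspace"
    and B :: "'p \<Rightarrow> ('p, 'k) tvec set"
    and Y :: "('p, 'k) fspace"
    and \<pi> :: "'p \<Rightarrow> 'p"
    and \<delta> :: "'p \<Rightarrow> ('p, 'k) tvec set"
  assumes base: "function_space X"
    and total: "is_line_bundle_space X B Y \<pi> \<delta>"
begin

abbreviation "lfun \<equiv> line_fun X (points Y) \<pi> \<delta>"

lemma bij: "bij_betw (\<lambda>q. (\<pi> q, \<delta> q)) (points Y) {(p, L). p \<in> points X \<and> is_line L \<and> L \<subseteq> B p}"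
  using total unfolding is_line_bundle_space_def by (elim conjE)

lemma zariski_Y: "zariski Y = topology_generated_by {W. \<exists>h. lfun W h}"
  using total unfolding is_line_bundle_space_def by (elim conjE)

lemma regular_Y: "regular Y W f \<longleftrightarrow> openin (zariski Y) W \<and>
        (\<forall>q\<in>W. \<exists>W' h. lfun W' h \<and> q \<in> W' \<and> (\<forall>r\<in>W \<inter> W'. f r = h r))"
proof -
  have "\<forall>W f. regular Y W f \<longleftrightarrow> openin (zariski Y) W \<and>
        (\<forall>q\<in>W. \<exists>W' h. lfun W' h \<and> q \<in> W' \<and> (\<forall>r\<in>W \<inter> W'. f r = h r))"
    using total unfolding is_line_bundle_space_def by (elim conjE)
  then show ?thesis by (elim allE)
qed

lemma proj_point: "q \<in> points Y \<Longrightarrow> \<pi> q \<in> points X"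
  using bij_betw_apply[OF bij] by fastforce

lemma direction:
  assumes "q \<in> points Y"
  obtains w where "w \<noteq> (\<lambda>f. 0)" "\<delta> q = span1 w" "w \<in> B (\<pi> q)" "\<delta> q \<subseteq> B (\<pi> q)"
proof -
  have l: "is_line (\<delta> q)" "\<delta> q \<subseteq> B (\<pi> q)" using bij_betw_apply[OF bij assms] by auto
  from is_lineE[OF l(1)] obtain w where "w \<noteq> (\<lambda>f. 0)" "\<delta> q = span1 w" unfolding span1_def .
  moreover have "w \<in> B (\<pi> q)" using calculation l(2) span1_self by blast
  ultimately show thesis using that l(2) by blast
qed

lemma point_eqI:
  assumes "q \<in> points Y" "q' \<in> points Y" "\<pi> q = \<pi> q'" "\<delta> q = \<delta> q'"
  shows "q = q'"
  using bij_betw_imp_inj_on[OF bij] assms unfolding inj_on_def by blast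

lemma point_exists:
  assumes "p \<in> points X" "w v \<noteq> 0" "span1 w \<subseteq> B p"
  obtains q where "q \<in> points Y" "\<pi> q = p" "\<delta> q = span1 w"
proof -
  have "(p, span1 w) \<in> {(p, L). p \<in> points X \<and> is_line L \<and> L \<subseteq> B p}"
    using assms is_line_span1 by blast
  then have "(p, span1 w) \<in> (\<lambda>q. (\<pi> q, \<delta> q)) ` points Y"
    using bij_betw_imp_surj_on[OF bij] by blast
  then show thesis using that by auto
qed

lemma lfun_open: "lfun W h \<Longrightarrow> openin (zariski Y) W"
  by (subst zariski_Y, rule topology_generated_by_Basis) blast

lemma lfun_regular: "lfun W h \<Longrightarrow> regular Y W h"
  by (rule iffD2[OF regular_Y]) (use lfun_open in \<open>intro conjI ballI exI[of _ W] exI[of _ h]; simp\<close>)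

lemma lfun_const: "lfun {q \<in> points Y. \<pi> q \<in> points X} (\<lambda>q. c)"
  using line_fun.pullback[OF regular_const[OF base openin_topspace, of c]] .

text \<open>
  The domains of the local expressions form a basis of the topology, since sums are defined on the
  intersection of the domains.
\<close>

lemma lfun_basis:
  assumes "openin (zariski Y) W" "q \<in> W"
  shows "\<exists>W' h. lfun W' h \<and> q \<in> W' \<and> W' \<subseteq> W"
proof -
  have "generate_topology_on {W. \<exists>h. lfun W h} W"
    using assms(1) by (subst (asm) zariski_Y) (simp only: openin_topology_generated_by_iff)
  then show ?thesis
    using assms(2)
  proof (induction W arbitrary: q rule: generate_topology_on.induct)
    case (Int a b)
    obtain W h where 1: "lfun W h" "q \<in> W" "W \<subseteq> a" using Int.IH(1)[of q] Int.prems by blast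
    obtain W' h' where 2: "lfun W' h'" "q \<in> W'" "W' \<subseteq> b" using Int.IH(2)[of q] Int.prems by blast
    have "lfun (W \<inter> W') (\<lambda>q. h q + h' q)" using 1 2 line_fun.add by metis
    then show ?case using 1 2 by blast
  next
    case (UN K)
    then obtain k where k: "k \<in> K" "q \<in> k" by blast
    obtain W' h where "lfun W' h" "q \<in> W'" "W' \<subseteq> k" using UN.IH[OF k] by blast
    then show ?case using k by blast
  next
    case (Basis s)
    then show ?case by blast
  qed simp
qed

lemma regular_lfun:
  assumes "regular Y W f" "q \<in> W"
  obtains W' h where "lfun W' h" "q \<in> W'" "W' \<subseteq> W" "\<forall>r\<in>W'. f r = h r"
proof -
  have oW: "openin (zariski Y) W" by (rule conjunct1[OF iffD1[OF regular_Y assms(1)]])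
  have "\<forall>q\<in>W. \<exists>W' h. lfun W' h \<and> q \<in> W' \<and> (\<forall>r\<in>W \<inter> W'. f r = h r)"
    using iffD1[OF regular_Y assms(1)] by (elim conjE)
  from bspec[OF this assms(2)] obtain W1 h where 1: "lfun W1 h" "q \<in> W1" "\<forall>r\<in>W \<inter> W1. f r = h r"
    by (elim exE conjE)
  obtain W2 g where 2: "lfun W2 g" "q \<in> W2" "W2 \<subseteq> W" using lfun_basis[OF oW assms(2)] by blast
  have "W2 \<subseteq> points Y" using openin_subset[OF lfun_open[OF 2(1)]] .
  then have e: "W1 \<inter> (W2 \<inter> {q \<in> points Y. \<pi> q \<in> points X}) = W1 \<inter> W2" using proj_point by blast
  have "lfun (W1 \<inter> W2) (\<lambda>q. h q + g q * 0)"
    using line_fun.add[OF 1(1) line_fun.mult[OF 2(1) lfun_const[of 0]]] by (simp only: e)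
  then have "lfun (W1 \<inter> W2) h" by simp
  then show thesis using 1 2 by (intro that[of "W1 \<inter> W2" h]) auto
qed

lemma regularI:
  assumes "openin (zariski Y) W" "\<And>q. q \<in> W \<Longrightarrow> \<exists>W' h. lfun W' h \<and> q \<in> W' \<and> (\<forall>r\<in>W \<inter> W'. f r = h r)"
  shows "regular Y W f"
  by (rule iffD2[OF regular_Y]) (intro conjI ballI assms)

lemma function_space_Y: "function_space Y"
  unfolding function_space_def space_with_functions_def
proof (intro conjI allI impI; (elim conjE)?)
  fix W f assume f: "regular Y W f"
  show oW: "openin (zariski Y) W" by (rule conjunct1[OF iffD1[OF regular_Y f]])
  have loc: "\<exists>W' h. lfun W' h \<and> q \<in> W' \<and> W' \<subseteq> {p \<in> W. f p \<noteq> 0} \<and> (\<forall>r\<in>W'. inverse (f r) = h r)"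
    if "q \<in> {p \<in> W. f p \<noteq> 0}" for q
  proof -
    from that have q: "q \<in> W" "f q \<noteq> 0" by auto
    obtain W1 h where
      1: "lfun W1 h" "q \<in> W1" "W1 \<subseteq> W" "\<forall>r\<in>W1. f r = h r"
      by (rule regular_lfun[OF f q(1)])
    have "lfun {q \<in> W1. h q \<noteq> 0} (\<lambda>q. inverse (h q))" by (rule line_fun.inverse[OF 1(1)])
    then show ?thesis
      using 1 q by (intro exI[of _ "{q \<in> W1. h q \<noteq> 0}"] exI[of _ "\<lambda>q. inverse (h q)"]) auto
  qed
  show "regular Y {p \<in> W. f p \<noteq> 0} (\<lambda>p. inverse (f p))"
  proof (rule regularI)
    show "openin (zariski Y) {p \<in> W. f p \<noteq> 0}"
    proof (subst openin_subopen, intro ballI)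
      fix q assume "q \<in> {p \<in> W. f p \<noteq> 0}"
      from loc[OF this] show "\<exists>T. openin (zariski Y) T \<and> q \<in> T \<and> T \<subseteq> {p \<in> W. f p \<noteq> 0}"
        using lfun_open by (elim exE conjE) (intro exI conjI)
    qed
    fix q assume "q \<in> {p \<in> W. f p \<noteq> 0}"
    from loc[OF this] obtain W' h where "lfun W' h" "q \<in> W'" "\<forall>r\<in>W'. inverse (f r) = h r"
      by (elim exE conjE)
    then show "\<exists>W' h. lfun W' h \<and> q \<in> W' \<and> (\<forall>r\<in>{p \<in> W. f p \<noteq> 0} \<inter> W'. inverse (f r) = h r)"
      by (intro exI[of _ W'] exI[of _ h]) auto
  qed
next
  fix W c assume W: "openin (zariski Y) W"
  show "regular Y W (\<lambda>_. c)"
  proof (rule regularI[OF W])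
    fix q assume "q \<in> W"
    then have "q \<in> points Y" using W openin_subset by blast
    then show "\<exists>W' h. lfun W' h \<and> q \<in> W' \<and> (\<forall>r\<in>W \<inter> W'. c = h r)"
      using lfun_const[of c] proj_point
      by (intro exI[of _ "{q \<in> points Y. \<pi> q \<in> points X}"] exI[of _ "\<lambda>q. c"]) auto
  qed
next
  fix W f g assume fg: "regular Y W f" "regular Y W g"
  have oW: "openin (zariski Y) W" by (rule conjunct1[OF iffD1[OF regular_Y fg(1)]])
  have ex: "\<exists>W1 h W2 h'. lfun W1 h \<and> lfun W2 h' \<and> q \<in> W1 \<inter> W2 \<and> (\<forall>r\<in>W1 \<inter> W2. f r = h r \<and> g r = h' r)"
    if q: "q \<in> W" for q
  proof -
    obtain W1 h where
      1: "lfun W1 h" "q \<in> W1" "W1 \<subseteq> W" "\<forall>r\<in>W1. f r = h r"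
      by (rule regular_lfun[OF fg(1) q])
    obtain W2 h' where
      2: "lfun W2 h'" "q \<in> W2" "W2 \<subseteq> W" "\<forall>r\<in>W2. g r = h' r"
      by (rule regular_lfun[OF fg(2) q])
    show ?thesis
      by (rule exI[of _ W1], rule exI[of _ h], rule exI[of _ W2], rule exI[of _ h']) (simp add: 1 2)
  qed
  show "regular Y W (\<lambda>p. f p + g p)"
  proof (rule regularI[OF oW])
    fix q assume "q \<in> W"
    from ex[OF this] obtain W1 h W2 h' where *: "lfun W1 h" "lfun W2 h'" "q \<in> W1 \<inter> W2"
      "\<forall>r\<in>W1 \<inter> W2. f r = h r \<and> g r = h' r" by (elim exE conjE)
    then show "\<exists>W' h. lfun W' h \<and> q \<in> W' \<and> (\<forall>r\<in>W \<inter> W'. f r + g r = h r)"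
      using line_fun.add[OF *(1,2)]
      by (intro exI[of _ "W1 \<inter> W2"] exI[of _ "\<lambda>r. h r + h' r"]) simp
  qed
  show "regular Y W (\<lambda>p. f p * g p)"
  proof (rule regularI[OF oW])
    fix q assume "q \<in> W"
    from ex[OF this] obtain W1 h W2 h' where *: "lfun W1 h" "lfun W2 h'" "q \<in> W1 \<inter> W2"
      "\<forall>r\<in>W1 \<inter> W2. f r = h r \<and> g r = h' r" by (elim exE conjE)
    then show "\<exists>W' h. lfun W' h \<and> q \<in> W' \<and> (\<forall>r\<in>W \<inter> W'. f r * g r = h r)"
      using line_fun.mult[OF *(1,2)]
      by (intro exI[of _ "W1 \<inter> W2"] exI[of _ "\<lambda>r. h r * h' r"]) simp
  qed
next
  fix W W' f
  assume f: "regular Y W f" and W': "openin (zariski Y) W'" "W' \<subseteq> W"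
  show "regular Y W' f"
  proof (rule regularI[OF W'(1)])
    fix q assume "q \<in> W'"
    then have q: "q \<in> W" using W' by blast
    obtain W1 h where
      "lfun W1 h" "q \<in> W1" "W1 \<subseteq> W" "\<forall>r\<in>W1. f r = h r"
      by (rule regular_lfun[OF f q])
    then show "\<exists>W'' h. lfun W'' h \<and> q \<in> W'' \<and> (\<forall>r\<in>W' \<inter> W''. f r = h r)"
      by (intro exI[of _ W1] exI[of _ h]) simp
  qed
next
  fix W f
  assume W: "openin (zariski Y) W" and
    loc: "\<forall>p\<in>W. \<exists>W' f'. p \<in> W' \<and> W' \<subseteq> W \<and> regular Y W' f' \<and> (\<forall>q\<in>W'. f q = f' q)"
  show "regular Y W f"
  proof (rule regularI[OF W])
    fix q assume "q \<in> W"
    from bspec[OF loc this] obtain W' f' where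
      f': "q \<in> W'" "regular Y W' f'" "\<forall>q\<in>W'. f q = f' q" by (elim exE conjE)
    obtain W1 h where
      1: "lfun W1 h" "q \<in> W1" "W1 \<subseteq> W'" "\<forall>r\<in>W1. f' r = h r"
      by (rule regular_lfun[OF f'(2,1)])
    have "f r = h r" if "r \<in> W1" for r
      using bspec[OF 1(4) that] bspec[OF f'(3), of r] 1(3) that by auto
    then show "\<exists>W' h. lfun W' h \<and> q \<in> W' \<and> (\<forall>r\<in>W \<inter> W'. f r = h r)"
      using 1 by (intro exI[of _ W1] exI[of _ h]) simp
  qed
qed

lemma proj_regular: "regular_map Y X \<pi> (points Y)"
  unfolding regular_map_def
  using proj_point lfun_regular[OF line_fun.pullback] by auto

lemma quotient_regular:
  "regular X U u \<Longrightarrow> regular X U v \<Longrightarrow>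
   regular Y {q \<in> points Y. \<pi> q \<in> U \<and> nonzero_on (\<delta> q) v} (dquotient \<delta> u v)"
  by (rule lfun_regular[OF line_fun.quotient])

text \<open>
  A map into \<open>X\<close> together with a field \<open>\<omega>\<close> of nonzero vectors along it, spanning a line of \<open>B\<close> at each
  point, lifts to a map into \<open>Y\<close>. The lift is regular if \<open>\<omega>\<close> takes regular functions to regular
  functions, because the quotient \<open>du/dv\<close> pulls back to \<open>\<omega>(u)/\<omega>(v)\<close>.
\<close>

lemma regular_map_lift:
  assumes Z: "function_space Z" and N: "openin (zariski Z) N" "\<phi> ` N \<subseteq> points Y"
    and proj: "regular_map Z X (\<lambda>z. \<pi> (\<phi> z)) N"
    and dir: "\<And>z. z \<in> N \<Longrightarrow> \<delta> (\<phi> z) = span1 (\<omega> z)"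
    and \<omega>: "\<And>W u. regular X W u \<Longrightarrow> regular Z {z \<in> N. \<pi> (\<phi> z) \<in> W} (\<lambda>z. \<omega> z u)"
  shows "regular_map Z Y \<phi> N"
proof -
  have lf: "regular Z {z \<in> N. \<phi> z \<in> W} (\<lambda>z. h (\<phi> z))" if "lfun W h" for W h
    using that
  proof (induction rule: line_fun.induct)
    case (pullback U g)
    have "{z \<in> N. \<phi> z \<in> {q \<in> points Y. \<pi> q \<in> U}} = {z \<in> N. \<pi> (\<phi> z) \<in> U}" using N(2) by blast
    then show ?case using regular_mapD[OF proj pullback] by simp
  next
    case (quotient U u v)
    have e: "{z \<in> N. \<phi> z \<in> {q \<in> points Y. \<pi> q \<in> U \<and> nonzero_on (\<delta> q) v}} =
        {z \<in> {z \<in> N. \<pi> (\<phi> z) \<in> U}. \<omega> z v \<noteq> 0}" (is "_ = ?W")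
      using N(2) by (auto simp: dir nonzero_on_span1)
    have i: "regular Z ?W (\<lambda>z. inverse (\<omega> z v))"
      by (rule regular_inverse[OF Z \<omega>[OF quotient(2)]])
    have "regular Z ?W (\<lambda>z. \<omega> z u)"
      by (rule regular_restrict[OF Z \<omega>[OF quotient(1)] regular_openin[OF Z i]]) blast
    from regular_mult[OF Z this i] have "regular Z ?W (\<lambda>z. \<omega> z u * inverse (\<omega> z v))" .
    then have "regular Z ?W (\<lambda>z. dquotient \<delta> u v (\<phi> z))"
    proof (rule regular_cong[OF Z])
      fix z assume "z \<in> ?W"
      then have "\<delta> (\<phi> z) = span1 (\<omega> z)" "\<omega> z v \<noteq> 0" using dir by auto
      from dquotient_span1[of \<delta>, OF this]
      show "dquotient \<delta> u v (\<phi> z) = \<omega> z u * inverse (\<omega> z v)"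
        by (simp add: divide_inverse)
    qed
    then show ?case unfolding e .
  next
    case (add W f W' g)
    have e: "{z \<in> N. \<phi> z \<in> W \<inter> W'} = {z \<in> N. \<phi> z \<in> W} \<inter> {z \<in> N. \<phi> z \<in> W'}" (is "_ = ?W") by blast
    have o: "openin (zariski Z) ?W"
      by (rule openin_Int[OF regular_openin[OF Z add.IH(1)] regular_openin[OF Z add.IH(2)]])
    show ?case unfolding e
      by (rule regular_add[OF Z regular_restrict[OF Z add.IH(1) o Int_lower1]
            regular_restrict[OF Z add.IH(2) o Int_lower2]])
  next
    case (mult W f W' g)
    have e: "{z \<in> N. \<phi> z \<in> W \<inter> W'} = {z \<in> N. \<phi> z \<in> W} \<inter> {z \<in> N. \<phi> z \<in> W'}" (is "_ = ?W") by blast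
    have o: "openin (zariski Z) ?W"
      by (rule openin_Int[OF regular_openin[OF Z mult.IH(1)] regular_openin[OF Z mult.IH(2)]])
    show ?case unfolding e
      by (rule regular_mult[OF Z regular_restrict[OF Z mult.IH(1) o Int_lower1]
            regular_restrict[OF Z mult.IH(2) o Int_lower2]])
  next
    case (inverse W f)
    have e: "{z \<in> N. \<phi> z \<in> {q \<in> W. f q \<noteq> 0}} = {z \<in> {z \<in> N. \<phi> z \<in> W}. f (\<phi> z) \<noteq> 0}" by blast
    show ?case unfolding e by (rule regular_inverse[OF Z inverse.IH])
  qed
  have "regular Z {z \<in> N. \<phi> z \<in> W} (\<lambda>z. g (\<phi> z))" if g: "regular Y W g" for W g
  proof (rule regular_locally[OF Z])
    fix z assume z: "z \<in> {z \<in> N. \<phi> z \<in> W}"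
    then have q: "\<phi> z \<in> W" by blast
    obtain W' h where
      W': "lfun W' h" "\<phi> z \<in> W'" "W' \<subseteq> W" "\<forall>r\<in>W'. g r = h r"
      by (rule regular_lfun[OF g q])
    then show "\<exists>W' f'. z \<in> W' \<and> W' \<subseteq> {z \<in> N. \<phi> z \<in> W} \<and> regular Z W' f' \<and> (\<forall>q\<in>W'. g (\<phi> q) = f' q)"
      using z lf[OF W'(1)]
      by (intro exI[of _ "{z \<in> N. \<phi> z \<in> W'}"] exI[of _ "\<lambda>z. h (\<phi> z)"]) auto
  qed
  then show ?thesis unfolding regular_map_def using N by blast
qed

end

section \<open>Frames and their lifts\<close>

text \<open>
  Over the open set \<open>A\<close> the vector fields \<open>e1\<close>, \<open>e2\<close> form a frame of the rank 2 bundle \<open>B\<close>, dual to the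
  differentials of \<open>a\<close>, \<open>b\<close>. The last clause says that the vector fields are regular.
\<close>

definition frame ::
    "('p, 'k::field) fspace \<Rightarrow> ('p \<Rightarrow> ('p, 'k) tvec set) \<Rightarrow> 'p set \<Rightarrow> ('p \<Rightarrow> 'k) \<Rightarrow> ('p \<Rightarrow> 'k) \<Rightarrow>
     ('p \<Rightarrow> ('p, 'k) tvec) \<Rightarrow> ('p \<Rightarrow> ('p, 'k) tvec) \<Rightarrow> bool" where
  "frame X B A a b e1 e2 \<longleftrightarrow>
     openin (zariski X) A \<and> regular X A a \<and> regular X A b \<and>
     (\<forall>p\<in>A. e1 p \<in> tangent_space X p \<and> e2 p \<in> tangent_space X p \<and>
        e1 p a = 1 \<and> e1 p b = 0 \<and> e2 p a = 0 \<and> e2 p b = 1 \<and>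
        B p = {(\<lambda>f. c * e1 p f + d * e2 p f) |c d. True}) \<and>
     (\<forall>W g. regular X W g \<longrightarrow>
        regular X (W \<inter> A) (\<lambda>p. e1 p g) \<and> regular X (W \<inter> A) (\<lambda>p. e2 p g))"

lemma frame_swap:
  assumes "frame X B A a b e1 e2"
  shows "frame X B A b a e2 e1"
proof -
  have "{(\<lambda>f. c * e1 p f + d * e2 p f) |c d. True} = {(\<lambda>f. c * e2 p f + d * e1 p f) |c d. True}"
    (is "?L = ?R") for p
  proof (intro equalityI subsetI)
    fix v assume "v \<in> ?L"
    then obtain c d where "v = (\<lambda>f. d * e2 p f + c * e1 p f)" by (auto simp: add.commute)
    then show "v \<in> ?R" by blast
  next
    fix v assume "v \<in> ?R"
    then obtain c d where "v = (\<lambda>f. d * e1 p f + c * e2 p f)" by (auto simp: add.commute)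
    then show "v \<in> ?L" by blast
  qed
  with assms show ?thesis unfolding frame_def by simp
qed

lemma
  assumes "frame X B A a b e1 e2"
  shows frame_open: "openin (zariski X) A"
    and frame_coord1: "regular X A a"
    and frame_coord2: "regular X A b"
    and frame_regular1: "regular X W g \<Longrightarrow> regular X (W \<inter> A) (\<lambda>p. e1 p g)"
    and frame_regular2: "regular X W g \<Longrightarrow> regular X (W \<inter> A) (\<lambda>p. e2 p g)"
proof -
  show "openin (zariski X) A" "regular X A a" "regular X A b"
    using assms unfolding frame_def by - (elim conjE; assumption)+
  have *: "\<forall>W g. regular X W g \<longrightarrow>
        regular X (W \<inter> A) (\<lambda>p. e1 p g) \<and> regular X (W \<inter> A) (\<lambda>p. e2 p g)"
    using assms unfolding frame_def by (elim conjE)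
  show "regular X W g \<Longrightarrow> regular X (W \<inter> A) (\<lambda>p. e1 p g)"
    "regular X W g \<Longrightarrow> regular X (W \<inter> A) (\<lambda>p. e2 p g)"
    using *[THEN spec, THEN spec, THEN mp] by iprover+
qed

lemma
  assumes "frame X B A a b e1 e2" "p \<in> A"
  shows frame_tangent1: "e1 p \<in> tangent_space X p"
    and frame_tangent2: "e2 p \<in> tangent_space X p"
    and frame_dual: "e1 p a = 1" "e1 p b = 0" "e2 p a = 0" "e2 p b = 1"
    and frame_bundle: "B p = {(\<lambda>f. c * e1 p f + d * e2 p f) |c d. True}"
proof -
  have *: "\<forall>p\<in>A. e1 p \<in> tangent_space X p \<and> e2 p \<in> tangent_space X p \<and>
        e1 p a = 1 \<and> e1 p b = 0 \<and> e2 p a = 0 \<and> e2 p b = 1 \<and>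
        B p = {(\<lambda>f. c * e1 p f + d * e2 p f) |c d. True}"
    using assms(1) unfolding frame_def by (elim conjE)
  show "e1 p \<in> tangent_space X p" "e2 p \<in> tangent_space X p"
    "e1 p a = 1" "e1 p b = 0" "e2 p a = 0" "e2 p b = 1"
    "B p = {(\<lambda>f. c * e1 p f + d * e2 p f) |c d. True}"
    using bspec[OF * assms(2)] by - (elim conjE; assumption)+
qed

lemma frame_expand:
  assumes fr: "frame X B A a b e1 e2" and p: "p \<in> A" and "v \<in> B p"
  shows "v = (\<lambda>f. v a * e1 p f + v b * e2 p f)"
proof -
  obtain c d where v: "v = (\<lambda>f. c * e1 p f + d * e2 p f)"
    using assms(3) unfolding frame_bundle[OF fr p] by blast
  have "v a = c" "v b = d" by (simp_all add: v frame_dual[OF fr p])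
  then show ?thesis using v by simp
qed

lemma frame_eqI:
  assumes fr: "frame X B A a b e1 e2" and p: "p \<in> A" and "v \<in> B p" "w \<in> B p" "v a = w a" "v b = w b"
  shows "v = w"
  by (subst frame_expand[OF fr p assms(3)], subst frame_expand[OF fr p assms(4)]) (simp only: assms(5,6))

lemma frame_combination:
  assumes fr: "frame X B A a b e1 e2" and p: "p \<in> A"
  shows "(\<lambda>f. c * e1 p f + d * e2 p f) \<in> B p"
  unfolding frame_bundle[OF fr p] by blast

lemma frame_bundle_tangent:
  assumes fr: "frame X B A a b e1 e2" and p: "p \<in> A"
  shows "B p \<subseteq> tangent_space X p"
  unfolding frame_bundle[OF fr p]
  using tangent_combination[OF frame_tangent1[OF fr p] frame_tangent2[OF fr p]] by blast

lemma frame_scale: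
  assumes fr: "frame X B A a b e1 e2" and p: "p \<in> A" and "v \<in> B p"
  shows "span1 v \<subseteq> B p"
proof
  fix w assume "w \<in> span1 v"
  then obtain c where w: "w = (\<lambda>f. c * v f)" unfolding span1_def by blast
  have "w = (\<lambda>f. (c * v a) * e1 p f + (c * v b) * e2 p f)"
    unfolding w by (subst frame_expand[OF fr p assms(3)]) (simp add: algebra_simps)
  then show "w \<in> B p" using frame_combination[OF fr p] by metis
qed

lemma span1_scale:
  assumes "c \<noteq> 0"
  shows "span1 (\<lambda>f. c * w f) = span1 w"
proof -
  have "\<exists>c'. (\<lambda>f. d * w f) = (\<lambda>f. c' * (c * w f))" for d
    by (rule exI[of _ "d / c"]) (simp add: assms)
  then show ?thesis unfolding span1_def by (auto simp flip: mult.assoc)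
qed

text \<open>
  The space of lines in \<open>B\<close>, over an open set \<open>A\<close> on which \<open>B\<close> has a frame dual to \<open>da\<close>, \<open>db\<close>. The
  aim is a frame, over the chart where \<open>da\<close> does not vanish, of the bundle of tangent vectors of
  \<open>Y\<close> that project into the line represented by their point of application.
\<close>

locale framed_line_bundle = line_bundle_space X B Y \<pi> \<delta>
  for X :: "('p, 'k::field_char_0) fspace" and B Y \<pi> \<delta> +
  fixes A a b e1 e2
  assumes fr: "frame X B A a b e1 e2"
begin

text \<open>The points of \<open>Y\<close> over \<open>A\<close> that represent a line on which \<open>da\<close> does not vanish.\<close>

definition lift_chart where "lift_chart = {q \<in> points Y. \<pi> q \<in> A \<and> nonzero_on (\<delta> q) a}"

text \<open>The fiber coordinate \<open>db/da\<close>.\<close>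

abbreviation "slope \<equiv> dquotient \<delta> b a"

text \<open>
  The vector at \<open>p\<close> in the direction of slope \<open>c\<close>, normalized by \<open>da = 1\<close>.
\<close>

definition slope_vector where "slope_vector p c = (\<lambda>f. e1 p f + c * e2 p f)"

lemma slope_vector_bundle: "p \<in> A \<Longrightarrow> slope_vector p c \<in> B p"
  using frame_combination[OF fr, of p 1 c] by (simp add: slope_vector_def)

lemma slope_vector_tangent: "p \<in> A \<Longrightarrow> slope_vector p c \<in> tangent_space X p"
  using slope_vector_bundle frame_bundle_tangent[OF fr] by blast

lemma slope_vector_coord: "p \<in> A \<Longrightarrow> slope_vector p c a = 1" "p \<in> A \<Longrightarrow> slope_vector p c b = c"
  by (simp_all add: slope_vector_def frame_dual[OF fr])

lemma lift_chart_points: "q \<in> lift_chart \<Longrightarrow> q \<in> points Y"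
  and lift_chart_proj: "q \<in> lift_chart \<Longrightarrow> \<pi> q \<in> A"
  and lift_chart_nonzero: "q \<in> lift_chart \<Longrightarrow> nonzero_on (\<delta> q) a"
  by (simp_all add: lift_chart_def)

lemma lift_chart_direction:
  assumes q: "q \<in> lift_chart"
  shows "\<delta> q = span1 (slope_vector (\<pi> q) (slope q))"
proof -
  from direction[OF lift_chart_points[OF q]] obtain w where w: "\<delta> q = span1 w" "w \<in> B (\<pi> q)" .
  have ne: "w a \<noteq> 0" using lift_chart_nonzero[OF q] by (simp add: w nonzero_on_span1)
  have slope: "slope q = w b / w a" by (rule dquotient_span1[of \<delta>, OF w(1) ne])
  have "w = (\<lambda>f. w a * slope_vector (\<pi> q) (slope q) f)"
    unfolding slope_vector_def slope
    by (subst frame_expand[OF fr lift_chart_proj[OF q] w(2)]) (simp add: ne algebra_simps)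
  then show ?thesis unfolding w using span1_scale[OF ne] by metis
qed

lemma lift_chart_eqI:
  assumes "q \<in> lift_chart" "r \<in> lift_chart" "\<pi> q = \<pi> r" "slope q = slope r"
  shows "q = r"
  using assms lift_chart_direction point_eqI lift_chart_points by metis

lemma point_of_slope_exists:
  assumes p: "p \<in> A"
  shows "\<exists>q. q \<in> lift_chart \<and> \<pi> q = p \<and> slope q = c"
proof -
  have pX: "p \<in> points X" using frame_open[OF fr] openin_subset p by blast
  have ne: "slope_vector p c a \<noteq> 0" by (simp add: slope_vector_coord p)
  from point_exists[OF pX ne frame_scale[OF fr p slope_vector_bundle[OF p]]]
  obtain q where q: "q \<in> points Y" "\<pi> q = p" "\<delta> q = span1 (slope_vector p c)" .
  have "q \<in> lift_chart" unfolding lift_chart_def using q p ne by (simp add: nonzero_on_span1)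
  moreover have "slope q = c"
    using dquotient_span1[of \<delta>, OF q(3) ne] by (simp add: slope_vector_coord p)
  ultimately show ?thesis using q(2) by blast
qed

text \<open>
  The point of the chart over \<open>p\<close> where the fiber coordinate is \<open>c\<close>. For fixed \<open>c\<close> this is a section
  over \<open>A\<close>, for fixed \<open>p\<close> a parametrization of the fiber.
\<close>

definition point_of_slope where
  "point_of_slope p c = (SOME q. q \<in> lift_chart \<and> \<pi> q = p \<and> slope q = c)"

lemma
  assumes "p \<in> A"
  shows point_of_slope: "point_of_slope p c \<in> lift_chart"
    and point_of_slope_proj: "\<pi> (point_of_slope p c) = p"
    and point_of_slope_coord: "slope (point_of_slope p c) = c"
  using someI_ex[OF point_of_slope_exists[OF assms]] unfolding point_of_slope_def by blast+

lemma point_of_slope_self: "q \<in> lift_chart \<Longrightarrow> point_of_slope (\<pi> q) (slope q) = q"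
  by (rule lift_chart_eqI[OF point_of_slope _ point_of_slope_proj point_of_slope_coord]) (simp_all add: lift_chart_proj)

lemma point_of_slope_direction: "p \<in> A \<Longrightarrow> \<delta> (point_of_slope p c) = span1 (slope_vector p c)"
  using lift_chart_direction[OF point_of_slope] by (simp add: point_of_slope_proj point_of_slope_coord)

lemma slope_regular: "regular Y lift_chart slope"
  using quotient_regular[OF frame_coord2[OF fr] frame_coord1[OF fr]] unfolding lift_chart_def .

lemma lift_chart_open: "openin (zariski Y) lift_chart"
  by (rule regular_openin[OF function_space_Y slope_regular])

lemma pullback_regular: "regular X W g \<Longrightarrow> regular Y {q \<in> points Y. \<pi> q \<in> W} (\<lambda>q. g (\<pi> q))"
  by (rule lfun_regular[OF line_fun.pullback])

lemma pullback_regular_at: "regular X W g \<Longrightarrow> q \<in> points Y \<Longrightarrow> \<pi> q \<in> W \<Longrightarrow> regular_at Y q (\<lambda>q. g (\<pi> q))"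
  unfolding regular_at_def by (intro exI[of _ "{q \<in> points Y. \<pi> q \<in> W}"] conjI pullback_regular) auto

lemma section_regular_map: "regular_map X Y (\<lambda>p. point_of_slope p c) A"
proof (rule regular_map_lift[OF base frame_open[OF fr], where \<omega> = "\<lambda>p. slope_vector p c"])
  show "(\<lambda>p. point_of_slope p c) ` A \<subseteq> points Y"
    using point_of_slope lift_chart_points by blast
  show "regular_map X X (\<lambda>z. \<pi> (point_of_slope z c)) A"
    unfolding regular_map_def
  proof (intro conjI allI impI)
    show "openin (zariski X) A" by (rule frame_open[OF fr])
    then show "(\<lambda>z. \<pi> (point_of_slope z c)) ` A \<subseteq> points X"
      using openin_subset by (force simp: point_of_slope_proj)
    fix W g assume g: "regular X W g"
    have e: "{z \<in> A. \<pi> (point_of_slope z c) \<in> W} = W \<inter> A" by (auto simp: point_of_slope_proj)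
    have "openin (zariski X) (W \<inter> A)"
      using regular_openin[OF base g] frame_open[OF fr] by blast
    from regular_restrict[OF base g this] have "regular X (W \<inter> A) g" by simp
    then show "regular X {z \<in> A. \<pi> (point_of_slope z c) \<in> W} (\<lambda>z. g (\<pi> (point_of_slope z c)))"
      unfolding e by (rule regular_cong[OF base]) (simp add: point_of_slope_proj)
  qed
  show "\<delta> (point_of_slope z c) = span1 (slope_vector z c)" if "z \<in> A" for z
    by (rule point_of_slope_direction[OF that])
  fix W u assume u: "regular X W u"
  have e: "{z \<in> A. \<pi> (point_of_slope z c) \<in> W} = W \<inter> A" by (auto simp: point_of_slope_proj)
  have o: "openin (zariski X) (W \<inter> A)"
    using regular_openin[OF base u] frame_open[OF fr] by blast
  show "regular X {z \<in> A. \<pi> (point_of_slope z c) \<in> W} (\<lambda>z. slope_vector z c u)"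
    unfolding e slope_vector_def
    by (intro regular_add[OF base] regular_mult[OF base] regular_const[OF base o]
        frame_regular1[OF fr u] frame_regular2[OF fr u])
qed

lemma fiber_regular_map:
  assumes p: "p \<in> A"
  shows "regular_map affine_line Y (\<lambda>s. point_of_slope p s) UNIV"
proof -
  note line = function_space_affine_line[where 'k='k]
  have pX: "p \<in> points X" using frame_open[OF fr] openin_subset p by blast
  have U: "openin (zariski affine_line) (UNIV :: 'k set)"
    using openin_topspace[of "zariski (affine_line :: ('k,'k) fspace)"] by simp
  have E: "regular affine_line {z \<in> (UNIV :: 'k set). p \<in> W} f"
    if "regular affine_line UNIV f" for W f
  proof (cases "p \<in> W")
    case False
    have "regular affine_line {} f"
      by (rule regular_affine_lineI) simp
    then show ?thesis using False by simp
  qed (use that in simp)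
  show ?thesis
  proof (rule regular_map_lift[OF line U, where \<omega> = "\<lambda>s. slope_vector p s"])
    show "point_of_slope p ` UNIV \<subseteq> points Y"
      using point_of_slope[OF p] lift_chart_points by blast
    show "regular_map affine_line X (\<lambda>z. \<pi> (point_of_slope p z)) UNIV"
      unfolding regular_map_def point_of_slope_proj[OF p]
    proof (intro conjI allI impI)
      show "openin (zariski affine_line) (UNIV :: 'k set)" by (rule U)
      show "range (\<lambda>z. p) \<subseteq> points X" using pX by blast
      show "regular affine_line {z \<in> (UNIV :: 'k set). p \<in> W} (\<lambda>z. g p)" for W g
        by (rule E) (rule regular_const[OF line U])
    qed
    show "\<delta> (point_of_slope p z) = span1 (slope_vector p z)" for z
      by (rule point_of_slope_direction[OF p])
    fix W u
    have "slope_vector p z u = poly [:e1 p u, e2 p u:] z" for z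
      by (simp add: slope_vector_def)
    then show "regular affine_line {z \<in> UNIV. \<pi> (point_of_slope p z) \<in> W} (\<lambda>z. slope_vector p z u)"
      unfolding point_of_slope_proj[OF p]
      by (intro E) (simp only: regular_affine_line_poly)
  qed
qed

text \<open>
  Near a point of the chart every regular function is built from pullbacks and the fiber coordinate
  by sums, products and inverses: if \<open>\<omega>\<close> is the vector of slope \<open>s\<close>, then \<open>du/dv\<close> is \<open>\<omega>(u)/\<omega>(v)\<close>, where
  \<open>\<omega>(u) = e1(u) + s e2(u)\<close>.
\<close>

lemma germ_induct [consumes 2, case_names pullback coord add mult inverse cong]:
  assumes q: "q \<in> lift_chart" and f: "regular_at Y q f"
    and pb: "\<And>W g. regular X W g \<Longrightarrow> \<pi> q \<in> W \<Longrightarrow> P (\<lambda>r. g (\<pi> r))"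
    and tt: "P slope"
    and add: "\<And>f g. regular_at Y q f \<Longrightarrow> regular_at Y q g \<Longrightarrow> P f \<Longrightarrow> P g \<Longrightarrow> P (\<lambda>r. f r + g r)"
    and mult: "\<And>f g. regular_at Y q f \<Longrightarrow> regular_at Y q g \<Longrightarrow> P f \<Longrightarrow> P g \<Longrightarrow> P (\<lambda>r. f r * g r)"
    and inv: "\<And>f. regular_at Y q f \<Longrightarrow> f q \<noteq> 0 \<Longrightarrow> P f \<Longrightarrow> P (\<lambda>r. inverse (f r))"
    and cong: "\<And>f g W. regular_at Y q f \<Longrightarrow> P f \<Longrightarrow> openin (zariski Y) W \<Longrightarrow> q \<in> W \<Longrightarrow>
        (\<And>r. r \<in> W \<Longrightarrow> g r = f r) \<Longrightarrow> P g"
  shows "P f"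
proof -
  note fs = function_space_Y
  have rt: "regular_at Y q slope" unfolding regular_at_def using slope_regular q by blast
  have lf: "P h" if "lfun W h" "q \<in> W" for W h
    using that
  proof (induction rule: line_fun.induct)
    case (pullback U g)
    then show ?case using pb by blast
  next
    case (quotient U u v)
    define num where "num u r = e1 (\<pi> r) u + slope r * e2 (\<pi> r) u" for u r
    have qU: "\<pi> q \<in> U" "nonzero_on (\<delta> q) v" using quotient by auto
    have num: "regular_at Y q (num w) \<and> P (num w)" if w: "regular X U w" for w
    proof -
      have qW: "\<pi> q \<in> U \<inter> A" using qU lift_chart_proj[OF q] by blast
      note r1 = frame_regular1[OF fr w] and r2 = frame_regular2[OF fr w]
      note R1 = pullback_regular_at[OF r1 lift_chart_points[OF q] qW]
        and R2 = pullback_regular_at[OF r2 lift_chart_points[OF q] qW]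
      have "regular_at Y q (\<lambda>r. slope r * e2 (\<pi> r) w)" "P (\<lambda>r. slope r * e2 (\<pi> r) w)"
        by (intro regular_at_mult[OF fs] rt R2) (intro mult rt R2 tt pb[OF r2 qW])
      then show ?thesis unfolding num_def
        by (intro conjI regular_at_add[OF fs] R1 add pb[OF r1 qW])
    qed
    have dir: "\<delta> r = span1 (slope_vector (\<pi> r) (slope r))" "slope_vector (\<pi> r) (slope r) w = num w r"
      if "r \<in> lift_chart" for r w
      using lift_chart_direction[OF that] by (simp_all add: slope_vector_def num_def)
    have nz: "num v q \<noteq> 0" using qU(2) dir(1)[OF q] by (simp add: nonzero_on_span1 dir(2)[OF q])
    have nu: "regular_at Y q (num u)" "P (num u)" and nv: "regular_at Y q (num v)" "P (num v)"
      using num quotient by blast+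
    have "regular_at Y q (\<lambda>r. num u r * inverse (num v r))" "P (\<lambda>r. num u r * inverse (num v r))"
      by (intro regular_at_mult[OF fs] regular_at_inverse[OF fs] nu nv nz)
        (intro mult nu inv nv nz regular_at_inverse[OF fs])
    then show ?case
    proof (rule cong)
      let ?W = "{r \<in> points Y. \<pi> r \<in> U \<and> nonzero_on (\<delta> r) v} \<inter> lift_chart"
      show "openin (zariski Y) ?W"
        using lfun_open[OF line_fun.quotient[OF quotient(1,2)]] lift_chart_open by blast
      show "q \<in> ?W" using quotient.prems q by blast
      fix r assume r: "r \<in> ?W"
      then have rc: "r \<in> lift_chart" by blast
      have "slope_vector (\<pi> r) (slope r) v \<noteq> 0"
        using r dir(1)[OF rc] by (simp add: nonzero_on_span1)
      from dquotient_span1[of \<delta>, OF dir(1)[OF rc] this, of u]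
      show "dquotient \<delta> u v r = num u r * inverse (num v r)"
        unfolding dir(2)[OF rc] by (simp add: divide_inverse)
    qed
  next
    case (add W f W' g)
    have "regular_at Y q f" "regular_at Y q g"
      unfolding regular_at_def using add.hyps lfun_regular add.prems by blast+
    then show ?case using add.IH add.prems assms(5) by blast
  next
    case (mult W f W' g)
    have "regular_at Y q f" "regular_at Y q g"
      unfolding regular_at_def using mult.hyps lfun_regular mult.prems by blast+
    then show ?case using mult.IH mult.prems assms(6) by blast
  next
    case (inverse W f)
    have "regular_at Y q f"
      unfolding regular_at_def using inverse.hyps lfun_regular inverse.prems by blast
    then show ?case using inverse.IH inverse.prems inv by blast
  qed
  obtain W where W: "q \<in> W" "regular Y W f" using f unfolding regular_at_def by blast
  obtain W' h where W': "lfun W' h" "q \<in> W'" "W' \<subseteq> W" "\<forall>r\<in>W'. f r = h r"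
    by (rule regular_lfun[OF W(2,1)])
  have "regular_at Y q h" unfolding regular_at_def using lfun_regular[OF W'(1)] W'(2) by blast
  then show ?thesis
    by (rule cong[OF _ lf[OF W'(1,2)] lfun_open[OF W'(1)] W'(2)]) (rule bspec[OF W'(4)])
qed

lemma tangent_vector_eqI:
  assumes q: "q \<in> lift_chart" and v: "v \<in> tangent_space Y q" and w: "w \<in> tangent_space Y q"
    and pb: "\<And>W g. regular X W g \<Longrightarrow> \<pi> q \<in> W \<Longrightarrow> v (\<lambda>r. g (\<pi> r)) = w (\<lambda>r. g (\<pi> r))"
    and tt: "v slope = w slope"
  shows "v = w"
proof
  fix f
  note fs = function_space_Y
  show "v f = w f"
  proof (cases "regular_at Y q f")
    case True
    with q show ?thesis
    proof (induction rule: germ_induct)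
      case (pullback W g)
      then show ?case by (rule pb)
    next
      case coord
      show ?case by (rule tt)
    next
      case (add f g)
      then show ?case using tangent_add[OF v add(1,2)] tangent_add[OF w add(1,2)] by simp
    next
      case (mult f g)
      then show ?case using tangent_mult[OF v mult(1,2)] tangent_mult[OF w mult(1,2)] by simp
    next
      case (inverse f)
      then show ?case using tangent_inverse[OF fs v inverse(1,2)] tangent_inverse[OF fs w inverse(1,2)] by simp
    next
      case (cong f g W)
      show ?case
        by (rule trans[OF tangent_cong[OF v fs cong.hyps(1-3)] trans[OF cong.IH
                tangent_cong[OF w fs cong.hyps(1-3), symmetric]]]) (rule cong.hyps(4), assumption)+
    qed
  qed (simp add: tangent_not_regular[OF v] tangent_not_regular[OF w])
qed

text \<open>
  A vector field is regular if its values on pullbacks and on the fiber coordinate are.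
\<close>

lemma field_regular:
  assumes E: "\<And>q. q \<in> lift_chart \<Longrightarrow> E q \<in> tangent_space Y q"
    and pb: "\<And>W g. regular X W g \<Longrightarrow> regular Y {q \<in> lift_chart. \<pi> q \<in> W} (\<lambda>q. E q (\<lambda>r. g (\<pi> r)))"
    and tt: "regular Y lift_chart (\<lambda>q. E q slope)"
    and f: "regular Y W f"
  shows "regular Y (W \<inter> lift_chart) (\<lambda>q. E q f)"
proof (rule regular_locally[OF function_space_Y])
  note fs = function_space_Y
  fix q assume q: "q \<in> W \<inter> lift_chart"
  then have qc: "q \<in> lift_chart" and rf: "regular_at Y q f" unfolding regular_at_def using f by blast+
  have inter: "regular Y (W1 \<inter> W2) g" if "regular Y W1 g" "openin (zariski Y) W2" for W1 W2 g
    using regular_restrict[OF fs that(1)] regular_openin[OF fs that(1)] that(2) by blast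
  have at: "regular_at Y s g" if "regular Y W1 g" "s \<in> W1" for W1 s g
    unfolding regular_at_def using that by blast
  let ?Q = "\<lambda>f. \<exists>W'. q \<in> W' \<and> W' \<subseteq> lift_chart \<and> regular Y W' f \<and> regular Y W' (\<lambda>s. E s f)"
  have common: "\<exists>W. q \<in> W \<and> W \<subseteq> lift_chart \<and> regular Y W f \<and> regular Y W (\<lambda>s. E s f) \<and>
      regular Y W g \<and> regular Y W (\<lambda>s. E s g)" if "?Q f" "?Q g" for f g
  proof -
    from that obtain W1 W2 where 1: "q \<in> W1" "W1 \<subseteq> lift_chart" "regular Y W1 f" "regular Y W1 (\<lambda>s. E s f)"
      and 2: "q \<in> W2" "W2 \<subseteq> lift_chart" "regular Y W2 g" "regular Y W2 (\<lambda>s. E s g)"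
      by (elim exE conjE)
    note o1 = regular_openin[OF fs 1(3)] and o2 = regular_openin[OF fs 2(3)]
    show ?thesis
      using 1(1,2) 2(1) inter[OF 1(3) o2] inter[OF 1(4) o2] inter[OF 2(3) o1] inter[OF 2(4) o1]
      unfolding Int_commute[of W2 W1] by (intro exI[of _ "W1 \<inter> W2"]) auto
  qed
  from qc rf have "?Q f"
  proof (induction rule: germ_induct)
    case (pullback W g)
    have "regular Y {q \<in> lift_chart. \<pi> q \<in> W} (\<lambda>r. g (\<pi> r))"
      by (rule regular_restrict[OF fs pullback_regular[OF pullback(1)]
          regular_openin[OF fs pb[OF pullback(1)]]]) (use lift_chart_points in blast)
    then show ?case using qc pullback pb[OF pullback(1)]
      by (intro exI[of _ "{q \<in> lift_chart. \<pi> q \<in> W}"]) simp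
  next
    case coord
    show ?case using qc tt slope_regular by (intro exI[of _ lift_chart]) simp
  next
    case (add f g)
    obtain W where W: "q \<in> W" "W \<subseteq> lift_chart" "regular Y W f" "regular Y W (\<lambda>s. E s f)"
      "regular Y W g" "regular Y W (\<lambda>s. E s g)"
      using common[OF add.IH] by (elim exE conjE)
    have "regular Y W (\<lambda>s. E s (\<lambda>r. f r + g r))"
      by (rule regular_cong[OF fs regular_add[OF fs W(4,6)]], rule tangent_add[OF E at[OF W(3)] at[OF W(5)]])
        (use W(2) in auto)
    then show ?case using W regular_add[OF fs W(3,5)] by (intro exI[of _ W]) simp
  next
    case (mult f g)
    obtain W where W: "q \<in> W" "W \<subseteq> lift_chart" "regular Y W f" "regular Y W (\<lambda>s. E s f)"
      "regular Y W g" "regular Y W (\<lambda>s. E s g)"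
      using common[OF mult.IH] by (elim exE conjE)
    have "regular Y W (\<lambda>s. E s (\<lambda>r. f r * g r))"
      by (rule regular_cong[OF fs regular_add[OF fs regular_mult[OF fs W(3,6)] regular_mult[OF fs W(5,4)]]],
          rule tangent_mult[OF E at[OF W(3)] at[OF W(5)]]) (use W(2) in auto)
    then show ?case using W regular_mult[OF fs W(3,5)] by (intro exI[of _ W]) simp
  next
    case (inverse f)
    then obtain W1 where 1: "q \<in> W1" "W1 \<subseteq> lift_chart" "regular Y W1 f" "regular Y W1 (\<lambda>s. E s f)"
      by (elim exE conjE)
    let ?W = "{s \<in> W1. f s \<noteq> 0}"
    have i: "regular Y ?W (\<lambda>s. inverse (f s))" by (rule regular_inverse[OF fs 1(3)])
    note o = regular_openin[OF fs i]
    have d: "regular Y ?W (\<lambda>s. E s f)" by (rule regular_restrict[OF fs 1(4) o]) blast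
    have "regular Y ?W (\<lambda>s. E s (\<lambda>r. inverse (f r)))"
    proof (rule regular_cong[OF fs regular_mult[OF fs regular_const[OF fs o, of "-1"]
          regular_mult[OF fs regular_mult[OF fs i i] d]]])
      fix s assume s: "s \<in> ?W"
      have "E s (\<lambda>r. inverse (f r)) = - (inverse (f s) * inverse (f s) * E s f)"
        by (rule tangent_inverse[OF fs E at[OF 1(3)]]) (use s 1(2) in auto)
      then show "E s (\<lambda>r. inverse (f r)) = - 1 * (inverse (f s) * inverse (f s) * E s f)" by simp
    qed
    then show ?case using i 1 inverse(2) by (intro exI[of _ ?W]) auto
  next
    case (cong f g W)
    then obtain W1 where 1: "q \<in> W1" "W1 \<subseteq> lift_chart" "regular Y W1 f" "regular Y W1 (\<lambda>s. E s f)"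
      by (elim exE conjE)
    have "regular Y (W1 \<inter> W) (\<lambda>s. E s g)"
    proof (rule regular_cong[OF fs inter[OF 1(4) cong.hyps(2)]])
      fix s assume s: "s \<in> W1 \<inter> W"
      show "E s g = E s f"
        by (rule tangent_cong[OF E fs at[OF 1(3)] cong.hyps(2)]) (use s 1(2) cong.hyps(4) in auto)
    qed
    moreover have "regular Y (W1 \<inter> W) g"
      by (rule regular_cong[OF fs inter[OF 1(3) cong.hyps(2)]]) (use cong.hyps(4) in auto)
    ultimately show ?case using 1 cong.hyps(3) by (intro exI[of _ "W1 \<inter> W"]) auto
  qed
  then obtain W1 where 1: "q \<in> W1" "W1 \<subseteq> lift_chart" "regular Y W1 f" "regular Y W1 (\<lambda>s. E s f)"
    by (elim exE conjE)
  show "\<exists>W' f'. q \<in> W' \<and> W' \<subseteq> W \<inter> lift_chart \<and> regular Y W' f' \<and> (\<forall>q\<in>W'. E q f = f' q)"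
    using 1 q inter[OF 1(4) regular_openin[OF fs f]]
    by (intro exI[of _ "W1 \<inter> W"] exI[of _ "\<lambda>s. E s f"]) auto
qed

text \<open>
  The lift of the tautological vector \<open>slope_vector\<close> at \<open>\<pi> q\<close> to \<open>q\<close> that is tangent to the section of
  constant slope through \<open>q\<close>.
\<close>

definition horizontal where
  "horizontal q = pushforward Y (\<lambda>p. point_of_slope p (slope q)) (\<pi> q) (slope_vector (\<pi> q) (slope q))"

text \<open>
  The velocity, at \<open>q\<close>, of the fiber through \<open>q\<close> parametrized by the slope.
\<close>

definition vertical where
  "vertical q = pushforward Y (\<lambda>s. point_of_slope (\<pi> q) s) (slope q) (ddt (slope q))"

lemma horizontal_tangent: "q \<in> lift_chart \<Longrightarrow> horizontal q \<in> tangent_space Y q"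
  using pushforward_tangent[OF base function_space_Y section_regular_map lift_chart_proj slope_vector_tangent]
    lift_chart_proj point_of_slope_self
  unfolding horizontal_def by metis

lemma vertical_tangent: "q \<in> lift_chart \<Longrightarrow> vertical q \<in> tangent_space Y q"
  using pushforward_tangent[OF function_space_affine_line function_space_Y fiber_regular_map UNIV_I ddt_tangent]
    lift_chart_proj point_of_slope_self
  unfolding vertical_def by metis

lemma horizontal_pullback:
  assumes q: "q \<in> lift_chart" and g: "regular X W g" "\<pi> q \<in> W"
  shows "horizontal q (\<lambda>r. g (\<pi> r)) = slope_vector (\<pi> q) (slope q) g"
proof -
  have "regular_at Y q (\<lambda>r. g (\<pi> r))"
    by (rule pullback_regular_at[OF g(1) lift_chart_points[OF q] g(2)])
  then have "horizontal q (\<lambda>r. g (\<pi> r)) =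
      slope_vector (\<pi> q) (slope q) (\<lambda>p. g (\<pi> (point_of_slope p (slope q))))"
    by (simp add: horizontal_def pushforward_def point_of_slope_self[OF q])
  also have "\<dots> = slope_vector (\<pi> q) (slope q) g"
    by (rule tangent_cong[OF slope_vector_tangent[OF lift_chart_proj[OF q]] base _ frame_open[OF fr] lift_chart_proj[OF q]])
      (use g in \<open>auto simp: point_of_slope_proj regular_at_def\<close>)
  finally show ?thesis .
qed

lemma slope_regular_at: "q \<in> lift_chart \<Longrightarrow> regular_at Y q slope"
  unfolding regular_at_def using slope_regular by blast

lemma horizontal_slope:
  assumes q: "q \<in> lift_chart"
  shows "horizontal q slope = 0"
proof -
  have "horizontal q slope = slope_vector (\<pi> q) (slope q) (\<lambda>p. slope (point_of_slope p (slope q)))"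
    by (simp add: horizontal_def pushforward_def point_of_slope_self[OF q] slope_regular_at[OF q])
  also have "\<dots> = 0"
    by (rule tangent_locally_const[OF base slope_vector_tangent[OF lift_chart_proj[OF q]] frame_open[OF fr]
        lift_chart_proj[OF q]]) (rule point_of_slope_coord)
  finally show ?thesis .
qed

lemma vertical_pullback:
  assumes q: "q \<in> lift_chart" and g: "regular X W g" "\<pi> q \<in> W"
  shows "vertical q (\<lambda>r. g (\<pi> r)) = 0"
proof -
  have "regular_at Y q (\<lambda>r. g (\<pi> r))"
    by (rule pullback_regular_at[OF g(1) lift_chart_points[OF q] g(2)])
  then have "vertical q (\<lambda>r. g (\<pi> r)) = ddt (slope q) (\<lambda>s. g (\<pi> q))"
    by (simp add: vertical_def pushforward_def point_of_slope_self[OF q] point_of_slope_proj[OF lift_chart_proj[OF q]])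
  also have "\<dots> = 0" by (rule tangent_const[OF function_space_affine_line _ ddt_tangent]) simp
  finally show ?thesis .
qed

lemma vertical_slope:
  assumes q: "q \<in> lift_chart"
  shows "vertical q slope = 1"
  by (simp add: vertical_def pushforward_def point_of_slope_self[OF q] slope_regular_at[OF q]
      point_of_slope_coord[OF lift_chart_proj[OF q]] ddt_ident)

text \<open>
  The tangent vectors of \<open>Y\<close> at \<open>q\<close> that project into the line represented by \<open>q\<close>. For the tower this
  is the next focal bundle.
\<close>

definition lifted_bundle where
  "lifted_bundle q = {v \<in> tangent_space Y q. differential X \<pi> q v \<in> \<delta> q}"

lemma lifted_bundle_combination:
  assumes q: "q \<in> lift_chart"
  shows "lifted_bundle q = {(\<lambda>f. c * horizontal q f + d * vertical q f) |c d. True}"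
proof (intro equalityI subsetI)
  note p = lift_chart_proj[OF q]
  have ax: "\<exists>W. regular X W a \<and> \<pi> q \<in> W" using frame_coord1[OF fr] p by blast
  fix v assume v: "v \<in> lifted_bundle q"
  then have vt: "v \<in> tangent_space Y q" and d: "differential X \<pi> q v \<in> span1 (slope_vector (\<pi> q) (slope q))"
    by (auto simp: lifted_bundle_def lift_chart_direction[OF q])
  obtain c where c: "differential X \<pi> q v = (\<lambda>f. c * slope_vector (\<pi> q) (slope q) f)"
    using d unfolding span1_def by blast
  have "v = (\<lambda>f. c * horizontal q f + v slope * vertical q f)"
  proof (rule tangent_vector_eqI[OF q vt])
    show "(\<lambda>f. c * horizontal q f + v slope * vertical q f) \<in> tangent_space Y q"
      by (rule tangent_combination[OF horizontal_tangent[OF q] vertical_tangent[OF q]])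
    show "v slope = c * horizontal q slope + v slope * vertical q slope"
      by (simp add: horizontal_slope[OF q] vertical_slope[OF q])
    fix W g assume g: "regular X W g" "\<pi> q \<in> W"
    then have "regular_at X (\<pi> q) g" unfolding regular_at_def by blast
    then have "v (\<lambda>r. g (\<pi> r)) = differential X \<pi> q v g" by (simp add: differential_def)
    then show "v (\<lambda>r. g (\<pi> r)) = c * horizontal q (\<lambda>r. g (\<pi> r)) + v slope * vertical q (\<lambda>r. g (\<pi> r))"
      by (simp add: c horizontal_pullback[OF q g] vertical_pullback[OF q g])
  qed
  then show "v \<in> {(\<lambda>f. c * horizontal q f + d * vertical q f) |c d. True}" by blast
next
  note p = lift_chart_proj[OF q]
  fix v assume "v \<in> {(\<lambda>f. c * horizontal q f + d * vertical q f) |c d. True}"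
  then obtain c d where v: "v = (\<lambda>f. c * horizontal q f + d * vertical q f)" by blast
  have "differential X \<pi> q v = (\<lambda>f. c * slope_vector (\<pi> q) (slope q) f)"
  proof
    fix g
    show "differential X \<pi> q v g = c * slope_vector (\<pi> q) (slope q) g"
    proof (cases "regular_at X (\<pi> q) g")
      case True
      then obtain W where g: "regular X W g" "\<pi> q \<in> W" unfolding regular_at_def by blast
      then show ?thesis using True
        by (simp add: differential_def v horizontal_pullback[OF q g] vertical_pullback[OF q g])
    qed (simp add: differential_def tangent_not_regular[OF slope_vector_tangent[OF p]])
  qed
  then have "differential X \<pi> q v \<in> \<delta> q" unfolding lift_chart_direction[OF q] span1_def by blast
  moreover have "v \<in> tangent_space Y q"
    unfolding v by (rule tangent_combination[OF horizontal_tangent[OF q] vertical_tangent[OF q]])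
  ultimately show "v \<in> lifted_bundle q" by (simp add: lifted_bundle_def)
qed

lemma frame_lift: "frame Y lifted_bundle lift_chart (\<lambda>q. a (\<pi> q)) slope horizontal vertical"
proof -
  note fs = function_space_Y
  have rest: "regular Y {q \<in> lift_chart. \<pi> q \<in> W} (\<lambda>q. g (\<pi> q))" if g: "regular X W g" for W g
  proof -
    have e: "{q \<in> lift_chart. \<pi> q \<in> W} = lift_chart \<inter> {q \<in> points Y. \<pi> q \<in> W}" using lift_chart_points by blast
    have "openin (zariski Y) (lift_chart \<inter> {q \<in> points Y. \<pi> q \<in> W})"
      by (intro openin_Int lift_chart_open regular_openin[OF fs pullback_regular[OF g]])
    from regular_restrict[OF fs pullback_regular[OF g] this] show ?thesis unfolding e by blast
  qed
  have chV: "{q \<in> lift_chart. \<pi> q \<in> A} = lift_chart" using lift_chart_proj by blast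
  have aV: "regular Y lift_chart (\<lambda>q. a (\<pi> q))" using rest[OF frame_coord1[OF fr]] unfolding chV .
  have h: "regular Y (W \<inter> lift_chart) (\<lambda>q. horizontal q f)" if f: "regular Y W f" for W f
  proof (rule field_regular[OF horizontal_tangent _ _ f])
    show "regular Y lift_chart (\<lambda>q. horizontal q slope)"
      by (rule regular_cong[OF fs regular_const[OF fs lift_chart_open, of 0]]) (rule horizontal_slope)
    fix W g assume g: "regular X W g"
    have e: "{q \<in> lift_chart. \<pi> q \<in> W \<inter> A} = {q \<in> lift_chart. \<pi> q \<in> W}" using lift_chart_proj by blast
    have 1: "regular Y {q \<in> lift_chart. \<pi> q \<in> W} (\<lambda>q. e1 (\<pi> q) g)"
      using rest[OF frame_regular1[OF fr g]] unfolding e .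
    have 2: "regular Y {q \<in> lift_chart. \<pi> q \<in> W} (\<lambda>q. e2 (\<pi> q) g)"
      using rest[OF frame_regular2[OF fr g]] unfolding e .
    have 3: "regular Y {q \<in> lift_chart. \<pi> q \<in> W} slope"
      by (rule regular_restrict[OF fs slope_regular regular_openin[OF fs 1]]) blast
    show "regular Y {q \<in> lift_chart. \<pi> q \<in> W} (\<lambda>q. horizontal q (\<lambda>r. g (\<pi> r)))"
    proof (rule regular_cong[OF fs regular_add[OF fs 1 regular_mult[OF fs 3 2]]])
      fix q assume "q \<in> {q \<in> lift_chart. \<pi> q \<in> W}"
      then have q: "q \<in> lift_chart" "\<pi> q \<in> W" by auto
      show "horizontal q (\<lambda>r. g (\<pi> r)) = e1 (\<pi> q) g + slope q * e2 (\<pi> q) g"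
        using horizontal_pullback[OF q(1) g q(2)] by (simp add: slope_vector_def)
    qed
  qed
  have v: "regular Y (W \<inter> lift_chart) (\<lambda>q. vertical q f)" if f: "regular Y W f" for W f
  proof (rule field_regular[OF vertical_tangent _ _ f])
    show "regular Y lift_chart (\<lambda>q. vertical q slope)"
      by (rule regular_cong[OF fs regular_const[OF fs lift_chart_open, of 1]]) (rule vertical_slope)
    fix W g assume g: "regular X W g"
    show "regular Y {q \<in> lift_chart. \<pi> q \<in> W} (\<lambda>q. vertical q (\<lambda>r. g (\<pi> r)))"
      by (rule regular_cong[OF fs regular_const[OF fs regular_openin[OF fs rest[OF g]], of 0]])
        (use vertical_pullback[OF _ g] in blast)
  qed
  have d: "horizontal q (\<lambda>q. a (\<pi> q)) = 1 \<and> vertical q (\<lambda>q. a (\<pi> q)) = 0" if q: "q \<in> lift_chart" for q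
    using horizontal_pullback[OF q frame_coord1[OF fr]] vertical_pullback[OF q frame_coord1[OF fr]]
      lift_chart_proj[OF q] by (simp add: slope_vector_coord)
  show ?thesis
    unfolding frame_def
  proof (intro conjI ballI allI impI)
    show "openin (zariski Y) lift_chart" by (rule lift_chart_open)
    show "regular Y lift_chart (\<lambda>q. a (\<pi> q))" by (rule aV)
    show "regular Y lift_chart slope" by (rule slope_regular)
    fix q assume q: "q \<in> lift_chart"
    show "horizontal q \<in> tangent_space Y q" "vertical q \<in> tangent_space Y q"
      by (rule horizontal_tangent[OF q], rule vertical_tangent[OF q])
    show "horizontal q (\<lambda>q. a (\<pi> q)) = 1" "horizontal q slope = 0"
      "vertical q (\<lambda>q. a (\<pi> q)) = 0" "vertical q slope = 1"
      using d[OF q] horizontal_slope[OF q] vertical_slope[OF q] by simp_all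
    show "lifted_bundle q = {(\<lambda>f. c * horizontal q f + d * vertical q f) |c d. True}"
      by (rule lifted_bundle_combination[OF q])
  qed (rule h v, assumption)+
qed

end

section \<open>Charts of the tower\<close>

lemma bar_bar: "i \<in> {1, 2} \<Longrightarrow> bar (bar i) = i"
  by (auto simp: bar_def)

lemma bar_in: "i \<in> {1, 2} \<Longrightarrow> bar i \<in> {1, 2}"
  by (auto simp: bar_def)

lemma bar_neq: "bar i = i \<Longrightarrow> i \<notin> {1, 2}"
  by (auto simp: bar_def)

lemma neq_bar: "i \<in> {1, 2} \<Longrightarrow> j \<in> {1, 2} \<Longrightarrow> i \<noteq> j \<Longrightarrow> i = bar j"
  by (auto simp: bar_def)

text \<open>
  A tower over a nonsingular surface with local coordinates on \<open>U\<close>. The coordinates need not vanish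
  simultaneously anywhere; the origin enters only through the node.
\<close>

locale surface_tower =
  fixes S :: "('p, 'k::field_char_0) fspace"
    and M :: "('p, 'k) tower"
    and U :: "'p set"
    and x :: "nat \<Rightarrow> 'p \<Rightarrow> 'k"
  assumes surface: "nonsingular_surface S"
    and tower: "monster_tower S M"
    and coords: "local_coordinates S U x"
begin

lemma level_0: "level M 0 = S"
  using tower by (simp add: monster_tower_def)

lemma level_Suc: "is_line_bundle_space (level M k) (focal M k)
            (level M (Suc k)) (bproj M (Suc k)) (dirn M (Suc k))"
  using tower unfolding monster_tower_def by iprover

lemma level_function_space: "function_space (level M k)"
proof (induction k)
  case 0
  then show ?case
    using surface function_space_prevariety unfolding level_0 nonsingular_surface_def by blast
next
  case (Suc k)
  have "line_bundle_space (level M k) (focal M k) (level M (Suc k)) (bproj M (Suc k)) (dirn M (Suc k))"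
    by (rule line_bundle_space.intro[OF Suc level_Suc])
  then show ?case by (rule line_bundle_space.function_space_Y)
qed

lemma line_bundle:
  "line_bundle_space (level M k) (focal M k) (level M (Suc k)) (bproj M (Suc k)) (dirn M (Suc k))"
  by (rule line_bundle_space.intro[OF level_function_space level_Suc])

lemma bproj_regular_map:
  "regular_map (level M (Suc k)) (level M k) (bproj M (Suc k)) (points (level M (Suc k)))"
  by (rule line_bundle_space.proj_regular[OF line_bundle])

lemma bproj_point: "q \<in> points (level M (Suc k)) \<Longrightarrow> bproj M (Suc k) q \<in> points (level M k)"
  by (rule line_bundle_space.proj_point[OF line_bundle])

text \<open>
  The tangent plane is two-dimensional and \<open>dx\<^sub>1\<close>, \<open>dx\<^sub>2\<close> are independent on it, so the \<open>2 \<times> 2\<close> matrix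
  of their values on a basis is invertible.
\<close>

lemma exists_dual_vectors:
  assumes "p \<in> U"
  shows "\<exists>e\<in>tangent_space S p. e (x 1) = 1 \<and> e (x 2) = 0"
    and "\<exists>e\<in>tangent_space S p. e (x 1) = 0 \<and> e (x 2) = 1"
proof -
  have U: "openin (zariski S) U"
    using coords unfolding local_coordinates_def by (elim conjE)
  have "\<forall>p\<in>U. \<forall>a b. (\<forall>v\<in>tangent_space S p. a * v (x 1) + b * v (x 2) = 0) \<longrightarrow> a = 0 \<and> b = 0"
    using coords unfolding local_coordinates_def by (elim conjE)
  from bspec[OF this assms]
  have indep: "\<And>a b. (\<forall>v\<in>tangent_space S p. a * v (x 1) + b * v (x 2) = 0) \<Longrightarrow> a = 0 \<and> b = 0"
    by iprover
  have "p \<in> points S" using U assms openin_subset by blast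
  then have "is_plane (tangent_space S p)" using surface unfolding nonsingular_surface_def by blast
  then obtain v w where P: "tangent_space S p = {(\<lambda>f. a * v f + b * w f) |a b. True}"
    unfolding is_plane_def by blast
  let ?D = "v (x 1) * w (x 2) - v (x 2) * w (x 1)"
  \<comment> \<open>If the determinant vanishes, each row of the matrix gives a relation between \<open>dx\<^sub>1\<close> and \<open>dx\<^sub>2\<close>.\<close>
  have D: "?D \<noteq> 0"
  proof
    assume D: "?D = 0"
    have 1: "v (x 2) = 0 \<and> - v (x 1) = 0"
    proof (rule indep, rule ballI)
      fix u assume "u \<in> tangent_space S p"
      then obtain a b where u: "u = (\<lambda>f. a * v f + b * w f)" unfolding P by blast
      have "v (x 2) * u (x 1) + - v (x 1) * u (x 2) = - (b * ?D)"
        by (simp add: u algebra_simps)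
      then show "v (x 2) * u (x 1) + - v (x 1) * u (x 2) = 0" by (simp only: D mult_zero_right minus_zero)
    qed
    have 2: "w (x 2) = 0 \<and> - w (x 1) = 0"
    proof (rule indep, rule ballI)
      fix u assume "u \<in> tangent_space S p"
      then obtain a b where u: "u = (\<lambda>f. a * v f + b * w f)" unfolding P by blast
      have "w (x 2) * u (x 1) + - w (x 1) * u (x 2) = a * ?D"
        by (simp add: u algebra_simps)
      then show "w (x 2) * u (x 1) + - w (x 1) * u (x 2) = 0" by (simp only: D mult_zero_right minus_zero)
    qed
    have "(1::'k) = 0 \<and> (1::'k) = 0"
      by (rule indep) (use 1 2 in \<open>auto simp: P\<close>)
    then show False by simp
  qed
  define d where "d = ?D"
  have d: "d \<noteq> 0" "w (x 2) * v (x 1) - v (x 2) * w (x 1) = d" "v (x 1) * w (x 2) - w (x 1) * v (x 2) = d"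
    using D by (simp_all add: d_def mult.commute)
  define e1 e2 where "e1 = (\<lambda>f. (w (x 2) / d) * v f + (- v (x 2) / d) * w f)"
    and "e2 = (\<lambda>f. (- w (x 1) / d) * v f + (v (x 1) / d) * w f)"
  have "e1 \<in> tangent_space S p" "e2 \<in> tangent_space S p"
    unfolding P e1_def e2_def by blast+
  moreover have "e1 (x 1) = 1" "e2 (x 2) = 1"
    using d by (simp_all add: e1_def e2_def flip: diff_divide_distrib)
  moreover have "e1 (x 2) = 0" "e2 (x 1) = 0"
    by (simp_all add: e1_def e2_def mult.commute)
  ultimately show "\<exists>e\<in>tangent_space S p. e (x 1) = 1 \<and> e (x 2) = 0"
    "\<exists>e\<in>tangent_space S p. e (x 1) = 0 \<and> e (x 2) = 1" by blast+
qed

lemma base_frame: "\<exists>e1 e2. frame S (tangent_space S) U (x 1) (x 2) e1 e2"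
proof -
  have fs: "function_space S" using level_function_space[of 0] by (simp add: level_0)
  have U: "openin (zariski S) U" and x: "regular S U (x 1)" "regular S U (x 2)"
    using coords unfolding local_coordinates_def by - (elim conjE; assumption)+
  have *: "\<forall>W g. W \<subseteq> U \<and> regular S W g \<longrightarrow>
        (\<exists>a b. regular S W a \<and> regular S W b \<and>
           (\<forall>p\<in>W. \<forall>v\<in>tangent_space S p. v g = a p * v (x 1) + b p * v (x 2)))"
    using coords unfolding local_coordinates_def by (elim conjE)
  have ex: "\<exists>a b. regular S (W \<inter> U) a \<and> regular S (W \<inter> U) b \<and>
      (\<forall>p\<in>W \<inter> U. \<forall>v\<in>tangent_space S p. v g = a p * v (x 1) + b p * v (x 2))"
    if g: "regular S W g" for W g
  proof -
    have "regular S (W \<inter> U) g"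
      by (rule regular_restrict[OF fs g openin_Int[OF regular_openin[OF fs g] U]]) simp
    then show ?thesis by (intro *[THEN spec, THEN spec, THEN mp] conjI) simp_all
  qed
  obtain e1 where e1: "\<forall>p\<in>U. e1 p \<in> tangent_space S p \<and> e1 p (x 1) = 1 \<and> e1 p (x 2) = 0"
    using bchoice[of U "\<lambda>p e. e \<in> tangent_space S p \<and> e (x 1) = 1 \<and> e (x 2) = 0"]
      exists_dual_vectors(1) by blast
  obtain e2 where e2: "\<forall>p\<in>U. e2 p \<in> tangent_space S p \<and> e2 p (x 1) = 0 \<and> e2 p (x 2) = 1"
    using bchoice[of U "\<lambda>p e. e \<in> tangent_space S p \<and> e (x 1) = 0 \<and> e (x 2) = 1"]
      exists_dual_vectors(2) by blast
  have T: "tangent_space S p = {(\<lambda>f. c * e1 p f + d * e2 p f) |c d. True}" if p: "p \<in> U" for p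
  proof (intro equalityI subsetI)
    fix v assume v: "v \<in> tangent_space S p"
    have "v = (\<lambda>f. v (x 1) * e1 p f + v (x 2) * e2 p f)"
    proof
      fix g
      show "v g = v (x 1) * e1 p g + v (x 2) * e2 p g"
      proof (cases "regular_at S p g")
        case True
        then obtain W where W: "p \<in> W" "regular S W g" unfolding regular_at_def by blast
        from ex[OF W(2)] obtain a b where
          "\<forall>p\<in>W \<inter> U. \<forall>v\<in>tangent_space S p. v g = a p * v (x 1) + b p * v (x 2)" by (elim exE conjE)
        then have ab: "w g = a p * w (x 1) + b p * w (x 2)" if "w \<in> tangent_space S p" for w
          using W(1) p that by blast
        show ?thesis
          using ab[OF v] ab[of "e1 p"] ab[of "e2 p"] e1 e2 p by (simp add: algebra_simps)
      next
        case False
        then show ?thesis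
          using tangent_not_regular[OF v False] tangent_not_regular[OF _ False, of "e1 p"]
            tangent_not_regular[OF _ False, of "e2 p"] e1 e2 p by simp
      qed
    qed
    then show "v \<in> {(\<lambda>f. c * e1 p f + d * e2 p f) |c d. True}" by blast
  next
    fix v assume "v \<in> {(\<lambda>f. c * e1 p f + d * e2 p f) |c d. True}"
    then obtain c d where v: "v = (\<lambda>f. c * e1 p f + d * e2 p f)" by blast
    have "e1 p \<in> tangent_space S p" "e2 p \<in> tangent_space S p" using e1 e2 p by simp_all
    then show "v \<in> tangent_space S p" unfolding v by (rule tangent_combination)
  qed
  have r: "regular S (W \<inter> U) (\<lambda>p. e1 p g) \<and> regular S (W \<inter> U) (\<lambda>p. e2 p g)" if g: "regular S W g" for W g
  proof -
    from ex[OF g] obtain a b where ab: "regular S (W \<inter> U) a" "regular S (W \<inter> U) b"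
      "\<forall>p\<in>W \<inter> U. \<forall>v\<in>tangent_space S p. v g = a p * v (x 1) + b p * v (x 2)" by (elim exE conjE)
    have "regular S (W \<inter> U) (\<lambda>p. e1 p g)"
    proof (rule regular_cong[OF fs ab(1)])
      fix q assume q: "q \<in> W \<inter> U"
      then have "e1 q \<in> tangent_space S q" "e1 q (x 1) = 1" "e1 q (x 2) = 0" using e1 by auto
      then show "e1 q g = a q" using bspec[OF bspec[OF ab(3) q], of "e1 q"] by simp
    qed
    moreover have "regular S (W \<inter> U) (\<lambda>p. e2 p g)"
    proof (rule regular_cong[OF fs ab(2)])
      fix q assume q: "q \<in> W \<inter> U"
      then have "e2 q \<in> tangent_space S q" "e2 q (x 1) = 0" "e2 q (x 2) = 1" using e2 by auto
      then show "e2 q g = b q" using bspec[OF bspec[OF ab(3) q], of "e2 q"] by simp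
    qed
    ultimately show ?thesis by blast
  qed
  have "frame S (tangent_space S) U (x 1) (x 2) e1 e2"
    unfolding frame_def
  proof (intro conjI ballI allI impI U x)
    fix p assume p: "p \<in> U"
    show "e1 p \<in> tangent_space S p" "e2 p \<in> tangent_space S p"
      "e1 p (x 1) = 1" "e1 p (x 2) = 0" "e2 p (x 1) = 0" "e2 p (x 2) = 1"
      using bspec[OF e1 p] bspec[OF e2 p] by simp_all
    show "tangent_space S p = {(\<lambda>f. c * e1 p f + d * e2 p f) |c d. True}" by (rule T[OF p])
  qed (use r in iprover)+
  then show ?thesis by blast
qed

text \<open>The first \<open>k\<close> letters of the string are 1 or 2.\<close>

definition valid :: "nat list \<Rightarrow> nat \<Rightarrow> bool" where
  "valid ps k \<longleftrightarrow> (\<forall>i<k. ps ! i \<in> {1, 2})"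

lemma valid_mono: "valid ps k \<Longrightarrow> j \<le> k \<Longrightarrow> valid ps j"
  by (auto simp: valid_def)

lemma validD: "valid ps k \<Longrightarrow> i < k \<Longrightarrow> ps ! i \<in> {1, 2}"
  by (auto simp: valid_def)

text \<open>\<open>crd ps k i\<close> is \<open>x\<^sub>i(p\<^sub>1 \<dots> p\<^sub>k)\<close> and \<open>ch ps k\<close> is \<open>C(p\<^sub>1 \<dots> p\<^sub>k)\<close>.\<close>

abbreviation "crd \<equiv> active M x"
abbreviation "ch \<equiv> chart M U x"

lemma framed:
  assumes "frame (level M k) (focal M k) (ch ps k) (crd ps k i) (crd ps k j) e1 e2"
  shows "framed_line_bundle (level M k) (focal M k) (level M (Suc k)) (bproj M (Suc k)) (dirn M (Suc k))
     (ch ps k) (crd ps k i) (crd ps k j) e1 e2"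
  by (rule framed_line_bundle.intro[OF line_bundle framed_line_bundle_axioms.intro[OF assms]])

text \<open>
  At level \<open>k + 1\<close> the two active coordinates are the pullback of \<open>a\<close> and the fiber coordinate \<open>db/da\<close>,
  where \<open>a\<close>, \<open>b\<close> are the active coordinates of level \<open>k\<close>; the frame is the lifted one.
\<close>

lemma chart_frame:
  assumes "valid ps k" "i \<in> {1, 2}"
  shows "\<exists>e1 e2. frame (level M k) (focal M k) (ch ps k) (crd ps k i) (crd ps k (bar i)) e1 e2"
  using assms
proof (induction k arbitrary: i)
  case 0
  obtain e1 e2 where f: "frame S (tangent_space S) U (x 1) (x 2) e1 e2" using base_frame by blast
  from 0 consider "i = 1" | "i = 2" by blast
  then show ?case
  proof cases
    case 1
    then show ?thesis using f by (auto simp: level_0 bar_def)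
  next
    case 2
    then show ?thesis using frame_swap[OF f] by (auto simp: level_0 bar_def)
  qed
next
  case (Suc k)
  have pk: "ps ! k \<in> {1, 2}" using Suc.prems(1) by (simp add: valid_def)
  obtain e1 e2 where f: "frame (level M k) (focal M k) (ch ps k) (crd ps k (ps ! k)) (crd ps k (bar (ps ! k))) e1 e2"
    using Suc.IH[OF _ pk] Suc.prems(1) valid_mono by (metis le_SucI order_refl)
  interpret F: framed_line_bundle "level M k" "focal M k" "level M (Suc k)" "bproj M (Suc k)" "dirn M (Suc k)"
     "ch ps k" "crd ps k (ps ! k)" "crd ps k (bar (ps ! k))" e1 e2
    by (rule framed[OF f])
  have c: "F.lift_chart = ch ps (Suc k)" by (auto simp: F.lift_chart_def)
  have l: "F.lifted_bundle = focal M (Suc k)" by (rule ext) (simp add: F.lifted_bundle_def)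
  have 1: "(\<lambda>q. crd ps k (ps ! k) (bproj M (Suc k) q)) = crd ps (Suc k) (ps ! k)" by simp
  have 2: "F.slope = crd ps (Suc k) (bar (ps ! k))" using pk bar_neq[of "ps ! k"] by auto
  have g: "frame (level M (Suc k)) (focal M (Suc k)) (ch ps (Suc k)) (crd ps (Suc k) (ps ! k))
      (crd ps (Suc k) (bar (ps ! k))) F.horizontal F.vertical"
    using F.frame_lift unfolding c l 1 2 .
  show ?case
  proof (cases "i = ps ! k")
    case True
    then show ?thesis using g by blast
  next
    case False
    then have i: "i = bar (ps ! k)" by (rule neq_bar[OF Suc.prems(2) pk])
    show ?thesis unfolding i bar_bar[OF pk] using frame_swap[OF g] by blast
  qed
qed

lemma valid_frame1: "valid ps k \<Longrightarrow> \<exists>e1 e2. frame (level M k) (focal M k) (ch ps k) (crd ps k 1) (crd ps k (bar 1)) e1 e2"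
  by (rule chart_frame) auto

lemma chart_open: "valid ps k \<Longrightarrow> openin (zariski (level M k)) (ch ps k)"
  using valid_frame1 frame_open by metis

lemma chart_points: "valid ps k \<Longrightarrow> ch ps k \<subseteq> points (level M k)"
  using chart_open openin_subset by blast

lemma crd_regular: "valid ps k \<Longrightarrow> i \<in> {1, 2} \<Longrightarrow> regular (level M k) (ch ps k) (crd ps k i)"
  using chart_frame[of ps k i] frame_coord1 by metis

lemma crd_regular_at: "valid ps k \<Longrightarrow> i \<in> {1, 2} \<Longrightarrow> q \<in> ch ps k \<Longrightarrow> regular_at (level M k) q (crd ps k i)"
  unfolding regular_at_def using crd_regular by blast

lemma focal_eqI:
  assumes "valid ps k" "i \<in> {1, 2}" "q \<in> ch ps k" "v \<in> focal M k q" "w \<in> focal M k q"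
    "v (crd ps k i) = w (crd ps k i)" "v (crd ps k (bar i)) = w (crd ps k (bar i))"
  shows "v = w"
  using chart_frame[OF assms(1,2)] frame_eqI assms(3-7) by metis

lemma focal_scale:
  assumes "valid ps k" "q \<in> ch ps k" "v \<in> focal M k q"
  shows "(\<lambda>f. c * v f) \<in> focal M k q"
proof -
  obtain e1 e2 where f: "frame (level M k) (focal M k) (ch ps k) (crd ps k 1) (crd ps k (bar 1)) e1 e2"
    using valid_frame1[OF assms(1)] by blast
  have "(\<lambda>f. c * v f) \<in> span1 v" unfolding span1_def by blast
  then show ?thesis using frame_scale[OF f assms(2,3)] by blast
qed

lemma focal_tangent: "valid ps k \<Longrightarrow> q \<in> ch ps k \<Longrightarrow> focal M k q \<subseteq> tangent_space (level M k) q"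
  using valid_frame1 frame_bundle_tangent by metis

lemma
  assumes "valid ps (Suc k)"
  shows
    chart_eqI: "q \<in> ch ps (Suc k) \<Longrightarrow> r \<in> ch ps (Suc k) \<Longrightarrow> bproj M (Suc k) q = bproj M (Suc k) r \<Longrightarrow>
      crd ps (Suc k) (bar (ps ! k)) q = crd ps (Suc k) (bar (ps ! k)) r \<Longrightarrow> q = r"
    and chart_point_exists: "p \<in> ch ps k \<Longrightarrow>
      \<exists>q\<in>ch ps (Suc k). bproj M (Suc k) q = p \<and> crd ps (Suc k) (bar (ps ! k)) q = c"
    and fiber_curve: "p \<in> ch ps k \<Longrightarrow>
      \<exists>\<gamma>. regular_map affine_line (level M (Suc k)) \<gamma> UNIV \<and>
        (\<forall>s. \<gamma> s \<in> ch ps (Suc k) \<and> bproj M (Suc k) (\<gamma> s) = p \<and> crd ps (Suc k) (bar (ps ! k)) (\<gamma> s) = s)"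
    and chart_direction: "q \<in> ch ps (Suc k) \<Longrightarrow>
      \<exists>w\<in>focal M k (bproj M (Suc k) q). dirn M (Suc k) q = span1 w \<and> w (crd ps k (ps ! k)) = 1 \<and>
        w (crd ps k (bar (ps ! k))) = crd ps (Suc k) (bar (ps ! k)) q"
proof -
  have pk: "ps ! k \<in> {1, 2}" using assms by (simp add: valid_def)
  have vk: "valid ps k" using assms valid_mono le_SucI by blast
  obtain e1 e2 where f: "frame (level M k) (focal M k) (ch ps k) (crd ps k (ps ! k)) (crd ps k (bar (ps ! k))) e1 e2"
    using chart_frame[OF vk pk] by blast
  interpret F: framed_line_bundle "level M k" "focal M k" "level M (Suc k)" "bproj M (Suc k)" "dirn M (Suc k)"
     "ch ps k" "crd ps k (ps ! k)" "crd ps k (bar (ps ! k))" e1 e2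
    by (rule framed[OF f])
  have c: "ch ps (Suc k) = F.lift_chart" by (auto simp: F.lift_chart_def)
  have t: "crd ps (Suc k) (bar (ps ! k)) = F.slope" using pk bar_neq[of "ps ! k"] by auto
  show "q \<in> ch ps (Suc k) \<Longrightarrow> r \<in> ch ps (Suc k) \<Longrightarrow> bproj M (Suc k) q = bproj M (Suc k) r \<Longrightarrow>
      crd ps (Suc k) (bar (ps ! k)) q = crd ps (Suc k) (bar (ps ! k)) r \<Longrightarrow> q = r"
    unfolding c t by (rule F.lift_chart_eqI)
  show "p \<in> ch ps k \<Longrightarrow> \<exists>q\<in>ch ps (Suc k). bproj M (Suc k) q = p \<and> crd ps (Suc k) (bar (ps ! k)) q = c"
    unfolding c t using F.point_of_slope_exists by blast
  show "\<exists>\<gamma>. regular_map affine_line (level M (Suc k)) \<gamma> UNIV \<and>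
        (\<forall>s. \<gamma> s \<in> ch ps (Suc k) \<and> bproj M (Suc k) (\<gamma> s) = p \<and> crd ps (Suc k) (bar (ps ! k)) (\<gamma> s) = s)"
    if p: "p \<in> ch ps k"
    unfolding c t
    using F.fiber_regular_map[OF p] F.point_of_slope[OF p] F.point_of_slope_proj[OF p]
      F.point_of_slope_coord[OF p] by blast
  show "\<exists>w\<in>focal M k (bproj M (Suc k) q). dirn M (Suc k) q = span1 w \<and> w (crd ps k (ps ! k)) = 1 \<and>
        w (crd ps k (bar (ps ! k))) = crd ps (Suc k) (bar (ps ! k)) q"
    if q: "q \<in> ch ps (Suc k)"
  proof -
    have q': "q \<in> F.lift_chart" using q c by blast
    note p = F.lift_chart_proj[OF q']
    show ?thesis unfolding t
      by (rule bexI[OF _ F.slope_vector_bundle[OF p]])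
        (simp only: F.lift_chart_direction[OF q'] F.slope_vector_coord[OF p] simp_thms)
  qed
qed

lemma chart_Suc_proj: "q \<in> ch ps (Suc k) \<Longrightarrow> bproj M (Suc k) q \<in> ch ps k"
  by simp

lemma proj_to_self: "proj_to M k k q = q"
  by (cases k) simp_all

lemma proj_to_chart: "j \<le> k \<Longrightarrow> q \<in> ch ps k \<Longrightarrow> proj_to M j k q \<in> ch ps j"
proof (induction k arbitrary: q)
  case (Suc k)
  show ?case
  proof (cases "j = Suc k")
    case True
    then show ?thesis using Suc.prems by simp
  next
    case False
    then show ?thesis using Suc by simp
  qed
qed simp

lemma proj_to_point: "j \<le> k \<Longrightarrow> q \<in> points (level M k) \<Longrightarrow> proj_to M j k q \<in> points (level M j)"
proof (induction k arbitrary: q)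
  case (Suc k)
  show ?case
  proof (cases "j = Suc k")
    case True
    then show ?thesis using Suc.prems by simp
  next
    case False
    then show ?thesis using Suc bproj_point by simp
  qed
qed simp

lemma bproj_proj_to: "j < k \<Longrightarrow> bproj M (Suc j) (proj_to M (Suc j) k q) = proj_to M j k q"
proof (induction k arbitrary: q)
  case (Suc k)
  show ?case
  proof (cases "j = k")
    case True
    then show ?thesis by (simp add: proj_to_self)
  next
    case False
    then show ?thesis using Suc by simp
  qed
qed simp

text \<open>
  The active coordinate of level \<open>j \<ge> 1\<close> that is not a pullback from level \<open>j - 1\<close>.
\<close>

definition fiber_coord :: "nat list \<Rightarrow> nat \<Rightarrow> 'p \<Rightarrow> 'k" where
  "fiber_coord ps j = crd ps j (bar (ps ! (j - 1)))"

lemma point_with_coords_exists: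
  assumes "valid ps k" "p \<in> U"
  shows "\<exists>q\<in>ch ps k. proj_to M 0 k q = p \<and> (\<forall>j\<in>{1..k}. fiber_coord ps j (proj_to M j k q) = c j)"
  using assms(1)
proof (induction k)
  case 0
  then show ?case using assms(2) by simp
next
  case (Suc k)
  then obtain r where r: "r \<in> ch ps k" "proj_to M 0 k r = p"
    "\<forall>j\<in>{1..k}. fiber_coord ps j (proj_to M j k r) = c j"
    using valid_mono le_SucI by blast
  obtain q where q: "q \<in> ch ps (Suc k)" "bproj M (Suc k) q = r"
    "crd ps (Suc k) (bar (ps ! k)) q = c (Suc k)"
    using chart_point_exists[OF Suc.prems r(1)] by blast
  have "fiber_coord ps j (proj_to M j (Suc k) q) = c j" if j: "j \<in> {1..Suc k}" for j
  proof (cases "j = Suc k")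
    case True
    then show ?thesis using q(3) by (simp add: fiber_coord_def)
  next
    case False
    then show ?thesis using r(3) j q(2) by simp
  qed
  then show ?case using q r by (intro bexI[OF _ q(1)]) simp
qed

lemma point_with_coords_unique:
  assumes "valid ps k" "q \<in> ch ps k" "r \<in> ch ps k" "proj_to M 0 k q = proj_to M 0 k r"
    "\<forall>j\<in>{1..k}. fiber_coord ps j (proj_to M j k q) = fiber_coord ps j (proj_to M j k r)"
  shows "q = r"
  using assms
proof (induction k arbitrary: q r)
  case (Suc k)
  have "bproj M (Suc k) q = bproj M (Suc k) r"
  proof (rule Suc.IH)
    show "valid ps k" using Suc.prems(1) valid_mono le_SucI by blast
    show "bproj M (Suc k) q \<in> ch ps k" "bproj M (Suc k) r \<in> ch ps k" using Suc.prems by simp_all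
    show "proj_to M 0 k (bproj M (Suc k) q) = proj_to M 0 k (bproj M (Suc k) r)"
      using Suc.prems(4) by simp
    show "\<forall>j\<in>{1..k}. fiber_coord ps j (proj_to M j k (bproj M (Suc k) q)) =
        fiber_coord ps j (proj_to M j k (bproj M (Suc k) r))"
    proof
      fix j assume j: "j \<in> {1..k}"
      then have "j \<in> {1..Suc k}" by simp
      from bspec[OF Suc.prems(5) this] j
      show "fiber_coord ps j (proj_to M j k (bproj M (Suc k) q)) =
        fiber_coord ps j (proj_to M j k (bproj M (Suc k) r))" by simp
    qed
  qed
  moreover have "crd ps (Suc k) (bar (ps ! k)) q = crd ps (Suc k) (bar (ps ! k)) r"
    using bspec[OF Suc.prems(5), of "Suc k"] by (simp add: fiber_coord_def del: active.simps)
  ultimately show ?case using chart_eqI[OF Suc.prems(1-3)] by blast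
qed simp

lemma node_chart:
  assumes v: "set ps \<subseteq> {1, 2}" and origin: "\<exists>!p. p \<in> U \<and> x 1 p = 0 \<and> x 2 p = 0"
  shows "node M U x ps \<in> ch ps (length ps)"
    and "\<forall>j\<in>{1..length ps}. fiber_coord ps j (proj_to M j (length ps) (node M U x ps)) = 0"
proof -
  let ?k = "length ps"
  let ?P = "\<lambda>q. q \<in> ch ps ?k \<and>
       x 1 (proj_to M 0 ?k q) = 0 \<and> x 2 (proj_to M 0 ?k q) = 0 \<and>
       (\<forall>j\<in>{1..?k}. crd ps j (bar (ps ! (j - 1))) (proj_to M j ?k q) = 0)"
  have va: "valid ps ?k" unfolding valid_def using v nth_mem by blast
  obtain p where p: "p \<in> U" "x 1 p = 0" "x 2 p = 0" using origin by blast
  obtain q where q: "q \<in> ch ps ?k" "proj_to M 0 ?k q = p"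
    "\<forall>j\<in>{1..?k}. fiber_coord ps j (proj_to M j ?k q) = 0"
    using point_with_coords_exists[OF va p(1), of "\<lambda>_. 0"] by blast
  have "?P q" using q p by (simp add: fiber_coord_def)
  moreover have "r = q" if r: "?P r" for r
  proof (rule point_with_coords_unique[OF va _ q(1)])
    show "r \<in> ch ps ?k" using r by blast
    have "proj_to M 0 ?k r \<in> U" using proj_to_chart[of 0 ?k r ps] r by simp
    then show "proj_to M 0 ?k r = proj_to M 0 ?k q" using origin r p q(2) by metis
    show "\<forall>j\<in>{1..?k}. fiber_coord ps j (proj_to M j ?k r) = fiber_coord ps j (proj_to M j ?k q)"
      using r q(3) by (simp add: fiber_coord_def)
  qed
  ultimately have "?P (THE q. ?P q)" by (rule theI)
  moreover have "node M U x ps = (THE q. ?P q)" by (simp add: node_def Let_def)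
  ultimately have "?P (node M U x ps)" by metis
  then show "node M U x ps \<in> ch ps (length ps)"
    "\<forall>j\<in>{1..length ps}. fiber_coord ps j (proj_to M j (length ps) (node M U x ps)) = 0"
    unfolding fiber_coord_def by blast+
qed

text \<open>
  A point of a chart has a neighborhood that avoids any given other point. Hence within a chart the
  condition of lying over a given point of a lower level is a closed one.
\<close>

lemma chart_T1:
  assumes "valid ps k" "q \<in> ch ps k" "r \<noteq> q"
  shows "\<exists>W. openin (zariski (level M k)) W \<and> q \<in> W \<and> r \<notin> W"
  using assms
proof (induction k arbitrary: q r)
  case 0
  have "prevariety S" using surface by (simp add: nonsingular_surface_def)
  moreover have "q \<in> points S" using chart_points[OF 0(1)] 0(2) by (auto simp: level_0)
  ultimately show ?case using prevariety_T1[of S q r] 0(3) by (auto simp: level_0)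
next
  case (Suc k)
  let ?Y = "level M (Suc k)" and ?t = "crd ps (Suc k) (bar (ps ! k))"
  note fs = level_function_space[of "Suc k"]
  have pk: "bar (ps ! k) \<in> {1, 2}" using validD[OF Suc.prems(1)] bar_in by blast
  show ?case
  proof (cases "r \<in> ch ps (Suc k)")
    case False
    then show ?thesis using chart_open[OF Suc.prems(1)] Suc.prems(2) by blast
  next
    case r: True
    show ?thesis
    proof (cases "bproj M (Suc k) r = bproj M (Suc k) q")
      case True
      then have ne: "?t r \<noteq> ?t q" using chart_eqI[OF Suc.prems(1) r Suc.prems(2)] Suc.prems(3) by blast
      have o: "openin (zariski ?Y) (ch ps (Suc k))" by (rule chart_open[OF Suc.prems(1)])
      have "regular ?Y (ch ps (Suc k)) (\<lambda>s. ?t s + - ?t r)"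
        by (rule regular_add[OF fs crd_regular[OF Suc.prems(1) pk] regular_const[OF fs o]])
      from openin_nonzero[OF fs this]
      have "openin (zariski ?Y) {s \<in> ch ps (Suc k). ?t s + - ?t r \<noteq> 0}" .
      then show ?thesis using ne Suc.prems(2)
        by (intro exI[of _ "{s \<in> ch ps (Suc k). ?t s + - ?t r \<noteq> 0}"])
          (simp del: active.simps chart.simps)
    next
      case False
      obtain W where W: "openin (zariski (level M k)) W" "bproj M (Suc k) q \<in> W" "bproj M (Suc k) r \<notin> W"
        using Suc.IH[OF valid_mono[OF Suc.prems(1)] chart_Suc_proj[OF Suc.prems(2)] False] by auto
      show ?thesis
        using regular_map_vimage[OF fs level_function_space bproj_regular_map W(1)] W(2,3)
          chart_points[OF Suc.prems(1)] Suc.prems(2)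
        by (intro exI[of _ "{z \<in> points ?Y. bproj M (Suc k) z \<in> W}"]) blast
    qed
  qed
qed

end

section \<open>Prolongations of fibers\<close>

text \<open>The velocity at time \<open>s\<close> of a curve parametrized by the affine line.\<close>

definition velocity :: "('p, 'k::field) fspace \<Rightarrow> ('k \<Rightarrow> 'p) \<Rightarrow> 'k \<Rightarrow> ('p, 'k) tvec" where
  "velocity Y \<gamma> s = pushforward Y \<gamma> s (ddt s)"

lemma velocity_eq: "regular_at Y (\<gamma> s) f \<Longrightarrow> velocity Y \<gamma> s f = ddt s (\<lambda>z. f (\<gamma> z))"
  by (simp add: velocity_def pushforward_def)

lemma velocity_tangent:
  fixes Y :: "('p, 'k::field_char_0) fspace"
  assumes "function_space Y" "regular_map affine_line Y \<gamma> UNIV"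
  shows "velocity Y \<gamma> s \<in> tangent_space Y (\<gamma> s)"
  unfolding velocity_def
  by (rule pushforward_tangent[OF function_space_affine_line assms UNIV_I ddt_tangent])

lemma velocity_regular:
  fixes Y :: "('p, 'k::field_char_0) fspace"
  assumes "regular_map affine_line Y \<gamma> UNIV" "regular Y W u"
  shows "regular affine_line {z \<in> UNIV. \<gamma> z \<in> W} (\<lambda>z. velocity Y \<gamma> z u)"
proof (rule regular_cong[OF function_space_affine_line ddt_regular[OF regular_mapD[OF assms]]])
  fix z assume "z \<in> {z \<in> UNIV. \<gamma> z \<in> W}"
  then have "regular_at Y (\<gamma> z) u" unfolding regular_at_def using assms(2) by blast
  then show "velocity Y \<gamma> z u = ddt z (\<lambda>z. u (\<gamma> z))" by (rule velocity_eq)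
qed

lemma ddt_const: "ddt s (\<lambda>z. c) = (0 :: 'k::field_char_0)"
  by (rule tangent_const[OF function_space_affine_line _ ddt_tangent]) simp

lemma ddt_locally_zero:
  assumes "openin (zariski affine_line) W" "s \<in> W" "\<And>z. z \<in> W \<Longrightarrow> f z = 0"
  shows "ddt s f = (0 :: 'k::field_char_0)"
  by (rule tangent_locally_const[OF function_space_affine_line ddt_tangent assms(1,2)]) (rule assms(3))

lemma prolong_closed: "closedin (zariski (level M (Suc k))) (prolong M k C)"
  unfolding prolong_def by simp

context surface_tower
begin

text \<open>
  The equations, in a chart of level \<open>J + 1 + m\<close>, of the \<open>m\<close>-fold prolongation of the fiber of level
  \<open>J + 1\<close> over \<open>p\<close>. Strings are indexed from 0, so \<open>ps ! i\<close> is \<open>p\<^sub>i\<^sub>+\<^sub>1\<close>; the active coordinate that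
  parametrizes the fiber and its prolongations has the index \<open>bar (ps ! J)\<close>.
\<close>

primrec fiber_cond :: "nat list \<Rightarrow> nat \<Rightarrow> 'p \<Rightarrow> nat \<Rightarrow> 'p \<Rightarrow> bool" where
  "fiber_cond ps J p 0 q \<longleftrightarrow> bproj M (Suc J) q = p"
| "fiber_cond ps J p (Suc m) q \<longleftrightarrow> ps ! Suc (J + m) \<noteq> ps ! J \<and>
     crd ps (Suc (Suc (J + m))) (bar (ps ! Suc (J + m))) q = 0 \<and>
     fiber_cond ps J p m (bproj M (Suc (Suc (J + m))) q)"

lemma fiber_cond_base:
  assumes "valid ps (Suc (J + m))" "q \<in> ch ps (Suc (J + m))" "fiber_cond ps J p m q"
  shows "p \<in> ch ps J \<and> (\<forall>i. J < i \<and> i \<le> J + m \<longrightarrow> ps ! i = bar (ps ! J))"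
  using assms
proof (induction m arbitrary: q)
  case 0
  then show ?case by auto
next
  case (Suc m)
  have v: "valid ps (Suc (J + m))" using Suc.prems(1) valid_mono by (metis add_Suc_right le_SucI order_refl)
  have IH: "p \<in> ch ps J \<and> (\<forall>i. J < i \<and> i \<le> J + m \<longrightarrow> ps ! i = bar (ps ! J))"
    by (rule Suc.IH[OF v, of "bproj M (Suc (Suc (J + m))) q"]) (use Suc.prems in simp_all)
  have "ps ! Suc (J + m) = bar (ps ! J)"
    by (rule neq_bar[OF validD[OF Suc.prems(1)] validD[OF Suc.prems(1)]]) (use Suc.prems in simp_all)
  then show ?case using IH by (auto simp: le_Suc_eq)
qed

lemma fiber_cond_unique:
  assumes "valid ps (Suc (J + m))" "q \<in> ch ps (Suc (J + m))" "r \<in> ch ps (Suc (J + m))"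
    "fiber_cond ps J p m q" "fiber_cond ps J p m r"
    "crd ps (Suc (J + m)) (bar (ps ! J)) q = crd ps (Suc (J + m)) (bar (ps ! J)) r"
  shows "q = r"
  using assms
proof (induction m arbitrary: q r)
  case 0
  then show ?case using chart_eqI[of ps J q r] by (simp del: active.simps chart.simps)
next
  case (Suc m)
  let ?k = "Suc (J + m)"
  have v: "valid ps ?k" using Suc.prems(1) valid_mono by (metis add_Suc_right le_SucI order_refl)
  have e: "bar (ps ! J) = ps ! ?k"
    by (rule neq_bar[symmetric, OF validD[OF Suc.prems(1)] validD[OF Suc.prems(1)]]) (use Suc.prems in simp_all)
  have "bproj M (Suc ?k) q = bproj M (Suc ?k) r"
    by (rule Suc.IH[OF v]) (use Suc.prems e in simp_all)
  moreover have "crd ps (Suc ?k) (bar (ps ! ?k)) q = crd ps (Suc ?k) (bar (ps ! ?k)) r"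
    using Suc.prems(4,5) by (simp del: active.simps)
  ultimately show ?case
    using chart_eqI[of ps ?k q r] Suc.prems(1-3) by (simp del: active.simps chart.simps)
qed

text \<open>
  The active coordinate other than the parameter is constant on the prolongation: for \<open>m = 0\<close> it is a
  pullback from level \<open>J\<close>, and otherwise it is the new coordinate, which is required to vanish.
\<close>

lemma fiber_cond_crd:
  assumes "valid ps (Suc (J + m))" "fiber_cond ps J p m q"
  shows "crd ps (Suc (J + m)) (ps ! J) q = (if m = 0 then crd ps J (ps ! J) p else 0)"
proof (cases m)
  case 0
  then show ?thesis using assms(2) by simp
next
  case (Suc n)
  have ne: "ps ! Suc (J + n) \<noteq> ps ! J" using assms(2) Suc by simp
  have J: "ps ! J \<in> {1, 2}" "ps ! Suc (J + n) \<in> {1, 2}" using assms(1) by (simp_all add: valid_def Suc)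
  have "ps ! J = bar (ps ! Suc (J + n))" by (rule neq_bar[OF J ne[symmetric]])
  then show ?thesis using assms(2) Suc by (simp del: active.simps)
qed

lemma fiber_cond_closed:
  assumes "valid ps (Suc (J + m))" "q \<in> ch ps (Suc (J + m))" "\<not> fiber_cond ps J p m q"
  shows "\<exists>W. openin (zariski (level M (Suc (J + m)))) W \<and> q \<in> W \<and> W \<subseteq> ch ps (Suc (J + m)) \<and>
    (\<forall>r\<in>W. \<not> fiber_cond ps J p m r)"
  using assms
proof (induction m arbitrary: q)
  case 0
  let ?Y = "level M (Suc J)"
  have v: "valid ps (Suc J)" "valid ps J" using 0(1) valid_mono[of ps "Suc J" J] by simp_all
  have q: "bproj M (Suc J) q \<in> ch ps J" "p \<noteq> bproj M (Suc J) q" using 0(2,3) by auto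
  obtain W where W: "openin (zariski (level M J)) W" "bproj M (Suc J) q \<in> W" "p \<notin> W"
    using chart_T1[OF v(2) q] by blast
  have o: "openin (zariski ?Y) ({z \<in> points ?Y. bproj M (Suc J) z \<in> W} \<inter> ch ps (Suc J))"
    by (intro openin_Int chart_open v(1)
        regular_map_vimage[OF level_function_space level_function_space bproj_regular_map W(1)])
  show ?case
    using o W chart_points[OF v(1)] 0(2)
    by (intro exI[of _ "{z \<in> points ?Y. bproj M (Suc J) z \<in> W} \<inter> ch ps (Suc J)"])
      (auto simp del: chart.simps)
next
  case (Suc m)
  let ?k = "Suc (J + m)"
  let ?Y = "level M (Suc ?k)" and ?t = "crd ps (Suc ?k) (bar (ps ! ?k))"
  have V: "valid ps (Suc ?k)" using Suc.prems(1) by simp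
  then have v: "valid ps ?k" using valid_mono le_SucI by blast
  have qc: "q \<in> ch ps (Suc ?k)" using Suc.prems(2) by simp
  have pk: "bar (ps ! ?k) \<in> {1, 2}" using validD[OF V] bar_in by blast
  have "\<exists>W. openin (zariski ?Y) W \<and> q \<in> W \<and> W \<subseteq> ch ps (Suc ?k) \<and>
    (\<forall>r\<in>W. \<not> fiber_cond ps J p (Suc m) r)"
  proof (cases "ps ! ?k = ps ! J")
    case True
    then show ?thesis using chart_open[OF V] qc by (intro exI[of _ "ch ps (Suc ?k)"]) simp
  next
    case ne: False
    show ?thesis
    proof (cases "?t q = 0")
      case False
      have "openin (zariski ?Y) {s \<in> ch ps (Suc ?k). ?t s \<noteq> 0}"
        by (rule openin_nonzero[OF level_function_space crd_regular[OF V pk]])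
      moreover have "\<not> fiber_cond ps J p (Suc m) r" if "r \<in> {s \<in> ch ps (Suc ?k). ?t s \<noteq> 0}" for r
        using that by (simp del: chart.simps active.simps)
      ultimately show ?thesis using False qc by blast
    next
      case True
      then have "\<not> fiber_cond ps J p m (bproj M (Suc ?k) q)"
        using Suc.prems(3) ne by (simp del: active.simps)
      from Suc.IH[OF v chart_Suc_proj[OF qc] this]
      obtain W where W: "openin (zariski (level M ?k)) W" "bproj M (Suc ?k) q \<in> W"
        "\<forall>r\<in>W. \<not> fiber_cond ps J p m r" by blast
      have o: "openin (zariski ?Y) ({z \<in> points ?Y. bproj M (Suc ?k) z \<in> W} \<inter> ch ps (Suc ?k))"
        by (intro openin_Int chart_open V
            regular_map_vimage[OF level_function_space level_function_space bproj_regular_map W(1)])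
      show ?thesis
        using o W chart_points[OF V] qc
        by (intro exI[of _ "{z \<in> points ?Y. bproj M (Suc ?k) z \<in> W} \<inter> ch ps (Suc ?k)"])
          (auto simp del: chart.simps active.simps)
    qed
  qed
  then show ?case by (simp del: chart.simps fiber_cond.simps)
qed

lemma differential_velocity:
  assumes "regular_map affine_line (level M (Suc k)) \<gamma> UNIV"
  shows "differential (level M k) (bproj M (Suc k)) (\<gamma> s) (velocity (level M (Suc k)) \<gamma> s) =
    velocity (level M k) (\<lambda>z. bproj M (Suc k) (\<gamma> z)) s"
proof
  fix g
  have p: "\<gamma> s \<in> points (level M (Suc k))" using assms unfolding regular_map_def by blast
  show "differential (level M k) (bproj M (Suc k)) (\<gamma> s) (velocity (level M (Suc k)) \<gamma> s) g =
    velocity (level M k) (\<lambda>z. bproj M (Suc k) (\<gamma> z)) s g"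
  proof (cases "regular_at (level M k) (bproj M (Suc k) (\<gamma> s)) g")
    case True
    have "regular_at (level M (Suc k)) (\<gamma> s) (\<lambda>q. g (bproj M (Suc k) q))"
      by (rule regular_map_regular_at[OF bproj_regular_map p True])
    then show ?thesis using True by (simp add: differential_def velocity_def pushforward_def)
  qed (simp add: differential_def velocity_def pushforward_def)
qed

lemma curve_velocity:
  assumes "valid ps k" "i \<in> {1, 2}" "\<And>s. \<gamma> s \<in> ch ps k"
  shows "velocity (level M k) \<gamma> s (crd ps k i) = ddt s (\<lambda>z. crd ps k i (\<gamma> z))"
  by (rule velocity_eq[OF crd_regular_at[OF assms]])

text \<open>
  Within a chart the prolongation is parametrized by the affine line. The next curve sends a parameter value to
  the line spanned by the velocity of the previous one.
\<close>

lemma prolonged_fiber_curve: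
  assumes "valid ps (Suc (J + m))" "p \<in> ch ps J" "\<forall>i. J < i \<and> i \<le> J + m \<longrightarrow> ps ! i = bar (ps ! J)"
  shows "\<exists>\<gamma>. regular_map affine_line (level M (Suc (J + m))) \<gamma> UNIV \<and>
    (\<forall>s. \<gamma> s \<in> ch ps (Suc (J + m)) \<and> fiber_cond ps J p m (\<gamma> s) \<and>
       crd ps (Suc (J + m)) (bar (ps ! J)) (\<gamma> s) = s \<and>
       velocity (level M (Suc (J + m))) \<gamma> s \<in> focal M (Suc (J + m)) (\<gamma> s))"
  using assms
proof (induction m)
  case 0
  then have v: "valid ps (Suc J)" by simp
  from fiber_curve[OF v 0(2)] obtain \<gamma> where \<gamma>: "regular_map affine_line (level M (Suc J)) \<gamma> UNIV"
    "\<And>s. \<gamma> s \<in> ch ps (Suc J)" "\<And>s. bproj M (Suc J) (\<gamma> s) = p"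
    "\<And>s. crd ps (Suc J) (bar (ps ! J)) (\<gamma> s) = s" by blast
  have "velocity (level M (Suc J)) \<gamma> s \<in> focal M (Suc J) (\<gamma> s)" for s
  proof -
    have "differential (level M J) (bproj M (Suc J)) (\<gamma> s) (velocity (level M (Suc J)) \<gamma> s) = (\<lambda>f. 0)"
      unfolding differential_velocity[OF \<gamma>(1)]
      by (rule ext) (simp add: velocity_def pushforward_def \<gamma>(3) ddt_const)
    moreover obtain w where "dirn M (Suc J) (\<gamma> s) = span1 w" using chart_direction[OF v \<gamma>(2)] by blast
    ultimately show ?thesis
      using velocity_tangent[OF level_function_space \<gamma>(1)] zero_in_span1 by simp
  qed
  then show ?case using \<gamma> by (intro exI[of _ \<gamma>]) (simp del: active.simps chart.simps focal.simps)
next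
  case (Suc m)
  let ?k = "Suc (J + m)"
  let ?X = "level M ?k" and ?Y = "level M (Suc ?k)"
  have V: "valid ps (Suc ?k)" using Suc.prems(1) by simp
  then have v: "valid ps ?k" using valid_mono le_SucI by blast
  have J: "ps ! J \<in> {1, 2}" using validD[OF V] by simp
  have e: "ps ! ?k = bar (ps ! J)" using Suc.prems(3) by simp
  have e': "bar (ps ! ?k) = ps ! J" unfolding e by (rule bar_bar[OF J])
  obtain \<gamma> where \<gamma>: "regular_map affine_line ?X \<gamma> UNIV"
    "\<And>s. \<gamma> s \<in> ch ps ?k" "\<And>s. fiber_cond ps J p m (\<gamma> s)" "\<And>s. crd ps ?k (bar (ps ! J)) (\<gamma> s) = s"
    "\<And>s. velocity ?X \<gamma> s \<in> focal M ?k (\<gamma> s)"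
    using Suc.IH[OF v Suc.prems(2)] Suc.prems(3) by (auto simp del: chart.simps active.simps focal.simps)
  have v1: "velocity ?X \<gamma> s (crd ps ?k (bar (ps ! J))) = 1" for s
    unfolding curve_velocity[OF v bar_in[OF J] \<gamma>(2)] \<gamma>(4) by (rule ddt_ident)
  have v0: "velocity ?X \<gamma> s (crd ps ?k (ps ! J)) = 0" for s
    unfolding curve_velocity[OF v J \<gamma>(2)] fiber_cond_crd[OF v \<gamma>(3)] by (rule ddt_const)
  have "\<exists>q. q \<in> points ?Y \<and> bproj M (Suc ?k) q = \<gamma> s \<and> dirn M (Suc ?k) q = span1 (velocity ?X \<gamma> s)" for s
  proof -
    have 1: "\<gamma> s \<in> points ?X" using chart_points[OF v] \<gamma>(2) by blast
    have 2: "velocity ?X \<gamma> s (crd ps ?k (bar (ps ! J))) \<noteq> 0" by (simp add: v1 del: active.simps)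
    have 3: "span1 (velocity ?X \<gamma> s) \<subseteq> focal M ?k (\<gamma> s)"
      unfolding span1_def using focal_scale[OF v \<gamma>(2) \<gamma>(5)] by blast
    from line_bundle_space.point_exists[OF line_bundle 1 2 3] show ?thesis by blast
  qed
  then obtain \<gamma>' where \<gamma>': "\<And>s. \<gamma>' s \<in> points ?Y" "\<And>s. bproj M (Suc ?k) (\<gamma>' s) = \<gamma> s"
    "\<And>s. dirn M (Suc ?k) (\<gamma>' s) = span1 (velocity ?X \<gamma> s)" by metis
  have reg: "regular_map affine_line ?Y \<gamma>' UNIV"
  proof (rule line_bundle_space.regular_map_lift[OF line_bundle function_space_affine_line])
    show "openin (zariski affine_line) (UNIV :: 'k set)"
      using openin_topspace[of "zariski (affine_line :: ('k,'k) fspace)"] by simp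
    show "range \<gamma>' \<subseteq> points ?Y" using \<gamma>'(1) by blast
    show "regular_map affine_line ?X (\<lambda>z. bproj M (Suc ?k) (\<gamma>' z)) UNIV"
      unfolding \<gamma>'(2) using \<gamma>(1) .
    show "dirn M (Suc ?k) (\<gamma>' z) = span1 (velocity ?X \<gamma> z)" for z by (rule \<gamma>'(3))
    show "regular affine_line {z \<in> UNIV. bproj M (Suc ?k) (\<gamma>' z) \<in> W} (\<lambda>z. velocity ?X \<gamma> z u)"
      if "regular ?X W u" for W u
      unfolding \<gamma>'(2) by (rule velocity_regular[OF \<gamma>(1) that])
  qed
  have c: "\<gamma>' s \<in> ch ps (Suc ?k)" for s
  proof -
    have "nonzero_on (dirn M (Suc ?k) (\<gamma>' s)) (crd ps ?k (ps ! ?k))"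
      unfolding \<gamma>'(3) nonzero_on_span1 e v1 by simp
    moreover have "bproj M (Suc ?k) (\<gamma>' s) \<in> ch ps ?k" unfolding \<gamma>'(2) by (rule \<gamma>(2))
    ultimately show ?thesis using \<gamma>'(1)[of s] chart.simps(2)[of M U x ps ?k] by blast
  qed
  have t: "crd ps (Suc ?k) (bar (ps ! ?k)) (\<gamma>' s) = 0" for s
  proof -
    obtain w where w: "dirn M (Suc ?k) (\<gamma>' s) = span1 w" "w (crd ps ?k (ps ! ?k)) = 1"
      "w (crd ps ?k (bar (ps ! ?k))) = crd ps (Suc ?k) (bar (ps ! ?k)) (\<gamma>' s)"
      using chart_direction[OF V c] by blast
    have "w \<in> span1 (velocity ?X \<gamma> s)" using w(1) \<gamma>'(3) span1_self by metis
    then obtain d where "w = (\<lambda>f. d * velocity ?X \<gamma> s f)" unfolding span1_def by blast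
    then have "w (crd ps ?k (bar (ps ! ?k))) = 0" by (simp add: e' v0 del: active.simps)
    then show ?thesis using w(3) by simp
  qed
  have f: "velocity ?Y \<gamma>' s \<in> focal M (Suc ?k) (\<gamma>' s)" for s
    using velocity_tangent[OF level_function_space reg] differential_velocity[OF reg, of s]
    by (simp add: \<gamma>'(2,3) span1_self)
  have ne: "ps ! ?k \<noteq> ps ! J" using e bar_neq J by metis
  have "regular_map affine_line ?Y \<gamma>' UNIV \<and> (\<forall>s. \<gamma>' s \<in> ch ps (Suc ?k) \<and> fiber_cond ps J p (Suc m) (\<gamma>' s) \<and>
       crd ps (Suc ?k) (bar (ps ! J)) (\<gamma>' s) = s \<and> velocity ?Y \<gamma>' s \<in> focal M (Suc ?k) (\<gamma>' s))"
  proof (intro conjI allI reg c f)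
    fix s
    show "fiber_cond ps J p (Suc m) (\<gamma>' s)"
      using t ne \<gamma>'(2) \<gamma>(3) by (simp del: active.simps)
    have "crd ps (Suc ?k) (ps ! ?k) (\<gamma>' s) = crd ps ?k (ps ! ?k) (\<gamma> s)" by (simp add: \<gamma>'(2) del: active.simps(1))
    then show "crd ps (Suc ?k) (bar (ps ! J)) (\<gamma>' s) = s" unfolding e \<gamma>(4) .
  qed
  then show ?case by (intro exI[of _ \<gamma>']) simp
qed

text \<open>The \<open>m\<close>-fold prolongation of the fiber of level \<open>J + 1\<close> over \<open>p\<close>.\<close>

abbreviation "PF J p m \<equiv> prolong_iter M (Suc J) m (fiber M (Suc J) p)"

lemma tangent_to_sup:
  assumes v: "valid ps (Suc (J + m))" and q: "q \<in> ch ps (Suc (J + m))" "fiber_cond ps J p m q"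
    and claim: "\<And>r. r \<in> ch ps (Suc (J + m)) \<Longrightarrow> fiber_cond ps J p m r \<Longrightarrow> r \<in> PF J p m"
    and w: "w \<in> focal M (Suc (J + m)) q" "w (crd ps (Suc (J + m)) (ps ! J)) = 0"
  shows "w \<in> tangent_to (level M (Suc (J + m))) (PF J p m) q"
proof -
  let ?k = "Suc (J + m)"
  let ?X = "level M ?k"
  have J: "ps ! J \<in> {1, 2}" using validD[OF v] by simp
  note base = fiber_cond_base[OF v q]
  obtain \<gamma> where \<gamma>: "regular_map affine_line ?X \<gamma> UNIV"
    "\<And>s. \<gamma> s \<in> ch ps ?k" "\<And>s. fiber_cond ps J p m (\<gamma> s)" "\<And>s. crd ps ?k (bar (ps ! J)) (\<gamma> s) = s"
    "\<And>s. velocity ?X \<gamma> s \<in> focal M ?k (\<gamma> s)"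
    using prolonged_fiber_curve[OF v conjunct1[OF base] conjunct2[OF base]] by blast
  define s where "s = crd ps ?k (bar (ps ! J)) q"
  have qs: "\<gamma> s = q"
    by (rule fiber_cond_unique[OF v \<gamma>(2) q(1) \<gamma>(3) q(2)]) (simp only: \<gamma>(4) s_def)
  have v1: "velocity ?X \<gamma> s (crd ps ?k (bar (ps ! J))) = 1"
    unfolding curve_velocity[OF v bar_in[OF J] \<gamma>(2)] \<gamma>(4) by (rule ddt_ident)
  have v0: "velocity ?X \<gamma> s (crd ps ?k (ps ! J)) = 0"
    unfolding curve_velocity[OF v J \<gamma>(2)] fiber_cond_crd[OF v \<gamma>(3)] by (rule ddt_const)
  define d where "d = w (crd ps ?k (bar (ps ! J)))"
  have vel: "velocity ?X \<gamma> s \<in> focal M ?k q" using \<gamma>(5)[of s] qs by metis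
  have wd: "w = (\<lambda>f. d * velocity ?X \<gamma> s f)"
    by (rule focal_eqI[OF v J q(1) w(1) focal_scale[OF v q(1) vel]])
      (simp_all only: w(2) v0 v1 d_def mult_1_right mult_zero_right)
  \<comment> \<open>\<open>f\<close> vanishes along the curve \<open>\<gamma>\<close>, of whose velocity \<open>w\<close> is a multiple.\<close>
  have "w f = 0" if f: "q \<in> W" "regular ?X W f" "\<forall>r\<in>PF J p m \<inter> W. f r = 0" for W f
  proof -
    have "regular_at ?X (\<gamma> s) f" unfolding regular_at_def using f(1,2) qs by blast
    then have "velocity ?X \<gamma> s f = ddt s (\<lambda>z. f (\<gamma> z))" by (rule velocity_eq)
    also have "\<dots> = 0"
    proof (rule ddt_locally_zero[OF regular_map_vimage[OF function_space_affine_line level_function_space \<gamma>(1)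
          regular_openin[OF level_function_space f(2)]]])
      show "s \<in> {z \<in> UNIV. \<gamma> z \<in> W}" using qs f(1) by simp
      fix z assume "z \<in> {z \<in> UNIV. \<gamma> z \<in> W}"
      then show "f (\<gamma> z) = 0" using f(3) claim[OF \<gamma>(2,3)] by blast
    qed
    finally show ?thesis by (simp add: wd)
  qed
  then show ?thesis unfolding tangent_to_def using focal_tangent[OF v q(1)] w(1) by blast
qed

lemma tangent_toD:
  assumes "v \<in> tangent_to X C p" "p \<in> W" "regular X W f" "\<And>q. q \<in> C \<Longrightarrow> q \<in> W \<Longrightarrow> f q = 0"
  shows "v f = 0"
proof -
  have "\<forall>W f. p \<in> W \<and> regular X W f \<and> (\<forall>q\<in>C \<inter> W. f q = 0) \<longrightarrow> v f = 0"
    using assms(1) unfolding tangent_to_def by (elim CollectE conjE)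
  from this[THEN spec, THEN spec, THEN mp, of W f] show ?thesis using assms(2-4) by blast
qed

lemma tangent_to_tangent: "v \<in> tangent_to X C p \<Longrightarrow> v \<in> tangent_space X p"
  unfolding tangent_to_def by blast

text \<open>
  On the prolonged fiber the active coordinate \<open>ps ! J\<close> is constant, so its differential vanishes on
  tangent vectors.
\<close>

lemma tangent_to_crd:
  assumes v: "valid ps (Suc (J + m))" and q: "q \<in> ch ps (Suc (J + m))" "fiber_cond ps J p m q"
    and claim: "\<And>r. r \<in> ch ps (Suc (J + m)) \<Longrightarrow> r \<in> PF J p m \<Longrightarrow> fiber_cond ps J p m r"
    and w: "w \<in> tangent_to (level M (Suc (J + m))) (PF J p m) q"
  shows "w (crd ps (Suc (J + m)) (ps ! J)) = 0"
proof -
  let ?k = "Suc (J + m)"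
  let ?X = "level M ?k" and ?a = "crd ps (Suc (J + m)) (ps ! J)"
  let ?c = "- (if m = 0 then crd ps J (ps ! J) p else 0)"
  note fs = level_function_space[of ?k]
  have J: "ps ! J \<in> {1, 2}" using validD[OF v] by simp
  have "regular ?X (ch ps ?k) (\<lambda>r. ?a r + ?c)"
    by (rule regular_add[OF fs crd_regular[OF v J] regular_const[OF fs chart_open[OF v]]])
  from tangent_toD[OF w q(1) this] have "w (\<lambda>r. ?a r + ?c) = 0"
    using claim fiber_cond_crd[OF v] by (simp del: active.simps chart.simps)
  moreover have "w (\<lambda>r. ?a r + ?c) = w ?a + w (\<lambda>r. ?c)"
    by (rule tangent_add[OF tangent_to_tangent[OF w] crd_regular_at[OF v J q(1)] regular_at_const[OF fs]])
      (use chart_points[OF v] q(1) in blast)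
  moreover have "w (\<lambda>r. ?c) = 0"
    by (rule tangent_const[OF fs _ tangent_to_tangent[OF w]]) (use chart_points[OF v] q(1) in blast)
  ultimately show ?thesis by (simp del: active.simps)
qed

text \<open>
  A tangent vector of a fiber is vertical: the pullback of a function, minus a constant, vanishes on
  the fiber.
\<close>

lemma tangent_to_focal_0:
  assumes v: "valid ps (Suc J)" and q: "q \<in> ch ps (Suc J)" "bproj M (Suc J) q = p"
    and w: "w \<in> tangent_to (level M (Suc J)) (fiber M (Suc J) p) q"
  shows "w \<in> focal M (Suc J) q"
proof -
  let ?X = "level M J" and ?Y = "level M (Suc J)" and ?\<pi> = "bproj M (Suc J)"
  note fs = level_function_space[of "Suc J"]
  have qp: "q \<in> points ?Y" using chart_points[OF v] q(1) by blast
  have "differential ?X ?\<pi> q w = (\<lambda>f. 0)"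
  proof
    fix g
    show "differential ?X ?\<pi> q w g = 0"
    proof (cases "regular_at ?X (?\<pi> q) g")
      case True
      then obtain W where W: "?\<pi> q \<in> W" "regular ?X W g" unfolding regular_at_def by blast
      let ?W = "{r \<in> points ?Y. ?\<pi> r \<in> W}"
      have r: "regular ?Y ?W (\<lambda>r. g (?\<pi> r))" by (rule regular_mapD[OF bproj_regular_map W(2)])
      have "regular ?Y ?W (\<lambda>r. g (?\<pi> r) + - g p)"
        by (rule regular_add[OF fs r regular_const[OF fs regular_openin[OF fs r]]])
      from tangent_toD[OF w _ this] have "w (\<lambda>r. g (?\<pi> r) + - g p) = 0"
        using qp W(1) by (simp add: fiber_def)
      moreover have "w (\<lambda>r. g (?\<pi> r) + - g p) = w (\<lambda>r. g (?\<pi> r)) + w (\<lambda>r. - g p)"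
      proof (rule tangent_add[OF tangent_to_tangent[OF w] _ regular_at_const[OF fs qp]])
        show "regular_at ?Y q (\<lambda>r. g (?\<pi> r))"
          by (rule regular_atI[OF _ r]) (use qp W(1) in simp)
      qed
      moreover have "w (\<lambda>r. - g p) = 0"
        by (rule tangent_const[OF fs qp tangent_to_tangent[OF w]])
      ultimately show ?thesis using True by (simp add: differential_def)
    qed (simp add: differential_def)
  qed
  moreover obtain u where "dirn M (Suc J) q = span1 u" using chart_direction[OF v q(1)] by blast
  ultimately show ?thesis using tangent_to_tangent[OF w] zero_in_span1 by simp
qed

lemma direction_of_fiber_cond:
  assumes V: "valid ps (Suc (Suc (J + m)))" and q: "q \<in> ch ps (Suc (Suc (J + m)))" "fiber_cond ps J p (Suc m) q"
  shows "dirn M (Suc (Suc (J + m))) q = {v \<in> focal M (Suc (J + m)) (bproj M (Suc (Suc (J + m))) q).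
    v (crd ps (Suc (J + m)) (ps ! J)) = 0}"
proof -
  let ?k = "Suc (J + m)"
  have v: "valid ps ?k" using V valid_mono le_SucI by blast
  have J: "ps ! J \<in> {1, 2}" "ps ! ?k \<in> {1, 2}" using validD[OF V] by simp_all
  have ne: "ps ! ?k \<noteq> ps ! J" using q(2) by simp
  have e: "ps ! ?k = bar (ps ! J)" by (rule neq_bar[OF J(2,1) ne])
  have e': "bar (ps ! ?k) = ps ! J" unfolding e by (rule bar_bar[OF J(1)])
  note qc = chart_Suc_proj[OF q(1)]
  obtain w where w: "w \<in> focal M ?k (bproj M (Suc ?k) q)" "dirn M (Suc ?k) q = span1 w"
    "w (crd ps ?k (ps ! ?k)) = 1" "w (crd ps ?k (bar (ps ! ?k))) = crd ps (Suc ?k) (bar (ps ! ?k)) q"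
    using chart_direction[OF V q(1)] by blast
  have w1: "w (crd ps ?k (bar (ps ! J))) = 1" using w(3) unfolding e .
  have w0: "w (crd ps ?k (ps ! J)) = 0" using w(4) q(2) unfolding e' by (simp del: active.simps add: e')
  show ?thesis
  proof (intro equalityI subsetI)
    fix u assume "u \<in> dirn M (Suc ?k) q"
    then obtain d where u: "u = (\<lambda>f. d * w f)" unfolding w(2) span1_def by blast
    show "u \<in> {v \<in> focal M ?k (bproj M (Suc ?k) q). v (crd ps ?k (ps ! J)) = 0}"
      using focal_scale[OF v qc w(1)] w0 by (simp add: u del: active.simps focal.simps)
  next
    fix u assume "u \<in> {v \<in> focal M ?k (bproj M (Suc ?k) q). v (crd ps ?k (ps ! J)) = 0}"
    then have u: "u \<in> focal M ?k (bproj M (Suc ?k) q)" "u (crd ps ?k (ps ! J)) = 0" by blast+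
    have "u = (\<lambda>f. u (crd ps ?k (bar (ps ! J))) * w f)"
      by (rule focal_eqI[OF v J(1) qc u(1) focal_scale[OF v qc w(1)]])
        (simp_all only: u(2) w0 w1 mult_1_right mult_zero_right)
    then show "u \<in> dirn M (Suc ?k) q" unfolding w(2) span1_def by blast
  qed
qed

text \<open>
  The prolonged curve projects into the curve below, whose tangent line at \<open>\<pi> q\<close> is the line
  represented by \<open>q\<close>. Hence a tangent vector of the prolonged curve projects into that line, which
  puts it into the focal bundle.
\<close>

lemma tangent_to_focal_Suc:
  assumes V: "valid ps (Suc (Suc (J + m)))" and q: "q \<in> ch ps (Suc (Suc (J + m)))" "fiber_cond ps J p (Suc m) q"
    and claim: "\<And>r. r \<in> ch ps (Suc (Suc (J + m))) \<Longrightarrow> r \<in> PF J p (Suc m) \<Longrightarrow> fiber_cond ps J p (Suc m) r"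
    and claim': "\<And>r. r \<in> ch ps (Suc (J + m)) \<Longrightarrow> fiber_cond ps J p m r \<Longrightarrow> r \<in> PF J p m"
    and T: "\<And>r. r \<in> ch ps (Suc (J + m)) \<Longrightarrow> fiber_cond ps J p m r \<Longrightarrow>
      tangent_to (level M (Suc (J + m))) (PF J p m) r =
        {v \<in> focal M (Suc (J + m)) r. v (crd ps (Suc (J + m)) (ps ! J)) = 0}"
    and w: "w \<in> tangent_to (level M (Suc (Suc (J + m)))) (PF J p (Suc m)) q"
  shows "w \<in> focal M (Suc (Suc (J + m))) q"
proof -
  let ?k = "Suc (J + m)"
  let ?X = "level M ?k" and ?Y = "level M (Suc ?k)" and ?\<pi> = "bproj M (Suc ?k)"
  note fs = level_function_space
  have qp: "q \<in> points ?Y" using chart_points[OF V] q(1) by blast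
  note qc = chart_Suc_proj[OF q(1)]
  have fc: "fiber_cond ps J p m (?\<pi> q)" using q(2) by simp
  have "differential ?X ?\<pi> q w \<in> tangent_to ?X (PF J p m) (?\<pi> q)"
    unfolding tangent_to_def
  proof (intro CollectI conjI allI impI; (elim conjE)?)
    show "differential ?X ?\<pi> q w \<in> tangent_space ?X (?\<pi> q)"
      unfolding differential_pushforward
      by (rule pushforward_tangent[OF fs fs bproj_regular_map qp tangent_to_tangent[OF w]])
    fix W f assume f: "?\<pi> q \<in> W" "regular ?X W f" "\<forall>r\<in>PF J p m \<inter> W. f r = 0"
    let ?W = "{r \<in> points ?Y. ?\<pi> r \<in> W} \<inter> ch ps (Suc ?k)"
    have r: "regular ?Y {r \<in> points ?Y. ?\<pi> r \<in> W} (\<lambda>r. f (?\<pi> r))"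
      by (rule regular_mapD[OF bproj_regular_map f(2)])
    have r': "regular ?Y ?W (\<lambda>r. f (?\<pi> r))"
      by (rule regular_restrict[OF fs r openin_Int[OF regular_openin[OF fs r] chart_open[OF V]]]) blast
    have "w (\<lambda>r. f (?\<pi> r)) = 0"
    proof (rule tangent_toD[OF w _ r'])
      show "q \<in> ?W" using qp f(1) q(1) by blast
      fix r assume r: "r \<in> PF J p (Suc m)" "r \<in> ?W"
      then have rc: "r \<in> ch ps (Suc ?k)" by blast
      have "fiber_cond ps J p m (?\<pi> r)" using claim[OF rc r(1)] by simp
      then have "?\<pi> r \<in> PF J p m" using claim'[OF chart_Suc_proj[OF rc]] by blast
      then show "f (?\<pi> r) = 0" using f(3) r(2) by blast
    qed
    then show "differential ?X ?\<pi> q w f = 0" by (simp add: differential_def)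
  qed
  then have "differential ?X ?\<pi> q w \<in> dirn M (Suc ?k) q"
    unfolding T[OF qc fc] direction_of_fiber_cond[OF V q] .
  then show ?thesis using tangent_to_tangent[OF w] by simp
qed

text \<open>
  The equations and the tangent lines of the prolonged fibers. The two statements are proved together,
  as the tangent lines at one level determine the prolongation in the next.
\<close>

lemma prolonged_fiber:
  assumes "valid ps (Suc (J + m))"
  shows "(\<forall>q\<in>ch ps (Suc (J + m)). q \<in> PF J p m \<longleftrightarrow> fiber_cond ps J p m q) \<and>
    (\<forall>q\<in>ch ps (Suc (J + m)). fiber_cond ps J p m q \<longrightarrow>
      tangent_to (level M (Suc (J + m))) (PF J p m) q =
        {v \<in> focal M (Suc (J + m)) q. v (crd ps (Suc (J + m)) (ps ! J)) = 0})"
  using assms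
proof (induction m)
  case 0
  then have v: "valid ps (Suc J)" by simp
  have claim: "q \<in> PF J p 0 \<longleftrightarrow> fiber_cond ps J p 0 q" if "q \<in> ch ps (Suc J)" for q
    using chart_points[OF v] that by (auto simp: fiber_def simp del: chart.simps)
  have T: "tangent_to (level M (Suc J)) (PF J p 0) q = {v \<in> focal M (Suc J) q. v (crd ps (Suc J) (ps ! J)) = 0}"
    if q: "q \<in> ch ps (Suc J)" "fiber_cond ps J p 0 q" for q
  proof (intro equalityI subsetI)
    fix w assume w: "w \<in> tangent_to (level M (Suc J)) (PF J p 0) q"
    have "w \<in> focal M (Suc J) q"
      by (rule tangent_to_focal_0[OF v q(1)]) (use q(2) w in simp_all)
    moreover have "w (crd ps (Suc J) (ps ! J)) = 0"
      using tangent_to_crd[of ps J 0 q p w] v q claim w by (simp del: active.simps chart.simps)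
    ultimately show "w \<in> {v \<in> focal M (Suc J) q. v (crd ps (Suc J) (ps ! J)) = 0}" by blast
  next
    fix w assume "w \<in> {v \<in> focal M (Suc J) q. v (crd ps (Suc J) (ps ! J)) = 0}"
    then show "w \<in> tangent_to (level M (Suc J)) (PF J p 0) q"
      using tangent_to_sup[of ps J 0 q p w] v q claim by (simp del: active.simps chart.simps focal.simps)
  qed
  show ?case unfolding add_0_right by (intro conjI ballI impI claim T)
next
  case (Suc m)
  let ?k = "Suc (J + m)"
  let ?X = "level M ?k" and ?Y = "level M (Suc ?k)" and ?\<pi> = "bproj M (Suc ?k)"
  have V: "valid ps (Suc ?k)" using Suc.prems(1) by simp
  then have v: "valid ps ?k" using valid_mono le_SucI by blast
  have J: "ps ! J \<in> {1, 2}" "ps ! ?k \<in> {1, 2}" using validD[OF V] by simp_all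
  note IH = Suc.IH[OF v]
  have C: "q \<in> PF J p m \<longleftrightarrow> fiber_cond ps J p m q" if "q \<in> ch ps ?k" for q
    using IH that by blast
  have T: "tangent_to ?X (PF J p m) q = {v \<in> focal M ?k q. v (crd ps ?k (ps ! J)) = 0}"
    if "q \<in> ch ps ?k" "fiber_cond ps J p m q" for q
    using IH that by blast
  define Z where "Z = {q \<in> points ?Y. ?\<pi> q \<in> PF J p m \<and> dirn M (Suc ?k) q = tangent_to ?X (PF J p m) (?\<pi> q)}"
  have E: "PF J p (Suc m) = zariski ?Y closure_of Z"
    by (simp add: prolong_def Z_def)
  have 1: "fiber_cond ps J p (Suc m) q" if q: "q \<in> ch ps (Suc ?k)" "q \<in> Z" for q
  proof -
    note qc = chart_Suc_proj[OF q(1)]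
    have fc: "fiber_cond ps J p m (?\<pi> q)" using C[OF qc] q(2) by (simp add: Z_def)
    have d: "dirn M (Suc ?k) q = {v \<in> focal M ?k (?\<pi> q). v (crd ps ?k (ps ! J)) = 0}"
      using q(2) T[OF qc fc] by (simp add: Z_def del: active.simps focal.simps)
    obtain w where w: "dirn M (Suc ?k) q = span1 w"
      "w (crd ps ?k (ps ! ?k)) = 1" "w (crd ps ?k (bar (ps ! ?k))) = crd ps (Suc ?k) (bar (ps ! ?k)) q"
      using chart_direction[OF V q(1)] by blast
    have w0: "w (crd ps ?k (ps ! J)) = 0" using d w(1) span1_self[of w] by blast
    have ne: "ps ! ?k \<noteq> ps ! J"
    proof
      assume "ps ! ?k = ps ! J"
      then show False using w(2) w0 by (simp only: zero_neq_one)
    qed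
    have e': "bar (ps ! ?k) = ps ! J" by (rule neq_bar[symmetric, OF J ne[symmetric]])
    have "crd ps (Suc ?k) (bar (ps ! ?k)) q = 0" using w(3) w0 unfolding e' by (simp only:)
    then show ?thesis using ne fc by (simp del: active.simps)
  qed
  have 2: "q \<in> Z" if q: "q \<in> ch ps (Suc ?k)" "fiber_cond ps J p (Suc m) q" for q
  proof -
    note qc = chart_Suc_proj[OF q(1)]
    have fc: "fiber_cond ps J p m (?\<pi> q)" using q(2) by simp
    show ?thesis unfolding Z_def
      using chart_points[OF V] q(1) C[OF qc] fc T[OF qc fc] direction_of_fiber_cond[OF V q] by blast
  qed
  have claim: "q \<in> PF J p (Suc m) \<longleftrightarrow> fiber_cond ps J p (Suc m) q" if q: "q \<in> ch ps (Suc ?k)" for q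
  proof
    assume "fiber_cond ps J p (Suc m) q"
    then have "q \<in> Z" using 2 q by blast
    moreover have "Z \<subseteq> zariski ?Y closure_of Z" by (rule closure_of_subset) (auto simp: Z_def)
    ultimately show "q \<in> PF J p (Suc m)" unfolding E by blast
  next
    assume q': "q \<in> PF J p (Suc m)"
    show "fiber_cond ps J p (Suc m) q"
    proof (rule ccontr)
      assume "\<not> fiber_cond ps J p (Suc m) q"
      with fiber_cond_closed[of ps J "Suc m" q p] V q
      obtain W where W: "openin (zariski ?Y) W" "q \<in> W" "W \<subseteq> ch ps (Suc ?k)"
        "\<forall>r\<in>W. \<not> fiber_cond ps J p (Suc m) r"
        by (auto simp del: chart.simps fiber_cond.simps)
      have "\<exists>r\<in>Z. r \<in> W" using q' W(1,2) unfolding E in_closure_of by blast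
      then show False using W(3,4) 1 by blast
    qed
  qed
  have "tangent_to ?Y (PF J p (Suc m)) q = {v \<in> focal M (Suc ?k) q. v (crd ps (Suc ?k) (ps ! J)) = 0}"
    if q: "q \<in> ch ps (Suc ?k)" "fiber_cond ps J p (Suc m) q" for q
  proof (intro equalityI subsetI)
    fix w assume w: "w \<in> tangent_to ?Y (PF J p (Suc m)) q"
    have "w \<in> focal M (Suc ?k) q"
      by (rule tangent_to_focal_Suc[OF V q _ _ T w]) (use claim C in blast)+
    moreover have "w (crd ps (Suc ?k) (ps ! J)) = 0"
      using tangent_to_crd[of ps J "Suc m" q p w] V q claim w
      by (simp del: active.simps chart.simps fiber_cond.simps prolong_iter.simps)
    ultimately show "w \<in> {v \<in> focal M (Suc ?k) q. v (crd ps (Suc ?k) (ps ! J)) = 0}" by blast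
  next
    fix w assume "w \<in> {v \<in> focal M (Suc ?k) q. v (crd ps (Suc ?k) (ps ! J)) = 0}"
    then show "w \<in> tangent_to ?Y (PF J p (Suc m)) q"
      using tangent_to_sup[of ps J "Suc m" q p w] V q claim
      by (simp del: active.simps chart.simps focal.simps fiber_cond.simps prolong_iter.simps)
  qed
  then show ?case using claim by (simp del: active.simps chart.simps focal.simps fiber_cond.simps prolong_iter.simps)
qed

end

section \<open>Code words\<close>

text \<open>
  The occurrences of a symbol \<open>V j\<close> in a code word form an interval of positions beginning with \<open>j\<close>.
\<close>

lemma code_word_nthD:
  assumes "is_code_word w" "i < length w" "w ! i = V j"
  shows "2 \<le> j \<and> j \<le> Suc i \<and> (\<forall>l. j \<le> Suc l \<and> l \<le> i \<longrightarrow> w ! l = V j)"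
  using assms(2,3)
proof (induction i)
  case 0
  then have "w ! 0 = R" using assms(1) by (auto simp: is_code_word_def)
  then show ?case using 0 by simp
next
  case (Suc i)
  have "\<forall>j\<in>{2..length w}. w ! (j - 1) \<in> {R, V j, w ! (j - 2)}"
    using assms(1) by (simp add: is_code_word_def)
  from bspec[OF this, of "Suc (Suc i)"] Suc.prems
  consider "j = Suc (Suc i)" | "w ! i = V j" by auto
  then show ?case
  proof cases
    case 1
    then show ?thesis using Suc.prems by (auto simp: le_Suc_eq)
  next
    case 2
    then show ?thesis using Suc by (auto simp: le_Suc_eq)
  qed
qed

text \<open>
  Positions are counted from 0, so that \<open>j + n - 2\<close> is the index of the \<open>n\<close>-th place of a run of \<open>V j\<close>.
\<close>

lemma code_word_count:
  assumes w: "is_code_word w" and n: "n > 0" and j: "2 \<le> j"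
  shows "n \<le> count_list w (V j) \<longleftrightarrow> j + n - 2 < length w \<and> w ! (j + n - 2) = V j"
proof -
  define A where "A = {i. i < length w \<and> w ! i = V j}"
  have c: "count_list w (V j) = card A"
    by (simp add: count_list_eq_length_filter length_filter_conv_card A_def eq_commute)
  have low: "j - 1 \<le> i" if "i \<in> A" for i
    using code_word_nthD[OF w, of i j] that by (auto simp: A_def)
  have down: "{j - 1..i} \<subseteq> A" if "i \<in> A" for i
    using code_word_nthD[OF w, of i j] that by (auto simp: A_def)
  have fin: "finite A" by (simp add: A_def)
  have "n \<le> card A \<longleftrightarrow> j + n - 2 \<in> A"
  proof
    assume "n \<le> card A"
    show "j + n - 2 \<in> A"
    proof (rule ccontr)
      assume *: "j + n - 2 \<notin> A"
      have "A \<subseteq> {j - 1..<j + n - 2}"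
      proof
        fix i assume i: "i \<in> A"
        have "\<not> j + n - 2 \<le> i"
        proof
          assume "j + n - 2 \<le> i"
          moreover have "j - 1 \<le> j + n - 2" using n j by simp
          ultimately show False using down[OF i] * by auto
        qed
        then show "i \<in> {j - 1..<j + n - 2}" using low[OF i] by simp
      qed
      from card_mono[OF _ this] have "card A \<le> j + n - 2 - (j - 1)" by simp
      then show False using \<open>n \<le> card A\<close> n j by simp
    qed
  next
    assume "j + n - 2 \<in> A"
    from card_mono[OF fin down[OF this]] show "n \<le> card A" using n j by simp
  qed
  then show ?thesis unfolding c by (simp add: A_def)
qed

lemma code_word_count_range:
  assumes "is_code_word w" "count_list w (V j) > 0"
  shows "2 \<le> j \<and> j + count_list w (V j) - 1 \<le> length w"
proof -
  have "V j \<in> set w" using assms(2) count_list_0_iff[of w "V j"] by auto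
  then obtain i where "i < length w" "w ! i = V j" by (auto simp: in_set_conv_nth)
  then have j: "2 \<le> j" using code_word_nthD[OF assms(1)] by blast
  then show ?thesis using code_word_count[OF assms j, of ] by auto
qed

lemma code_word_eqI:
  assumes w: "is_code_word w" "is_code_word w'" and l: "length w = length w'"
    and c: "\<And>j. count_list w (V j) = count_list w' (V j)"
  shows "w = w'"
proof (rule nth_equalityI[OF l])
  fix i assume i: "i < length w"
  have nthV: "v' ! i = V j" if "is_code_word v" "is_code_word v'" "i < length v" "v ! i = V j"
    "\<And>j. count_list v (V j) = count_list v' (V j)" for v v' j
  proof -
    have j: "2 \<le> j" "j \<le> Suc i" using code_word_nthD[OF that(1,3,4)] by auto
    define n where "n = i + 2 - j"
    have n: "n > 0" "j + n - 2 = i" using j by (auto simp: n_def)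
    have "n \<le> count_list v (V j)" using code_word_count[OF that(1) n(1) j(1)] that(3,4) n(2) by simp
    then show ?thesis using code_word_count[OF that(2) n(1) j(1)] that(5) n(2) by simp
  qed
  show "w ! i = w' ! i"
  proof (cases "w ! i")
    case (V j)
    then show ?thesis using nthV[OF w i V c] by simp
  next
    case wR: R
    show ?thesis
    proof (cases "w' ! i")
      case (V j)
      then show ?thesis using nthV[OF w(2,1) _ V c[symmetric]] i l wR by simp
    qed (simp add: wR)
  qed
qed

text \<open>
  The word of the points of the chart of \<open>ps\<close> for which \<open>z l\<close> tells whether the new coordinate of
  level \<open>l\<close> vanishes. Position \<open>k + 1\<close> carries \<open>R\<close> if it is the first one or the coordinate of level
  \<open>k + 1\<close> does not vanish; otherwise it carries the new symbol \<open>V (Suc k)\<close> where a block of \<open>ps\<close>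
  begins, and the preceding symbol inside a block.
\<close>

primrec chart_word :: "nat list \<Rightarrow> (nat \<Rightarrow> bool) \<Rightarrow> nat \<Rightarrow> code_symbol list" where
  "chart_word ps z 0 = []"
| "chart_word ps z (Suc k) = chart_word ps z k @
     [if k = 0 \<or> \<not> z (Suc k) then R
      else if ps ! k \<noteq> ps ! (k - 1) then V (Suc k) else last (chart_word ps z k)]"

lemma length_chart_word: "length (chart_word ps z k) = k"
  by (induction k) simp_all

lemma chart_word_nth:
  "i < k \<Longrightarrow> chart_word ps z k ! i =
     (if i = 0 \<or> \<not> z (Suc i) then R
      else if ps ! i \<noteq> ps ! (i - 1) then V (Suc i) else chart_word ps z k ! (i - 1))"
proof (induction k)
  case (Suc k)
  show ?case
  proof (cases "i = k")
    case True
    have "last (chart_word ps z k) = chart_word ps z k ! (k - 1)" if "k \<noteq> 0"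
      using that by (subst last_conv_nth) (auto simp: length_chart_word simp flip: length_0_conv)
    then show ?thesis using True by (simp add: nth_append length_chart_word)
  next
    case False
    then have i: "i < k" using Suc.prems by simp
    then have "chart_word ps z (Suc k) ! i = chart_word ps z k ! i"
      "chart_word ps z (Suc k) ! (i - 1) = chart_word ps z k ! (i - 1)"
      using less_imp_diff_less[OF i, of 1] by (simp_all add: nth_append length_chart_word)
    then show ?thesis using Suc.IH[OF i] by presburger
  qed
qed simp

declare chart_word.simps [simp del]

lemma chart_word_code_word: "is_code_word (chart_word ps z k)"
  unfolding is_code_word_def length_chart_word
proof (intro conjI impI ballI)
  assume "chart_word ps z k \<noteq> []"
  then have "0 < k" using length_chart_word[of ps z k] by (cases k) (auto simp: chart_word.simps)
  then show "chart_word ps z k ! 0 = R" by (subst chart_word_nth) auto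
next
  fix j assume j: "j \<in> {2..k}"
  then have "j - 1 < k" "Suc (j - 1) = j" "j - 1 - 1 = j - 2" by auto
  then show "chart_word ps z k ! (j - 1) \<in> {R, V j, chart_word ps z k ! (j - 2)}"
    using chart_word_nth[of "j - 1" k ps z] by simp
qed

lemma chart_word_unique:
  assumes "length w = k"
    and "\<And>i. i < k \<Longrightarrow> w ! i = (if i = 0 \<or> \<not> z (Suc i) then R
      else if ps ! i \<noteq> ps ! (i - 1) then V (Suc i) else w ! (i - 1))"
  shows "chart_word ps z k = w"
proof (rule nth_equalityI)
  show "length (chart_word ps z k) = length w" by (simp add: length_chart_word assms(1))
  fix i assume "i < length (chart_word ps z k)"
  then have "i < k" by (simp add: length_chart_word)
  then show "chart_word ps z k ! i = w ! i"
  proof (induction i rule: less_induct)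
    case (less i)
    have "chart_word ps z k ! (i - 1) = w ! (i - 1)" if "i \<noteq> 0"
      using less.IH[of "i - 1"] less.prems that by simp
    then show ?case
      by (subst chart_word_nth[OF less.prems], subst assms(2)[OF less.prems]) auto
  qed
qed

lemma chart_word_cong:
  assumes "\<And>l. l \<in> {1..k} \<Longrightarrow> z l = z' l"
  shows "chart_word ps z k = chart_word ps z' k"
proof (rule chart_word_unique[OF length_chart_word])
  fix i assume "i < k"
  then show "chart_word ps z' k ! i = (if i = 0 \<or> \<not> z (Suc i) then R
      else if ps ! i \<noteq> ps ! (i - 1) then V (Suc i) else chart_word ps z' k ! (i - 1))"
    by (subst chart_word_nth) (use assms[of "Suc i"] in auto)
qed

lemma chart_word_nth_V:
  assumes "\<forall>i<k. ps ! i \<in> {1, 2}" "i < k"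
  shows "chart_word ps z k ! i = V j \<longleftrightarrow>
    2 \<le> j \<and> j \<le> Suc i \<and> (\<forall>l\<in>{j..Suc i}. ps ! (l - 1) \<noteq> ps ! (j - 2) \<and> z l)"
  using assms(2)
proof (induction i)
  case 0
  then show ?case by (subst chart_word_nth) auto
next
  case (Suc i)
  let ?Q = "\<lambda>i. 2 \<le> j \<and> j \<le> Suc i \<and> (\<forall>l\<in>{j..Suc i}. ps ! (l - 1) \<noteq> ps ! (j - 2) \<and> z l)"
  have IH: "chart_word ps z k ! i = V j \<longleftrightarrow> ?Q i" using Suc by simp
  have S: "?Q (Suc i) \<longleftrightarrow> (j = Suc (Suc i) \<or> ?Q i) \<and> ps ! Suc i \<noteq> ps ! (j - 2) \<and> z (Suc (Suc i)) \<and> 2 \<le> j"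
  proof (cases "j \<le> Suc (Suc i)")
    case True
    then show ?thesis
      by (simp only: atLeastAtMostSuc_conv[OF True] ball_simps(7)) (auto simp: le_Suc_eq)
  qed auto
  show ?case
  proof (cases "z (Suc (Suc i))")
    case z: True
    show ?thesis
    proof (cases "ps ! Suc i = ps ! i")
      case True
      have "chart_word ps z k ! Suc i = V j \<longleftrightarrow> ?Q i"
        using Suc.prems z True IH by (subst chart_word_nth) auto
      also have "\<dots> \<longleftrightarrow> ?Q (Suc i)"
      proof -
        have "ps ! i \<noteq> ps ! (j - 2)" if "?Q i"
          using that by (metis atLeastAtMost_iff diff_Suc_1 le_refl)
        then show ?thesis unfolding S using z True by auto
      qed
      finally show ?thesis .
    next
      case False
      have n: "\<not> (?Q i \<and> ps ! Suc i \<noteq> ps ! (j - 2))"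
      proof
        assume *: "?Q i \<and> ps ! Suc i \<noteq> ps ! (j - 2)"
        then have "ps ! i \<noteq> ps ! (j - 2)" by (metis atLeastAtMost_iff diff_Suc_1 le_refl)
        moreover have "ps ! i \<in> {1, 2}" "ps ! Suc i \<in> {1, 2}" "ps ! (j - 2) \<in> {1, 2}"
          using assms(1) Suc.prems * by (metis Suc_lessD, metis, metis Suc_lessD diff_le_self le_less_trans
              less_Suc_eq_le less_trans diff_less_Suc diff_Suc_Suc numeral_2_eq_2 le_trans diff_is_0_eq')
        ultimately show False using * False by auto
      qed
      have "chart_word ps z k ! Suc i = V j \<longleftrightarrow> j = Suc (Suc i)"
        using Suc.prems z False by (subst chart_word_nth) auto
      also have "\<dots> \<longleftrightarrow> ?Q (Suc i)"
        unfolding S using z False n by auto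
      finally show ?thesis .
    qed
  next
    case False
    then show ?thesis
      unfolding S using Suc.prems by (subst chart_word_nth) auto
  qed
qed

text \<open>
  The string changes its letter exactly where the word has the symbol \<open>V j\<close> at position \<open>j\<close>, and the
  coordinates vanish at the positions that do not carry \<open>R\<close>.
\<close>

lemma code_word_realized:
  assumes w: "is_code_word w"
  shows "\<exists>ps z. (\<forall>i<length w. ps ! i \<in> {1, 2}) \<and> chart_word ps z (length w) = w"
proof -
  define a :: "nat \<Rightarrow> nat" where
    "a = rec_nat 1 (\<lambda>i b. if w ! Suc i = V (Suc (Suc i)) then 3 - b else b)"
  have a0: "a 0 = 1" and aS: "a (Suc i) = (if w ! Suc i = V (Suc (Suc i)) then 3 - a i else a i)" for i
    by (simp_all add: a_def)
  have a12: "a i = 1 \<or> a i = 2" for i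
    by (induction i) (auto simp: a0 aS)
  have ne: "3 - a i \<noteq> a i" for i using a12[of i] by auto
  let ?ps = "map a [0..<length w]" and ?z = "\<lambda>l. w ! (l - 1) \<noteq> R"
  have "chart_word ?ps ?z (length w) = w"
  proof (rule chart_word_unique[OF refl])
    fix i assume i: "i < length w"
    show "w ! i = (if i = 0 \<or> \<not> w ! (Suc i - 1) \<noteq> R then R
        else if ?ps ! i \<noteq> ?ps ! (i - 1) then V (Suc i) else w ! (i - 1))"
    proof (cases i)
      case 0
      then have "w ! 0 = R" using w i by (auto simp: is_code_word_def)
      then show ?thesis using 0 by simp
    next
      case (Suc l)
      have "\<forall>j\<in>{2..length w}. w ! (j - 1) \<in> {R, V j, w ! (j - 2)}"
        using w by (simp add: is_code_word_def)
      from bspec[OF this, of "Suc (Suc l)"] i Suc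
      have "w ! Suc l \<in> {R, V (Suc (Suc l)), w ! l}" by simp
      moreover have "?ps ! i = a (Suc l)" "?ps ! (i - 1) = a l" using i Suc by simp_all
      ultimately show ?thesis using Suc ne[of l] by (auto simp: aS)
    qed
  qed
  moreover have "\<forall>i<length w. ?ps ! i \<in> {1, 2}" using a12 by auto
  ultimately show ?thesis by blast
qed

section \<open>The block process on words\<close>

lemma block_decomposition:
  obtains m rest where "p # qs = replicate (Suc m) p @ rest" "dropWhile (\<lambda>r. r = p) qs = rest"
    "m = length (takeWhile (\<lambda>r. r = p) qs)" "rest = [] \<or> rest ! 0 \<noteq> p"
proof -
  let ?m = "length (takeWhile (\<lambda>r. r = p) qs)" and ?rest = "dropWhile (\<lambda>r. r = p) qs"
  have "replicate ?m p = takeWhile (\<lambda>r. r = p) qs"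
    by (rule replicate_length_same) (auto dest: set_takeWhileD)
  then have 1: "p # qs = replicate (Suc ?m) p @ ?rest" by simp
  have 2: "?rest = [] \<or> ?rest ! 0 \<noteq> p"
    using hd_dropWhile[of "\<lambda>r. r = p" qs] by (cases "?rest") (auto simp: hd_conv_nth)
  show thesis by (rule that[OF 1 refl refl 2])
qed

text \<open>
  If \<open>W\<close> follows the recursion of \<open>replace_later_blocks_nth\<close> for the rest of the string after its first
  block, then the first block of constant symbols followed by \<open>W\<close> follows it for the whole string.
\<close>

lemma nth_block_step:
  fixes W :: "'b list"
  assumes "ps = replicate (Suc m) p @ rest" "rest = [] \<or> rest ! 0 \<noteq> p" "length W = length rest"
    and W: "\<And>i. i < length rest \<Longrightarrow> W ! i = (if i = 0 then f 0
      else if rest ! i \<noteq> rest ! (i - 1) then f i else W ! (i - 1))"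
    and i: "i < length ps"
  shows "(replicate (Suc m) s @ W) ! i = (if i = 0 then s
      else if ps ! i \<noteq> ps ! (i - 1) then f (i - Suc m) else (replicate (Suc m) s @ W) ! (i - 1))"
proof (cases "i < Suc m")
  case True
  note True' = less_imp_diff_less[OF True, of 1]
  have "ps ! i = p" "ps ! (i - 1) = p"
    using assms(1) True True' by (simp_all add: nth_append del: replicate_Suc)
  then show ?thesis using True True' by (simp add: nth_append del: replicate_Suc)
next
  case False
  define l where "l = i - Suc m"
  have il: "i = Suc m + l" "l < length rest" using False i assms(1) by (simp_all add: l_def)
  have pi: "ps ! i = rest ! l" by (simp add: assms(1) il nth_append del: replicate_Suc)
  show ?thesis
  proof (cases l)
    case 0
    have "ps ! (i - 1) = p" using il 0 by (simp add: assms(1) nth_append del: replicate_Suc)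
    moreover have "rest ! 0 \<noteq> p" using assms(2) il by auto
    ultimately show ?thesis using il 0 W[of 0] pi by (simp add: nth_append del: replicate_Suc)
  next
    case (Suc n)
    have "ps ! (i - 1) = rest ! (l - 1)" using il Suc by (simp add: assms(1) nth_append del: replicate_Suc)
    then show ?thesis using il Suc W[of l] pi by (simp add: nth_append del: replicate_Suc)
  qed
qed

lemma replace_later_blocks_nth:
  "length (replace_later_blocks j (blocks ps)) = length ps \<and>
   (\<forall>i<length ps. replace_later_blocks j (blocks ps) ! i =
     (if i = 0 then V j else if ps ! i \<noteq> ps ! (i - 1) then V (j + i)
      else replace_later_blocks j (blocks ps) ! (i - 1)))"
proof (induction ps arbitrary: j rule: blocks.induct)
  case (2 p ps)
  obtain m rest where d: "p # ps = replicate (Suc m) p @ rest" "dropWhile (\<lambda>r. r = p) ps = rest"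
    "m = length (takeWhile (\<lambda>r. r = p) ps)" "rest = [] \<or> rest ! 0 \<noteq> p"
    by (rule block_decomposition)
  let ?W = "replace_later_blocks (j + Suc m) (blocks rest)"
  have e: "replace_later_blocks j (blocks (p # ps)) = replicate (Suc m) (V j) @ ?W"
    using d(2,3) by simp
  have IH: "length ?W = length rest" "\<And>i. i < length rest \<Longrightarrow> ?W ! i =
     (if i = 0 then V (j + Suc m + 0) else if rest ! i \<noteq> rest ! (i - 1) then V (j + Suc m + i)
      else ?W ! (i - 1))"
    using 2 unfolding d(2) by simp_all
  have "(replicate (Suc m) (V j) @ ?W) ! i = (if i = 0 then V j else if (p # ps) ! i \<noteq> (p # ps) ! (i - 1)
      then V (j + i) else (replicate (Suc m) (V j) @ ?W) ! (i - 1))" if i: "i < length (p # ps)" for i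
  proof -
    have "(p # ps) ! i = (p # ps) ! (i - 1)" if "i \<noteq> 0" "i < Suc m"
      unfolding d(1) using that less_imp_diff_less[OF that(2), of 1]
      by (simp add: nth_append del: replicate_Suc)
    then show ?thesis
      using nth_block_step[where f = "\<lambda>i. V (j + Suc m + i)" and s = "V j", OF d(1,4) IH i]
      by (cases "i < Suc m") auto
  qed
  moreover have "length (replicate (Suc m) (V j) @ ?W) = length (p # ps)"
    using IH(1) d(1) by (metis length_append length_replicate)
  ultimately show ?case unfolding e by blast
qed simp

lemma replace_blocks_chart_word:
  "replace_blocks (blocks ps) = chart_word ps (\<lambda>_. True) (length ps)"
proof (cases ps)
  case Nil
  then show ?thesis by (simp add: chart_word.simps)
next
  case (Cons p qs)
  obtain m rest where d: "p # qs = replicate (Suc m) p @ rest" "dropWhile (\<lambda>r. r = p) qs = rest"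
    "m = length (takeWhile (\<lambda>r. r = p) qs)" "rest = [] \<or> rest ! 0 \<noteq> p"
    by (rule block_decomposition)
  let ?W = "replace_later_blocks (Suc (Suc m)) (blocks rest)"
  have e: "replace_blocks (blocks (p # qs)) = replicate (Suc m) R @ ?W"
    using d(2,3) by simp
  have IH: "length ?W = length rest" "\<And>i. i < length rest \<Longrightarrow> ?W ! i =
     (if i = 0 then V (Suc (Suc m) + 0) else if rest ! i \<noteq> rest ! (i - 1) then V (Suc (Suc m) + i)
      else ?W ! (i - 1))"
    using replace_later_blocks_nth[of "Suc (Suc m)" rest] by simp_all
  have "chart_word (p # qs) (\<lambda>_. True) (length (p # qs)) = replicate (Suc m) R @ ?W"
  proof (rule chart_word_unique)
    show "length (replicate (Suc m) R @ ?W) = length (p # qs)"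
      using IH(1) d(1) by (metis length_append length_replicate)
    fix i assume i: "i < length (p # qs)"
    have "(p # qs) ! i = (p # qs) ! (i - 1)" if "i \<noteq> 0" "i < Suc m"
      unfolding d(1) using that less_imp_diff_less[OF that(2), of 1]
      by (simp add: nth_append del: replicate_Suc)
    then show "(replicate (Suc m) R @ ?W) ! i = (if i = 0 \<or> \<not> True then R
        else if (p # qs) ! i \<noteq> (p # qs) ! (i - 1) then V (Suc i) else (replicate (Suc m) R @ ?W) ! (i - 1))"
      using nth_block_step[where f = "\<lambda>i. V (Suc (Suc m) + i)" and s = R, OF d(1,4) IH i]
      by (cases "i < Suc m") auto
  qed
  then show ?thesis unfolding Cons e by simp
qed

section \<open>Strata\<close>

context surface_tower
begin

lemma fiber_cond_iff:
  "fiber_cond ps J p m q \<longleftrightarrow> proj_to M J (Suc (J + m)) q = p \<and>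
    (\<forall>i. J < i \<and> i \<le> J + m \<longrightarrow> ps ! i \<noteq> ps ! J \<and>
      fiber_coord ps (Suc i) (proj_to M (Suc i) (Suc (J + m)) q) = 0)"
proof (induction m arbitrary: q)
  case 0
  then show ?case by (auto simp: proj_to_self)
next
  case (Suc m)
  let ?k = "Suc (J + m)"
  have 1: "(J < i \<and> i \<le> J + m \<longrightarrow> ps ! i \<noteq> ps ! J \<and>
        fiber_coord ps (Suc i) (proj_to M (Suc i) ?k (bproj M (Suc ?k) q)) = 0) \<longleftrightarrow>
      (J < i \<and> i \<le> J + m \<longrightarrow> ps ! i \<noteq> ps ! J \<and>
        fiber_coord ps (Suc i) (proj_to M (Suc i) (Suc ?k) q) = 0)" for i
    by auto
  have e: "proj_to M J ?k (bproj M (Suc ?k) q) = proj_to M J (Suc ?k) q"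
    by simp
  have 2: "fiber_coord ps (Suc ?k) (proj_to M (Suc ?k) (Suc ?k) q) = crd ps (Suc ?k) (bar (ps ! ?k)) q"
    by (simp add: fiber_coord_def proj_to_self del: active.simps)
  have "fiber_cond ps J p (Suc m) q \<longleftrightarrow>
     (ps ! ?k \<noteq> ps ! J \<and> fiber_coord ps (Suc ?k) (proj_to M (Suc ?k) (Suc ?k) q) = 0) \<and>
     proj_to M J (Suc ?k) q = p \<and>
     (\<forall>i. J < i \<and> i \<le> J + m \<longrightarrow> ps ! i \<noteq> ps ! J \<and>
       fiber_coord ps (Suc i) (proj_to M (Suc i) (Suc ?k) q) = 0)"
    unfolding fiber_cond.simps(2) Suc.IH 2 by (simp only: 1 e conj_assoc)
  also have "\<dots> \<longleftrightarrow> proj_to M J (Suc (J + Suc m)) q = p \<and>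
    (\<forall>i. J < i \<and> i \<le> J + Suc m \<longrightarrow> ps ! i \<noteq> ps ! J \<and>
      fiber_coord ps (Suc i) (proj_to M (Suc i) (Suc (J + Suc m)) q) = 0)"
    by (auto simp: le_Suc_eq simp del: proj_to.simps)
  finally show ?case .
qed

text \<open>
  The locus \<open>I\<^sub>j[n]\<close> in coordinates: a new block begins at position \<open>j\<close> and extends at least to
  \<open>j + n\<close>, and all the new coordinates vanish on the way. As the letters are 1 and 2, to differ from
  \<open>p\<^sub>j\<^sub>-\<^sub>1\<close> is the same as to be equal to \<open>p\<^sub>j\<close>.
\<close>

lemma infinity_locus_chart:
  assumes v: "valid ps (j + n)" and q: "q \<in> ch ps (j + n)" and j: "2 \<le> j"
  shows "q \<in> infinity_locus M j n \<longleftrightarrow>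
    (\<forall>l\<in>{j..j + n}. ps ! (l - 1) \<noteq> ps ! (j - 2) \<and> fiber_coord ps l (proj_to M l (j + n) q) = 0)"
proof -
  define J where "J = j - 2"
  have jJ: "j + n = Suc (J + Suc n)" "j - 2 = J" "j - 1 = Suc J" "j = Suc (Suc J)" using j by (simp_all add: J_def)
  have v': "valid ps (Suc (J + Suc n))" and q': "q \<in> ch ps (Suc (J + Suc n))" using v q jJ(1) by metis+
  have "q \<in> points (level M (Suc (J + Suc n)))" using chart_points[OF v'] q' by blast
  then have pt: "proj_to M J (Suc (J + Suc n)) q \<in> points (level M J)" by (intro proj_to_point) simp
  have "q \<in> infinity_locus M j n \<longleftrightarrow> (\<exists>p\<in>points (level M J). q \<in> PF J p (Suc n))"
    unfolding infinity_locus_def jJ(2,3) by simp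
  also have "\<dots> \<longleftrightarrow> (\<exists>p\<in>points (level M J). fiber_cond ps J p (Suc n) q)"
    using prolonged_fiber[OF v'] q' by blast
  also have "\<dots> \<longleftrightarrow> (\<forall>i. J < i \<and> i \<le> J + Suc n \<longrightarrow> ps ! i \<noteq> ps ! J \<and>
      fiber_coord ps (Suc i) (proj_to M (Suc i) (j + n) q) = 0)"
    unfolding fiber_cond_iff jJ(1) using pt by blast
  also have "\<dots> \<longleftrightarrow> (\<forall>l\<in>{j..j + n}. ps ! (l - 1) \<noteq> ps ! (j - 2) \<and> fiber_coord ps l (proj_to M l (j + n) q) = 0)"
    (is "?A \<longleftrightarrow> ?B")
  proof
    assume A: ?A
    show ?B
    proof
      fix l assume "l \<in> {j..j + n}"
      then have "J < l - 1 \<and> l - 1 \<le> J + Suc n" "Suc (l - 1) = l" using jJ(4) by auto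
      then show "ps ! (l - 1) \<noteq> ps ! (j - 2) \<and> fiber_coord ps l (proj_to M l (j + n) q) = 0"
        using A jJ(2) by metis
    qed
  next
    assume B: ?B
    show ?A
    proof (intro allI impI)
      fix i assume "J < i \<and> i \<le> J + Suc n"
      then have "Suc i \<in> {j..j + n}" using jJ(4) by auto
      from bspec[OF B this] show "ps ! i \<noteq> ps ! J \<and>
          fiber_coord ps (Suc i) (proj_to M (Suc i) (j + n) q) = 0" using jJ(2) by simp
    qed
  qed
  finally show ?thesis .
qed

lemma prolong_proj:
  assumes C: "closedin (zariski (level M k)) C" and q: "q \<in> prolong M k C"
  shows "bproj M (Suc k) q \<in> C"
proof (rule ccontr)
  let ?Y = "level M (Suc k)" and ?\<pi> = "bproj M (Suc k)"
  assume *: "?\<pi> q \<notin> C"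
  have "q \<in> points ?Y" using q unfolding prolong_def in_closure_of by blast
  then have "q \<in> {r \<in> points ?Y. ?\<pi> r \<in> points (level M k) - C}"
    using bproj_point * by blast
  moreover have "openin (zariski (level M k)) (points (level M k) - C)"
    using C unfolding closedin_def by blast
  then have "openin (zariski ?Y) {r \<in> points ?Y. ?\<pi> r \<in> points (level M k) - C}"
    by (rule regular_map_vimage[OF level_function_space level_function_space bproj_regular_map])
  moreover have "\<exists>r. ?\<pi> r \<in> C \<and> r \<in> T" if "q \<in> T" "openin (zariski ?Y) T" for T
    using conjunct2[OF q[unfolded prolong_def in_closure_of], rule_format, of T] that by auto
  ultimately obtain r where "?\<pi> r \<in> C" "r \<in> {r \<in> points ?Y. ?\<pi> r \<in> points (level M k) - C}"
    by meson
  then show False by simp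
qed

text \<open>
  \<open>I\<^sub>j[n + 1]\<close> projects into \<open>I\<^sub>j[n]\<close>. This holds at all points of the tower, not only over \<open>U\<close>,
  which is needed for inclusions between whole loci \<open>I\<^sub>W\<close>.
\<close>

lemma infinity_locus_proj:
  assumes "2 \<le> j" "q \<in> infinity_locus M j (Suc n)"
  shows "bproj M (Suc (j + n)) q \<in> infinity_locus M j n"
proof -
  obtain i where j: "j = Suc i" using assms(1) by (cases j) auto
  obtain p where p: "p \<in> points (level M (j - 2))"
    "q \<in> prolong M (Suc (i + n)) (prolong M (i + n) (prolong_iter M i n (fiber M i p)))"
    using assms(2) unfolding infinity_locus_def by (auto simp: j)
  have "bproj M (Suc (Suc (i + n))) q \<in> prolong M (i + n) (prolong_iter M i n (fiber M i p))"
    by (rule prolong_proj[OF prolong_closed p(2)])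
  then show ?thesis using p(1) unfolding infinity_locus_def by (auto simp: j)
qed

lemma infinity_locus_down:
  assumes "2 \<le> j" "b \<le> a" "j + a \<le> k" "proj_to M (j + a) k q \<in> infinity_locus M j a"
  shows "proj_to M (j + b) k q \<in> infinity_locus M j b"
  using assms(2-4)
proof (induction a)
  case (Suc a)
  show ?case
  proof (cases "b = Suc a")
    case False
    have "bproj M (Suc (j + a)) (proj_to M (Suc (j + a)) k q) \<in> infinity_locus M j a"
      by (rule infinity_locus_proj[OF assms(1)]) (use Suc.prems(3) in simp)
    then have "proj_to M (j + a) k q \<in> infinity_locus M j a"
      using bproj_proj_to[of "j + a" k q] Suc.prems(2) by simp
    then show ?thesis using Suc.IH Suc.prems False by simp
  qed (use Suc.prems in simp)
qed simp

lemma word_locus_mono: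
  assumes w: "is_code_word w" "is_code_word w'" "length w = length w'"
    and c: "\<And>j. count_list w (V j) \<le> count_list w' (V j)"
  shows "word_locus M w' \<subseteq> word_locus M w"
proof
  fix q assume q: "q \<in> word_locus M w'"
  have "proj_to M (j + (count_list w (V j) - 1)) (length w) q \<in> infinity_locus M j (count_list w (V j) - 1)"
    if j: "j \<in> {2..length w}" "count_list w (V j) > 0" for j
  proof (rule infinity_locus_down)
    have c': "count_list w' (V j) > 0" using c[of j] j(2) by simp
    show "2 \<le> j" using j by simp
    show "count_list w (V j) - 1 \<le> count_list w' (V j) - 1" using c[of j] by simp
    show "j + (count_list w' (V j) - 1) \<le> length w"
      using code_word_count_range[OF w(2) c'] w(3) c' by simp
    show "proj_to M (j + (count_list w' (V j) - 1)) (length w) q \<in> infinity_locus M j (count_list w' (V j) - 1)"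
      using q j(1) c' w(3) by (simp add: word_locus_def Let_def)
  qed
  then show "q \<in> word_locus M w" using q w(3) by (simp add: word_locus_def Let_def)
qed

lemma proj_to_comp:
  "l \<le> m \<Longrightarrow> m \<le> k \<Longrightarrow> proj_to M l m (proj_to M m k q) = proj_to M l k q"
proof (induction k arbitrary: q)
  case (Suc k)
  show ?case
  proof (cases "m = Suc k")
    case True
    then show ?thesis by (simp only: proj_to_self)
  next
    case False
    then show ?thesis using Suc by simp
  qed
qed simp

text \<open>The code word of a point of the chart of \<open>ps\<close>, read off from its coordinates.\<close>

definition word_at :: "nat list \<Rightarrow> nat \<Rightarrow> 'p \<Rightarrow> code_symbol list" where
  "word_at ps k q = chart_word ps (\<lambda>l. fiber_coord ps l (proj_to M l k q) = 0) k"

lemma word_locus_chart: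
  assumes v: "valid ps k" and q: "q \<in> ch ps k" and w: "is_code_word w" "length w = k"
  shows "q \<in> word_locus M w \<longleftrightarrow> (\<forall>j. count_list w (V j) \<le> count_list (word_at ps k q) (V j))"
proof -
  let ?c = "word_at ps k q"
  have c: "is_code_word ?c" "length ?c = k" by (simp_all add: word_at_def chart_word_code_word length_chart_word)
  have *: "proj_to M (j + (n - 1)) k q \<in> infinity_locus M j (n - 1) \<longleftrightarrow> n \<le> count_list ?c (V j)"
    if n: "n = count_list w (V j)" "n > 0" for j n
  proof -
    have r: "2 \<le> j" "j + n - 1 \<le> k" using code_word_count_range[OF w(1), of j] n w(2) by auto
    define m where "m = j + (n - 1)"
    have m: "m \<le> k" "m = j + n - 1" using r(2) n(2) by (auto simp: m_def)
    have "proj_to M m k q \<in> infinity_locus M j (n - 1) \<longleftrightarrow>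
      (\<forall>l\<in>{j..m}. ps ! (l - 1) \<noteq> ps ! (j - 2) \<and> fiber_coord ps l (proj_to M l m (proj_to M m k q)) = 0)"
      unfolding m_def
      by (rule infinity_locus_chart[OF valid_mono[OF v] proj_to_chart[OF _ q] r(1)]) (use m m_def in simp_all)
    also have "\<dots> \<longleftrightarrow> (\<forall>l\<in>{j..m}. ps ! (l - 1) \<noteq> ps ! (j - 2) \<and> fiber_coord ps l (proj_to M l k q) = 0)"
      using proj_to_comp[OF _ m(1)] by auto
    also have "\<dots> \<longleftrightarrow> ?c ! (j + n - 2) = V j"
    proof -
      have "j + n - 2 < k" "Suc (j + n - 2) = m" "j \<le> m" using r m n(2) by simp_all
      then show ?thesis
        using chart_word_nth_V[of k ps "j + n - 2"] v r(1) unfolding valid_def word_at_def by simp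
    qed
    also have "\<dots> \<longleftrightarrow> n \<le> count_list ?c (V j)"
      using code_word_count[OF c(1) n(2) r(1)] r n(2) c(2) by auto
    finally show ?thesis unfolding m_def .
  qed
  have qp: "q \<in> points (level M k)" using chart_points[OF v] q by blast
  have "q \<in> word_locus M w \<longleftrightarrow> (\<forall>j\<in>{2..k}. count_list w (V j) > 0 \<longrightarrow>
      count_list w (V j) \<le> count_list ?c (V j))"
    using * qp by (simp add: word_locus_def Let_def w(2))
  also have "\<dots> \<longleftrightarrow> (\<forall>j. count_list w (V j) \<le> count_list ?c (V j))"
  proof -
    have "j \<in> {2..k}" if "count_list w (V j) > 0" for j
    proof -
      have "2 \<le> j" "j + count_list w (V j) - 1 \<le> k" using code_word_count_range[OF w(1) that] w(2) by simp_all
      with that have "j \<le> k" by linarith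
      with \<open>2 \<le> j\<close> show ?thesis by simp
    qed
    then show ?thesis by (metis gr0I le0)
  qed
  finally show ?thesis .
qed

lemma word_realized:
  assumes w: "is_code_word w" and "U \<noteq> {}"
  shows "\<exists>ps q. valid ps (length w) \<and> q \<in> ch ps (length w) \<and> word_at ps (length w) q = w"
proof -
  obtain p where p: "p \<in> U" using assms(2) by blast
  obtain ps z where ps: "\<forall>i<length w. ps ! i \<in> {1, 2}" "chart_word ps z (length w) = w"
    using code_word_realized[OF w] by blast
  have v: "valid ps (length w)" using ps(1) by (simp add: valid_def)
  \<comment> \<open>Any nonzero value in place of 1 would do.\<close>
  obtain q where q: "q \<in> ch ps (length w)"
    "\<forall>l\<in>{1..length w}. fiber_coord ps l (proj_to M l (length w) q) = (if z l then 0 else 1)"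
    using point_with_coords_exists[OF v p, of "\<lambda>l. if z l then 0 else 1"] by blast
  have "word_at ps (length w) q = chart_word ps z (length w)"
    unfolding word_at_def by (rule chart_word_cong) (use q(2) in auto)
  then show ?thesis using v q(1) ps(2) by metis
qed

lemma stratum_chart:
  assumes v: "valid ps k" and q: "q \<in> ch ps k" and U: "U \<noteq> {}" and w: "is_code_word w" "length w = k"
  shows "q \<in> stratum M w \<longleftrightarrow> w = word_at ps k q"
proof
  let ?c = "word_at ps k q"
  have c: "is_code_word ?c" "length ?c = k" by (simp_all add: word_at_def chart_word_code_word length_chart_word)
  have qc: "q \<in> word_locus M ?c" using word_locus_chart[OF v q c] by simp
  {
    assume s: "q \<in> stratum M w"
    then have "q \<in> word_locus M w" by (simp add: stratum_def)
    then have le: "count_list w (V j) \<le> count_list ?c (V j)" for j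
      using word_locus_chart[OF v q w] by blast
    have "word_locus M ?c \<subseteq> word_locus M w"
      by (rule word_locus_mono[OF w(1) c(1)]) (use w(2) c(2) le in simp_all)
    moreover have "\<not> word_locus M ?c \<subset> word_locus M w"
      using s qc c w(2) unfolding stratum_def by blast
    ultimately have eq: "word_locus M ?c = word_locus M w" by blast
    \<comment> \<open>A point with word \<open>w\<close> lies in the locus of \<open>?c\<close>, so each \<open>V j\<close> is also at most as frequent in
      \<open>?c\<close> as in \<open>w\<close>.\<close>
    obtain ps' r where r: "valid ps' k" "r \<in> ch ps' k" "word_at ps' k r = w"
      using word_realized[OF w(1) U] w(2) by blast
    have "r \<in> word_locus M w" using word_locus_chart[OF r(1,2) w] r(3) by simp
    then have "r \<in> word_locus M ?c" using eq by blast
    then have "count_list ?c (V j) \<le> count_list w (V j)" for j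
      using word_locus_chart[OF r(1,2) c] r(3) by simp
    then show "w = ?c" using le by (intro code_word_eqI[OF w(1) c(1)]) (simp_all add: w(2) c(2) le_antisym)
  }
  {
    assume wc: "w = ?c"
    have "\<not> word_locus M w' \<subset> word_locus M w"
      if w': "is_code_word w'" "length w' = length w" "q \<in> word_locus M w'" for w'
    proof -
      have "count_list w' (V j) \<le> count_list w (V j)" for j
        using word_locus_chart[OF v q w'(1)] w'(2,3) w(2) wc by simp
      then have "word_locus M w \<subseteq> word_locus M w'"
        by (intro word_locus_mono[OF w'(1) w(1) w'(2)])
      then show ?thesis by blast
    qed
    then show "q \<in> stratum M w" unfolding stratum_def using qc wc by blast
  }
qed

lemma code_word_of_chart:
  assumes v: "valid ps k" and q: "q \<in> ch ps k" and U: "U \<noteq> {}"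
  shows "code_word_of M k q = word_at ps k q"
  unfolding code_word_of_def
proof (rule the_equality)
  have c: "is_code_word (word_at ps k q)" "length (word_at ps k q) = k"
    by (simp_all add: word_at_def chart_word_code_word length_chart_word)
  then show "is_code_word (word_at ps k q) \<and> length (word_at ps k q) = k \<and> q \<in> stratum M (word_at ps k q)"
    using stratum_chart[OF v q U c] by blast
next
  fix w assume "is_code_word w \<and> length w = k \<and> q \<in> stratum M w"
  then show "w = word_at ps k q" using stratum_chart[OF v q U] by blast
qed

end

theorem theorem6p6:
  fixes S :: "('p, 'k :: {alg_closed_field, field_char_0}) fspace"
    and M :: "('p, 'k) tower"
    and U :: "'p set"
    and x :: "nat \<Rightarrow> 'p \<Rightarrow> 'k"
    and ps :: "nat list"
  assumes "nonsingular_surface S"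
    and "monster_tower S M"
    and "local_coordinates S U x"
    and "\<exists>!p. p \<in> U \<and> x 1 p = 0 \<and> x 2 p = 0"
    and "set ps \<subseteq> {1, 2}"
  shows "node_word M U x ps = replace_blocks (blocks ps)"
proof -
  interpret surface_tower S M U x by (rule surface_tower.intro[OF assms(1-3)])
  let ?N = "node M U x ps"
  note N = node_chart[OF assms(5,4)]
  have v: "valid ps (length ps)" unfolding valid_def using assms(5) nth_mem by blast
  have "U \<noteq> {}" using assms(4) by blast
  then have "node_word M U x ps = word_at ps (length ps) ?N"
    unfolding node_word_def by (rule code_word_of_chart[OF v N(1)])
  also have "\<dots> = chart_word ps (\<lambda>_. True) (length ps)"
    unfolding word_at_def by (rule chart_word_cong) (use N(2) in simp)
  also have "\<dots> = replace_blocks (blocks ps)" by (rule replace_blocks_chart_word[symmetric])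
  finally show ?thesis .
qed

end
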